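(* Let $\epsilon_1>0$ and $\gamma\in\mathbb{R}$ with $\alpha_{\mathrm{cr}}=1-\gamma+\epsilon_1>0$. The nodal property $$\eta_x<0\ \text{ in }(\mathcal{R}\cup\Gamma)\cap\{x>0\},\qquad \eta_x>0\ \text{ in }(\mathcal{R}\cup\Gamma)\cap\{x<0\},$$ where $\eta=w_1+y$, holds along the global bifurcation curve $\mathscr{C}$, i.e. for every $(w,\alpha)\in\mathscr{C}$.
   Context: Let $\mathcal{R}=\{(x,y):0<y<1\}$, $\Gamma=\{y=1\}$, $\mathcal{B}=\{y=0\}$, and fix $\beta\in(0,1)$. $C_{\mathrm b}^{k+\beta}$ is the space of functions with finite (global) $C^{k+\beta}$ norm; $C_0^k$ is the space of functions whose derivatives up to order $k$ are bounded, continuous and tend to $0$ uniformly at infinity. Define $$\mathcal{X}=\{w=(w_1,w_2)\in(C_{\mathrm b}^{3+\beta}(\overline{\mathcal{R}})\cap C_0^2(\overline{\mathcal{R}}))^2:\ \Delta w=0\text{ in }\mathcal{R},\ w=0\text{ on }\mathcal{B},\ w\text{ even in }x\},$$ and, with right-hand sides evaluated on $\Gamma$, $\mathscr{F}=(\mathscr{F}_1,\mathscr{F}_2)$, $$\mathscr{F}_1(w,\alpha)=w_2+\gamma w_1+\tfrac12\gamma w_1^2,$$ $$\mathscr{F}_2(w,\alpha)=\bigl(\gamma(w_1+w_{1y}+w_1w_{1y})+w_{2y}+1\bigr)^2+\epsilon_1-(1+\epsilon_1-2\alpha w_1)\bigl(w_{1x}^2+(w_{1y}+1)^2\bigr).$$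 Further, $$\kappa(w,\alpha)=\inf_\Gamma(1+\epsilon_1-2\alpha w_1)\bigl(w_{1x}^2+(1+w_{1y})^2\bigr),\quad \lambda(w,\alpha)=\inf_{\mathcal{R}}4(1+\epsilon_1-2\alpha w_1)^2\bigl(w_{1x}^2+(1+w_{1y})^2\bigr),$$ $$\mathcal{U}=\{(w,\alpha)\in\mathcal{X}\times\mathbb{R}:\ \alpha<1-\gamma+\epsilon_1,\ \kappa(w,\alpha)>\epsilon_1,\ \lambda(w,\alpha)>0\}.$$ Local curve: $\mathscr{C}_{\mathrm{loc}}=\{(w^\varepsilon,\alpha_{\mathrm{cr}}-\varepsilon):0<\varepsilon<\varepsilon_*\}$ is a continuous curve of nontrivial ($w\ne0$) solutions of $\mathscr{F}(w,\alpha)=0$ with $w^\varepsilon\to0$ as $\varepsilon\to0$, all satisfying the nodal property. Global curve: $\mathscr{C}=\{(w(s),\alpha(s)):0<s<\infty\}\subset\mathcal{U}$ is the continuous curve of solutions of $\mathscr{F}(w,\alpha)=0$ containing $\mathscr{C}_{\mathrm{loc}}$ provided by analytic global bifurcation: (a) as $s\to\infty$ either $$N(s)=\|w(s)\|_{\mathcal{X}}+\frac{1}{\kappa(w(s),\alpha(s))-\epsilon_1}+\frac{1}{\lambda(w(s),\alpha(s))}+\frac1{\alpha(s)}+\frac{1}{\alpha_{\mathrm{cr}}-\alpha(s)}\to\infty,$$ or there is a sequence $s_n\to\infty$ with $\sup_n N(s_n)<\infty$ such that $\{w(s_n)\}$ has no convergent subsequence in $\mathcal{X}$; (b) near each of its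 points $\mathscr{C}$ admits a real-analytic reparameterization; (c) $(w(s),\alpha(s))\notin\mathscr{C}_{\mathrm{loc}}$ for $s$ sufficiently large. *)

theory Defs
  imports "HOL-Analysis.Analysis"
begin

type_synonym plane = "real \<times> real"

definition strip :: "plane set" where "strip = UNIV \<times> {0<..<1}"
definition closed_strip :: "plane set" where "closed_strip = UNIV \<times> {0..1}"
definition surface :: "plane set" where "surface = UNIV \<times> {1}"
definition bed :: "plane set" where "bed = UNIV \<times> {0}"

section \<open>Function spaces on the closed strip\<close>

text \<open>Functions on the closed strip are total functions on the plane. The partial derivatives only
  depend on the values on the closed strip: the \<open>y\<close>-derivative is one-sided at \<open>y = 0\<close> and
  \<open>y = 1\<close>.\<close>

definition dx :: "(plane \<Rightarrow> real) \<Rightarrow> plane \<Rightarrow> real" where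
  "dx f p = vector_derivative (\<lambda>t. f (t, snd p)) (at (fst p))"

definition dy :: "(plane \<Rightarrow> real) \<Rightarrow> plane \<Rightarrow> real" where
  "dy f p = vector_derivative (\<lambda>t. f (fst p, t)) (at (snd p) within {0..1})"

definition partial :: "nat \<Rightarrow> nat \<Rightarrow> (plane \<Rightarrow> real) \<Rightarrow> plane \<Rightarrow> real" where
  "partial i j f = (dx ^^ i) ((dy ^^ j) f)"

text \<open>\<open>Ck k\<close>: all partial derivatives up to order \<open>k\<close>, in any order of differentiation, exist and are
  continuous up to the boundary. For such functions \<open>partial i j\<close> with \<open>i + j \<le> k\<close> runs through all
  partial derivatives, since the order of differentiation is irrelevant.\<close>

primrec Ck :: "nat \<Rightarrow> (plane \<Rightarrow> real) set" where
  "Ck 0 = {f. continuous_on closed_strip f}"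
| "Ck (Suc k) = {f. continuous_on closed_strip f
     \<and> (\<forall>(x, y) \<in> closed_strip. (\<lambda>t. f (t, y)) differentiable (at x)
           \<and> (\<lambda>t. f (x, t)) differentiable (at y within {0..1}))
     \<and> dx f \<in> Ck k \<and> dy f \<in> Ck k}"

definition holder_quotients :: "real \<Rightarrow> (plane \<Rightarrow> real) \<Rightarrow> real set" where
  "holder_quotients \<beta> f =
     {\<bar>f p - f q\<bar> / dist p q powr \<beta> | p q. p \<in> closed_strip \<and> q \<in> closed_strip \<and> p \<noteq> q}"

definition Cb_holder :: "nat \<Rightarrow> real \<Rightarrow> (plane \<Rightarrow> real) set" where
  "Cb_holder k \<beta> = {f \<in> Ck k.
     (\<forall>i j. i + j \<le> k \<longrightarrow> bounded (partial i j f ` closed_strip))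
     \<and> (\<forall>i j. i + j = k \<longrightarrow> bdd_above (holder_quotients \<beta> (partial i j f)))}"

definition Cb_holder_norm :: "nat \<Rightarrow> real \<Rightarrow> (plane \<Rightarrow> real) \<Rightarrow> real" where
  "Cb_holder_norm k \<beta> f =
     (\<Sum>i\<le>k. \<Sum>j\<le>k - i. SUP p\<in>closed_strip. \<bar>partial i j f p\<bar>)
     + (\<Sum>i\<le>k. Sup (holder_quotients \<beta> (partial i (k - i) f)))"

definition C0 :: "nat \<Rightarrow> (plane \<Rightarrow> real) set" where
  "C0 k = {f \<in> Ck k. \<forall>i j. i + j \<le> k \<longrightarrow>
     bounded (partial i j f ` closed_strip)
     \<and> (partial i j f \<longlongrightarrow> 0) (inf at_infinity (principal closed_strip))}"

section \<open>The space \<open>\<X>\<close>\<close>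

abbreviation comp1 :: "(plane \<Rightarrow> real \<times> real) \<Rightarrow> plane \<Rightarrow> real" where
  "comp1 w \<equiv> \<lambda>p. fst (w p)"

abbreviation comp2 :: "(plane \<Rightarrow> real \<times> real) \<Rightarrow> plane \<Rightarrow> real" where
  "comp2 w \<equiv> \<lambda>p. snd (w p)"

text \<open>Elements are normalised to be \<open>0\<close> off the closed strip, so that equality of functions is
  equality on the closed strip.\<close>

definition X_space :: "real \<Rightarrow> (plane \<Rightarrow> real \<times> real) set" where
  "X_space \<beta> = {w. (\<forall>f \<in> {comp1 w, comp2 w}.
         f \<in> Cb_holder 3 \<beta> \<inter> C0 2
         \<and> (\<forall>p \<in> strip. dx (dx f) p + dy (dy f) p = 0)
         \<and> (\<forall>p \<in> bed. f p = 0)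
         \<and> (\<forall>x. \<forall>y \<in> {0..1}. f (- x, y) = f (x, y)))
     \<and> (\<forall>p. p \<notin> closed_strip \<longrightarrow> w p = 0)}"

definition X_norm :: "real \<Rightarrow> (plane \<Rightarrow> real \<times> real) \<Rightarrow> real" where
  "X_norm \<beta> w = Cb_holder_norm 3 \<beta> (comp1 w) + Cb_holder_norm 3 \<beta> (comp2 w)"

definition X_tendsto ::
    "real \<Rightarrow> ('i \<Rightarrow> plane \<Rightarrow> real \<times> real) \<Rightarrow> (plane \<Rightarrow> real \<times> real) \<Rightarrow> 'i filter \<Rightarrow> bool" where
  "X_tendsto \<beta> u v F \<longleftrightarrow> ((\<lambda>i. X_norm \<beta> (\<lambda>p. u i p - v p)) \<longlongrightarrow> 0) F"

definition X_continuous_on :: "real \<Rightarrow> real set \<Rightarrow> (real \<Rightarrow> plane \<Rightarrow> real \<times> real) \<Rightarrow> bool" where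
  "X_continuous_on \<beta> I u \<longleftrightarrow> (\<forall>s\<in>I. X_tendsto \<beta> u (u s) (at s within I))"

text \<open>Real-analyticity of the curve \<open>t \<mapsto> (u t, a t)\<close> in \<open>\<X> \<times> \<real>\<close>: near each point it is the sum of
  a power series with coefficients \<open>(c n, d n)\<close> in \<open>\<X> \<times> \<real>\<close>.\<close>

definition XR_analytic_on ::
    "real \<Rightarrow> real set \<Rightarrow> (real \<Rightarrow> plane \<Rightarrow> real \<times> real) \<Rightarrow> (real \<Rightarrow> real) \<Rightarrow> bool" where
  "XR_analytic_on \<beta> I u a \<longleftrightarrow> (\<forall>t0\<in>I. \<exists>r>0. \<exists>c d. (\<forall>n. c n \<in> X_space \<beta>) \<and>
     (\<forall>t\<in>I. \<bar>t - t0\<bar> < r \<longrightarrow>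
        X_tendsto \<beta> (\<lambda>N p. \<Sum>n<N. (t - t0) ^ n *\<^sub>R c n p) (u t) sequentially
        \<and> (\<lambda>n. (t - t0) ^ n * d n) sums a t))"

section \<open>The water wave problem\<close>

definition alpha_cr :: "real \<Rightarrow> real \<Rightarrow> real" where
  "alpha_cr \<gamma> \<epsilon>1 = 1 - \<gamma> + \<epsilon>1"

text \<open>\<open>F1\<close> and \<open>F2\<close> take values in the functions on the surface, as functions of \<open>x\<close>.\<close>

definition F1 :: "real \<Rightarrow> (plane \<Rightarrow> real \<times> real) \<Rightarrow> real \<Rightarrow> real \<Rightarrow> real" where
  "F1 \<gamma> w \<alpha> x = (let w1 = comp1 w (x, 1); w2 = comp2 w (x, 1)
     in w2 + \<gamma> * w1 + 1/2 * \<gamma> * w1\<^sup>2)"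

definition F2 :: "real \<Rightarrow> real \<Rightarrow> (plane \<Rightarrow> real \<times> real) \<Rightarrow> real \<Rightarrow> real \<Rightarrow> real" where
  "F2 \<gamma> \<epsilon>1 w \<alpha> x = (let w1 = comp1 w (x, 1); w1x = dx (comp1 w) (x, 1);
       w1y = dy (comp1 w) (x, 1); w2y = dy (comp2 w) (x, 1)
     in (\<gamma> * (w1 + w1y + w1 * w1y) + w2y + 1)\<^sup>2 + \<epsilon>1
        - (1 + \<epsilon>1 - 2 * \<alpha> * w1) * (w1x\<^sup>2 + (w1y + 1)\<^sup>2))"

definition solves :: "real \<Rightarrow> real \<Rightarrow> (plane \<Rightarrow> real \<times> real) \<Rightarrow> real \<Rightarrow> bool" where
  "solves \<gamma> \<epsilon>1 w \<alpha> \<longleftrightarrow> (\<forall>x. F1 \<gamma> w \<alpha> x = 0 \<and> F2 \<gamma> \<epsilon>1 w \<alpha> x = 0)"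

definition kappa :: "real \<Rightarrow> (plane \<Rightarrow> real \<times> real) \<Rightarrow> real \<Rightarrow> real" where
  "kappa \<epsilon>1 w \<alpha> = (INF p\<in>surface. (1 + \<epsilon>1 - 2 * \<alpha> * comp1 w p)
     * ((dx (comp1 w) p)\<^sup>2 + (1 + dy (comp1 w) p)\<^sup>2))"

definition lambda :: "real \<Rightarrow> (plane \<Rightarrow> real \<times> real) \<Rightarrow> real \<Rightarrow> real" where
  "lambda \<epsilon>1 w \<alpha> = (INF p\<in>strip. 4 * (1 + \<epsilon>1 - 2 * \<alpha> * comp1 w p)\<^sup>2
     * ((dx (comp1 w) p)\<^sup>2 + (1 + dy (comp1 w) p)\<^sup>2))"

definition U_set :: "real \<Rightarrow> real \<Rightarrow> real \<Rightarrow> ((plane \<Rightarrow> real \<times> real) \<times> real) set" where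
  "U_set \<beta> \<gamma> \<epsilon>1 = {(w, \<alpha>). w \<in> X_space \<beta> \<and> \<alpha> < 1 - \<gamma> + \<epsilon>1
     \<and> kappa \<epsilon>1 w \<alpha> > \<epsilon>1 \<and> lambda \<epsilon>1 w \<alpha> > 0}"

definition nodal :: "(plane \<Rightarrow> real \<times> real) \<Rightarrow> bool" where
  "nodal w \<longleftrightarrow> (let \<eta> = \<lambda>(x, y). comp1 w (x, y) + y in
     (\<forall>p \<in> (strip \<union> surface) \<inter> {p. fst p > 0}. dx \<eta> p < 0)
     \<and> (\<forall>p \<in> (strip \<union> surface) \<inter> {p. fst p < 0}. dx \<eta> p > 0))"

section \<open>The bifurcation curves\<close>

definition loc_set ::
    "real \<Rightarrow> real \<Rightarrow> real \<Rightarrow> (real \<Rightarrow> plane \<Rightarrow> real \<times> real) \<Rightarrow> ((plane \<Rightarrow> real \<times> real) \<times> real) set" where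
  "loc_set \<gamma> \<epsilon>1 \<epsilon>star wloc = (\<lambda>\<epsilon>. (wloc \<epsilon>, alpha_cr \<gamma> \<epsilon>1 - \<epsilon>)) ` {0<..<\<epsilon>star}"

definition local_curve ::
    "real \<Rightarrow> real \<Rightarrow> real \<Rightarrow> real \<Rightarrow> (real \<Rightarrow> plane \<Rightarrow> real \<times> real) \<Rightarrow> bool" where
  "local_curve \<beta> \<gamma> \<epsilon>1 \<epsilon>star wloc \<longleftrightarrow> \<epsilon>star > 0
     \<and> (\<forall>\<epsilon>\<in>{0<..<\<epsilon>star}. wloc \<epsilon> \<in> X_space \<beta> \<and> wloc \<epsilon> \<noteq> (\<lambda>_. 0)
          \<and> solves \<gamma> \<epsilon>1 (wloc \<epsilon>) (alpha_cr \<gamma> \<epsilon>1 - \<epsilon>) \<and> nodal (wloc \<epsilon>))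
     \<and> X_continuous_on \<beta> {0<..<\<epsilon>star} wloc
     \<and> X_tendsto \<beta> wloc (\<lambda>_. 0) (at_right 0)"

definition blowup_quantity ::
    "real \<Rightarrow> real \<Rightarrow> real \<Rightarrow> (plane \<Rightarrow> real \<times> real) \<Rightarrow> real \<Rightarrow> real" where
  "blowup_quantity \<beta> \<gamma> \<epsilon>1 w \<alpha> = X_norm \<beta> w + 1 / (kappa \<epsilon>1 w \<alpha> - \<epsilon>1)
     + 1 / lambda \<epsilon>1 w \<alpha> + 1 / \<alpha> + 1 / (alpha_cr \<gamma> \<epsilon>1 - \<alpha>)"

definition global_alternative ::
    "real \<Rightarrow> real \<Rightarrow> real \<Rightarrow> (real \<Rightarrow> plane \<Rightarrow> real \<times> real) \<Rightarrow> (real \<Rightarrow> real) \<Rightarrow> bool" where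
  "global_alternative \<beta> \<gamma> \<epsilon>1 w \<alpha> \<longleftrightarrow>
     (let N = \<lambda>s. blowup_quantity \<beta> \<gamma> \<epsilon>1 (w s) (\<alpha> s) in
      filterlim N at_top at_top
      \<or> (\<exists>s :: nat \<Rightarrow> real. (\<forall>n. s n > 0) \<and> filterlim s at_top sequentially
           \<and> bdd_above (range (\<lambda>n. N (s n)))
           \<and> \<not> (\<exists>r v. strict_mono r \<and> v \<in> X_space \<beta>
                    \<and> X_tendsto \<beta> (\<lambda>n. w (s (r n))) v sequentially)))"

text \<open>A local reparameterisation is an increasing homeomorphism \<open>\<sigma>\<close> of an open interval onto a
  neighbourhood of the given parameter value.\<close>

definition locally_analytic_curve ::
    "real \<Rightarrow> (real \<Rightarrow> plane \<Rightarrow> real \<times> real) \<Rightarrow> (real \<Rightarrow> real) \<Rightarrow> bool" where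
  "locally_analytic_curve \<beta> w \<alpha> \<longleftrightarrow> (\<forall>s0>0. \<exists>\<delta>>0. \<exists>\<sigma> :: real \<Rightarrow> real.
     continuous_on {-\<delta><..<\<delta>} \<sigma> \<and> strict_mono_on {-\<delta><..<\<delta>} \<sigma>
     \<and> \<sigma> 0 = s0 \<and> \<sigma> ` {-\<delta><..<\<delta>} \<subseteq> {0<..}
     \<and> XR_analytic_on \<beta> {-\<delta><..<\<delta>} (w \<circ> \<sigma>) (\<alpha> \<circ> \<sigma>))"

definition global_set ::
    "(real \<Rightarrow> plane \<Rightarrow> real \<times> real) \<Rightarrow> (real \<Rightarrow> real) \<Rightarrow> ((plane \<Rightarrow> real \<times> real) \<times> real) set" where
  "global_set w \<alpha> = (\<lambda>s. (w s, \<alpha> s)) ` {0<..}"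

definition global_curve ::
    "real \<Rightarrow> real \<Rightarrow> real \<Rightarrow> ((plane \<Rightarrow> real \<times> real) \<times> real) set
      \<Rightarrow> (real \<Rightarrow> plane \<Rightarrow> real \<times> real) \<Rightarrow> (real \<Rightarrow> real) \<Rightarrow> bool" where
  "global_curve \<beta> \<gamma> \<epsilon>1 Cloc w \<alpha> \<longleftrightarrow>
     global_set w \<alpha> \<subseteq> U_set \<beta> \<gamma> \<epsilon>1
     \<and> (\<forall>s>0. solves \<gamma> \<epsilon>1 (w s) (\<alpha> s))
     \<and> X_continuous_on \<beta> {0<..} w \<and> continuous_on {0<..} \<alpha>
     \<and> Cloc \<subseteq> global_set w \<alpha>
     \<and> global_alternative \<beta> \<gamma> \<epsilon>1 w \<alpha>
     \<and> locally_analytic_curve \<beta> w \<alpha>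
     \<and> (\<forall>\<^sub>F s in at_top. (w s, \<alpha> s) \<notin> Cloc)"

end

theory Submission
  imports Defs "HOL-Complex_Analysis.Conformal_Mappings"
begin

text \<open>The set of parameters with a nodal wave is shown to be open and closed in \<open>{0<..}\<close>. Let
  \<open>A = \<eta>\<^sub>y + \<i> \<eta>\<^sub>x\<close>, let \<open>F\<close> be the holomorphic part of the complex velocity, and \<open>g = - Im F\<close>. On the
  surface \<open>g\<close> is a positive multiple of \<open>\<eta>\<^sub>x\<close>, and the differentiated Bernoulli condition is a Robin
  condition coupling the harmonic functions \<open>\<eta>\<^sub>x\<close> and \<open>g\<close>. A nontrivial wave with \<open>\<eta>\<^sub>x \<le> 0\<close> for
  \<open>x > 0\<close> is strictly nodal, by the strong maximum principle and Hopf's lemma for \<open>\<eta>\<^sub>x\<close> together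
  with the sign of \<open>g\<close>, and its crest is nondegenerate. This gives closedness away from trivial waves.

  For openness, a nearby wave has \<open>\<eta>\<^sub>x < 0\<close> on a bounded part of the surface by uniform
  convergence. On the remaining part the wave is small and \<open>\<alpha> < alpha_cr\<close> makes the Robin coefficient
  subcritical, so testing the two harmonic functions with the cubes of their positive parts,
  with a weight that decouples the surface terms, shows that the positive part of \<open>\<eta>\<^sub>x\<close> vanishes in the
  whole half strip. Near a trivial wave the whole surface is of the second kind, and the
  same estimate for \<open>- \<eta>\<^sub>x\<close> shows that there are no nontrivial waves nearby; thus a nodal family
  cannot reach a trivial wave.\<close>

section \<open>Calculus on the closed strip\<close>

text \<open>The obstacle is the unbounded surface: \<eta>_x tends to zero as x grows, so closeness
  in the norm gives no sign there, and the Robin coefficient may be positive, which rules out a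
  plain maximum principle. The substitute is comparison with the profile y, which satisfies u_y = u
  at y = 1: boundary coefficients below 1 are harmless. For small waves the surface condition
  balances \<open>(\<alpha> + \<gamma>) / \<epsilon>1\<close> against
  \<open>1 + 1 / \<epsilon>1\<close>, the unit thresholds of \<eta>_x and g added with relative
  weight \<open>1 / \<epsilon>1\<close>; this is exactly \<open>\<alpha> < alpha_cr\<close>.
  Dividing by a slightly concave profile instead of y costs a little of this gap, the factor
  \<open>1 - 2 * \<rho>\<close>, and buys a zero-order term, which is needed because the weight
  joining the two functions varies along the surface. The other delicate point is the axis, where
  \<eta>_x vanishes for every wave by symmetry; the sign next to the crest has to be read from
  \<eta>_xx.\<close>

lemma mem_closed_strip [simp]: "(x, y) \<in> closed_strip \<longleftrightarrow> 0 \<le> y \<and> y \<le> 1"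
  by (auto simp: closed_strip_def)

lemma Ck_continuous: "f \<in> Ck k \<Longrightarrow> continuous_on closed_strip f"
  by (cases k) auto

lemma Ck_dx: "f \<in> Ck (Suc k) \<Longrightarrow> dx f \<in> Ck k"
  and Ck_dy: "f \<in> Ck (Suc k) \<Longrightarrow> dy f \<in> Ck k"
  by simp_all

lemma Ck_has_dx:
  assumes "f \<in> Ck (Suc k)" "0 \<le> y" "y \<le> 1"
  shows "((\<lambda>t. f (t, y)) has_real_derivative dx f (x, y)) (at x)"
proof -
  have "\<forall>(x, y)\<in>closed_strip. (\<lambda>t. f (t, y)) differentiable (at x)"
    using assms(1) by auto
  then have "(\<lambda>t. f (t, y)) differentiable (at x)" using assms by force
  then show ?thesis
    by (simp add: dx_def has_real_derivative_iff_has_vector_derivative vector_derivative_works)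
qed

lemma Ck_has_dy:
  assumes "f \<in> Ck (Suc k)" "0 \<le> y" "y \<le> 1"
  shows "((\<lambda>t. f (x, t)) has_real_derivative dy f (x, y)) (at y within {0..1})"
proof -
  have "\<forall>(x, y)\<in>closed_strip. (\<lambda>t. f (x, t)) differentiable (at y within {0..1})"
    using assms(1) by auto
  then have "(\<lambda>t. f (x, t)) differentiable (at y within {0..1})" using assms by force
  then show ?thesis
    by (simp add: dy_def has_real_derivative_iff_has_vector_derivative vector_derivative_works)
qed

lemma dx_eqI: "((\<lambda>t. f (t, y)) has_real_derivative d) (at x) \<Longrightarrow> dx f (x, y) = d"
  by (simp add: dx_def has_real_derivative_iff_has_vector_derivative vector_derivative_at)

lemma dy_eqI:
  assumes "((\<lambda>t. f (x, t)) has_real_derivative d) (at y within {0..1})" "0 \<le> y" "y \<le> 1"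
  shows "dy f (x, y) = d"
  using assms
  by (simp add: dy_def has_real_derivative_iff_has_vector_derivative
      vector_derivative_within_closed_interval)

lemma continuous_on_strip_section_x:
  assumes "continuous_on closed_strip f" "0 \<le> y" "y \<le> 1"
  shows "continuous_on S (\<lambda>t. f (t, y))"
proof -
  have "continuous_on S (f \<circ> (\<lambda>t. (t, y)))"
    by (rule continuous_on_compose)
      (use assms in \<open>auto intro!: continuous_intros intro: continuous_on_subset\<close>)
  then show ?thesis by (simp add: o_def)
qed

lemma continuous_on_strip_section_y:
  assumes "continuous_on closed_strip f"
  shows "continuous_on {0..1} (\<lambda>t. f (x, t))"
proof -
  have "continuous_on {0..1} (f \<circ> (\<lambda>t. (x, t)))"
    by (rule continuous_on_compose)
      (use assms in \<open>auto intro!: continuous_intros intro: continuous_on_subset\<close>)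
  then show ?thesis by (simp add: o_def)
qed

text \<open>Schwarz's theorem up to the boundary: f(x,z) - f(x,0) is the integral of f_y, which may
  be differentiated in x under the integral; the fundamental theorem in z then gives the mixed
  derivative, one-sided at y = 0 and y = 1.\<close>

lemma mixed_partials:
  assumes f: "f \<in> Ck (Suc (Suc k))" and y: "0 \<le> y" "y \<le> 1"
  shows "dy (dx f) (x, y) = dx (dy f) (x, y)"
proof (rule dy_eqI[OF _ y])
  have fy: "dy f \<in> Ck (Suc k)" and fx: "dx f \<in> Ck (Suc k)" using f by simp_all
  note cyx = Ck_continuous[OF Ck_dx[OF fy]]
  have incr: "f (x, z) - f (x, 0) = integral {0..z} (\<lambda>t. dy f (x, t))"
    if "0 \<le> z" "z \<le> 1" for x z
  proof -
    have "((\<lambda>t. dy f (x, t)) has_integral (f (x, z) - f (x, 0))) {0..z}"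
      using that
      by (intro fundamental_theorem_of_calculus)
        (auto simp flip: has_real_derivative_iff_has_vector_derivative
          intro!: DERIV_subset[OF Ck_has_dy[OF f]])
    then show ?thesis by (simp add: integral_unique)
  qed
  have incr_x: "dx f (x, z) - dx f (x, 0) = integral {0..z} (\<lambda>t. dx (dy f) (x, t))"
    if z: "0 \<le> z" "z \<le> 1" for z
  proof -
    have "((\<lambda>x. integral (cbox 0 z) (\<lambda>t. dy f (x, t))) has_real_derivative
       integral (cbox 0 z) (\<lambda>t. dx (dy f) (x, t))) (at x within UNIV)"
    proof (rule leibniz_rule_field_derivative)
      show "((\<lambda>x. dy f (x, t)) has_real_derivative dx (dy f) (x, t)) (at x within UNIV)"
        if "t \<in> cbox 0 z" for x t
        using Ck_has_dx[OF fy] that z by auto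
      show "(\<lambda>t. dy f (x, t)) integrable_on cbox 0 z" for x
        using continuous_on_subset[OF continuous_on_strip_section_y[OF Ck_continuous[OF fy]]] z
        by (intro integrable_continuous) auto
      show "continuous_on (UNIV \<times> cbox 0 z) (\<lambda>(x, t). dx (dy f) (x, t))"
        using z by (auto intro: continuous_on_subset[OF cyx])
    qed auto
    moreover have "((\<lambda>x. f (x, z) - f (x, 0)) has_real_derivative dx f (x, z) - dx f (x, 0)) (at x)"
      by (intro derivative_intros Ck_has_dx[OF f]) (use z in auto)
    ultimately show ?thesis
      using incr[OF z] DERIV_unique by fastforce
  qed
  have "((\<lambda>z. integral {0..z} (\<lambda>t. dx (dy f) (x, t)) + dx f (x, 0)) has_real_derivative
      dx (dy f) (x, y) + 0) (at y within {0..1})"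
    using continuous_on_strip_section_y[OF cyx] y
    by (intro derivative_intros integral_has_real_derivative) auto
  then have "((\<lambda>z. integral {0..z} (\<lambda>t. dx (dy f) (x, t)) + dx f (x, 0)) has_real_derivative
      dx (dy f) (x, y)) (at y within {0..1})" by simp
  then show "((\<lambda>t. dx f (x, t)) has_real_derivative dx (dy f) (x, y)) (at y within {0..1})"
  proof (rule has_field_derivative_transform_within[OF _ zero_less_one])
    show "integral {0..z} (\<lambda>t. dx (dy f) (x, t)) + dx f (x, 0) = dx f (x, z)"
      if "z \<in> {0..1}" "dist z y < 1" for z using incr_x[of z] that by simp
  qed (use y in auto)
qed

section \<open>Holomorphic functions on the closed strip\<close>

text \<open>\<open>A\<close> is holomorphic in \<open>x + \<i>y\<close> with derivative \<open>A'\<close>, up to the boundary of the strip; the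
  \<open>y\<close>-derivative is one-sided at \<open>y = 0\<close> and \<open>y = 1\<close>. For \<open>u = Im A\<close> this means
  \<open>u\<^sub>x = Im A'\<close> and \<open>u\<^sub>y = Re A'\<close>.\<close>
definition CR :: "(plane \<Rightarrow> complex) \<Rightarrow> (plane \<Rightarrow> complex) \<Rightarrow> bool" where
  "CR A A' \<longleftrightarrow> continuous_on closed_strip A \<and> continuous_on closed_strip A' \<and>
     (\<forall>x y. 0 \<le> y \<longrightarrow> y \<le> 1 \<longrightarrow>
        ((\<lambda>t. A (t, y)) has_vector_derivative A' (x, y)) (at x) \<and>
        ((\<lambda>t. A (x, t)) has_vector_derivative \<i> * A' (x, y)) (at y within {0..1}))"

lemma CR_cont: "CR A A' \<Longrightarrow> continuous_on closed_strip A"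
  and CR_cont': "CR A A' \<Longrightarrow> continuous_on closed_strip A'"
  by (simp_all add: CR_def)

lemma CR_dx: "\<lbrakk>CR A A'; 0 \<le> y; y \<le> 1\<rbrakk> \<Longrightarrow>
    ((\<lambda>t. A (t, y)) has_vector_derivative A' (x, y)) (at x)"
  and CR_dy: "\<lbrakk>CR A A'; 0 \<le> y; y \<le> 1\<rbrakk> \<Longrightarrow>
    ((\<lambda>t. A (x, t)) has_vector_derivative \<i> * A' (x, y)) (at y within {0..1})"
  by (simp_all add: CR_def)

section \<open>Algebra of holomorphic functions on the closed strip\<close>

lemma CR_diff:
  assumes "CR A A'" "CR B B'"
  shows "CR (\<lambda>p. A p - B p) (\<lambda>p. A' p - B' p)"
  using assms unfolding CR_def
  by (auto intro!: continuous_intros derivative_eq_intros simp: algebra_simps)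

lemma CR_minus: "CR A A' \<Longrightarrow> CR (\<lambda>p. - A p) (\<lambda>p. - A' p)"
  unfolding CR_def
  by (auto intro!: continuous_intros derivative_eq_intros simp: algebra_simps)

lemma CR_mult:
  assumes "CR A A'" "CR B B'"
  shows "CR (\<lambda>p. A p * B p) (\<lambda>p. A p * B' p + A' p * B p)"
  using assms unfolding CR_def
  by (auto intro!: continuous_intros has_vector_derivative_eq_rhs[OF has_vector_derivative_mult]
      simp: algebra_simps)

lemma has_vector_derivative_quotient:
  fixes A B :: "real \<Rightarrow> complex"
  assumes "(A has_vector_derivative a) (at x within S)" "(B has_vector_derivative b) (at x within S)"
    and "B x \<noteq> 0"
  shows "((\<lambda>t. A t / B t) has_vector_derivative (a - A x / B x * b) / B x) (at x within S)"
proof -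
  have "((\<lambda>t. A t / B t) has_derivative
     (\<lambda>h. (h *\<^sub>R a * B x - A x * (h *\<^sub>R b)) / (B x * B x))) (at x within S)"
    using assms unfolding has_vector_derivative_def by (intro has_derivative_divide') auto
  moreover have "(h *\<^sub>R a * B x - A x * (h *\<^sub>R b)) / (B x * B x)
      = h *\<^sub>R ((a - A x / B x * b) / B x)" for h
    using assms(3) by (simp add: scaleR_conv_of_real field_simps)
  ultimately show ?thesis by (simp add: has_vector_derivative_def)
qed

text \<open>With Q = A / B the derivative is kept in the form (A' - Q B') / B; a second application
  to this quotient then produces exactly the shape of \<open>vel''\<close>.\<close>

lemma CR_divide:
  assumes "CR A A'" "CR B B'" and nz: "\<And>p. p \<in> closed_strip \<Longrightarrow> B p \<noteq> 0"
  shows "CR (\<lambda>p. A p / B p) (\<lambda>p. (A' p - A p / B p * B' p) / B p)"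
proof -
  have nz': "B (x, y) \<noteq> 0" if "0 \<le> y" "y \<le> 1" for x y using nz that by simp
  show ?thesis
    unfolding CR_def
  proof (intro conjI allI impI)
    show "continuous_on closed_strip (\<lambda>p. A p / B p)"
      "continuous_on closed_strip (\<lambda>p. (A' p - A p / B p * B' p) / B p)"
      using assms by (auto intro!: continuous_intros simp: CR_def)
    fix x y :: real assume y: "0 \<le> y" "y \<le> 1"
    show "((\<lambda>t. A (t, y) / B (t, y)) has_vector_derivative
        (A' (x, y) - A (x, y) / B (x, y) * B' (x, y)) / B (x, y)) (at x)"
      by (rule has_vector_derivative_quotient[OF CR_dx CR_dx]) (use assms y nz' in auto)
    have "((\<lambda>t. A (x, t) / B (x, t)) has_vector_derivative
        (\<i> * A' (x, y) - A (x, y) / B (x, y) * (\<i> * B' (x, y))) / B (x, y)) (at y within {0..1})"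
      by (rule has_vector_derivative_quotient[OF CR_dy CR_dy]) (use assms y nz' in auto)
    then show "((\<lambda>t. A (x, t) / B (x, t)) has_vector_derivative
        \<i> * ((A' (x, y) - A (x, y) / B (x, y) * B' (x, y)) / B (x, y))) (at y within {0..1})"
      by (simp add: algebra_simps)
  qed
qed

lemma has_vector_derivative_Complex:
  assumes "(f has_real_derivative f') (at x within S)" "(g has_real_derivative g') (at x within S)"
  shows "((\<lambda>t. Complex (f t) (g t)) has_vector_derivative Complex f' g') (at x within S)"
proof -
  have "((\<lambda>t. complex_of_real (f t) + \<i> * complex_of_real (g t)) has_vector_derivative
      complex_of_real f' + \<i> * complex_of_real g') (at x within S)"
    using assms
    by (intro has_vector_derivative_add has_vector_derivative_mult_right
        has_vector_derivative_of_real)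
      (auto simp: has_real_derivative_iff_has_vector_derivative)
  then show ?thesis by (simp add: Complex_eq)
qed

lemma has_real_derivative_Im:
  "(A has_vector_derivative a) (at x within S) \<Longrightarrow>
    ((\<lambda>t. Im (A t)) has_real_derivative Im a) (at x within S)"
  unfolding has_vector_derivative_def has_field_derivative_def
  by (drule has_derivative_Im) (simp add: mult.commute[of _ "Im a"])

lemma has_real_derivative_Re:
  "(A has_vector_derivative a) (at x within S) \<Longrightarrow>
    ((\<lambda>t. Re (A t)) has_real_derivative Re a) (at x within S)"
  unfolding has_vector_derivative_def has_field_derivative_def
  by (drule has_derivative_Re) (simp add: mult.commute[of _ "Re a"])

text \<open>For harmonic \<open>f\<close> the function \<open>f\<^sub>y + \<i> f\<^sub>x\<close> is holomorphic; the constant \<open>c\<close> accounts for an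
  additional term \<open>c y\<close> in \<open>f\<close>.\<close>
definition grad :: "real \<Rightarrow> (plane \<Rightarrow> real) \<Rightarrow> plane \<Rightarrow> complex" where
  "grad c f p = Complex (c + dy f p) (dx f p)"

definition grad' :: "(plane \<Rightarrow> real) \<Rightarrow> plane \<Rightarrow> complex" where
  "grad' f p = Complex (dx (dy f) p) (dx (dx f) p)"

definition grad'' :: "(plane \<Rightarrow> real) \<Rightarrow> plane \<Rightarrow> complex" where
  "grad'' f p = Complex (dx (dx (dy f)) p) (dx (dx (dx f)) p)"

text \<open>Both second derivatives are continuous up to the boundary, so the equation extends from
  the open strip along vertical sections.\<close>

lemma laplace_closed_strip:
  assumes f: "f \<in> Ck (Suc (Suc k))"
    and lap: "\<And>p. p \<in> strip \<Longrightarrow> dx (dx f) p + dy (dy f) p = 0"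
    and y: "0 \<le> y" "y \<le> 1"
  shows "dy (dy f) (x, y) = - dx (dx f) (x, y)"
proof -
  have "continuous_on closed_strip (dx (dx f))" "continuous_on closed_strip (dy (dy f))"
    by (rule Ck_continuous[OF Ck_dx[OF Ck_dx[OF f]]])
      (rule Ck_continuous[OF Ck_dy[OF Ck_dy[OF f]]])
  then have "continuous_on {0..1} (\<lambda>y. dx (dx f) (x, y) + dy (dy f) (x, y))"
    by (intro continuous_on_add) (auto dest: continuous_on_strip_section_y)
  then have "continuous_on (closure {0<..<1}) (\<lambda>y. dx (dx f) (x, y) + dy (dy f) (x, y))"
    by simp
  from continuous_constant_on_closure[OF this, of 0 y]
  have "dx (dx f) (x, y) + dy (dy f) (x, y) = 0"
    using y lap by (simp add: strip_def)
  then show ?thesis by simp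
qed

lemma CR_grad:
  assumes f: "f \<in> Ck (Suc (Suc (Suc k)))"
    and lap: "\<And>p. p \<in> strip \<Longrightarrow> dx (dx f) p + dy (dy f) p = 0"
  shows "CR (grad c f) (grad' f)" and "CR (grad' f) (grad'' f)"
proof -
  have fx: "dx f \<in> Ck (Suc (Suc k))" and fy: "dy f \<in> Ck (Suc (Suc k))" by (rule Ck_dx[OF f], rule Ck_dy[OF f])
  have fxx: "dx (dx f) \<in> Ck (Suc k)" and fyx: "dx (dy f) \<in> Ck (Suc k)"
    by (rule Ck_dx[OF fx], rule Ck_dx[OF fy])
  have fxxx: "dx (dx (dx f)) \<in> Ck k" and fyxx: "dx (dx (dy f)) \<in> Ck k"
    by (rule Ck_dx[OF fxx], rule Ck_dx[OF fyx])
  note cont = Ck_continuous[OF fx] Ck_continuous[OF fy] Ck_continuous[OF fxx] Ck_continuous[OF fyx]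
    Ck_continuous[OF fxxx] Ck_continuous[OF fyxx]
  have Cplx: "continuous_on closed_strip (\<lambda>p. Complex (a p) (b p))"
    if "continuous_on closed_strip a" "continuous_on closed_strip b" for a b :: "plane \<Rightarrow> real"
    unfolding Complex_eq using that by (intro continuous_intros)
  have yy: "dy (dy f) (x, y) = - dx (dx f) (x, y)" if "0 \<le> y" "y \<le> 1" for x y
    by (rule laplace_closed_strip[OF f lap that])
  have xy: "dy (dx f) (x, y) = dx (dy f) (x, y)" if "0 \<le> y" "y \<le> 1" for x y
    by (rule mixed_partials[OF f that])
  \<comment> \<open>Third derivatives are commuted one pair at a time, by
    \<open>mixed_partials\<close> for \<open>dx f\<close> here and for \<open>dy f\<close>
    below.\<close>
  have xxy: "dy (dx (dx f)) (x, y) = dx (dx (dy f)) (x, y)" if y: "0 \<le> y" "y \<le> 1" for x y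
  proof -
    have "dx (dy (dx f)) (x, y) = dx (dx (dy f)) (x, y)"
      unfolding dx_def[of "dy (dx f)"] dx_def[of "dx (dy f)"] fst_conv snd_conv xy[OF y] ..
    then show ?thesis using mixed_partials[OF fx y] by simp
  qed
  have yxy: "dy (dx (dy f)) (x, y) = - dx (dx (dx f)) (x, y)" if y: "0 \<le> y" "y \<le> 1" for x y
  proof -
    have "((\<lambda>t. dy (dy f) (t, y)) has_real_derivative - dx (dx (dx f)) (x, y)) (at x)"
      unfolding yy[OF y] by (intro derivative_intros Ck_has_dx[OF fxx y])
    then show ?thesis using mixed_partials[OF fy y] by (simp add: dx_eqI)
  qed
  have i: "Complex (- a) b = \<i> * Complex b a" for a b by (simp add: complex_eq_iff)
  have "((\<lambda>t. grad c f (t, y)) has_vector_derivative grad' f (x, y)) (at x)"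
    if y: "0 \<le> y" "y \<le> 1" for x y
    unfolding grad_def grad'_def
    by (intro has_vector_derivative_Complex Ck_has_dx[OF fx] y)
      (use DERIV_add[OF DERIV_const Ck_has_dx[OF fy y]] in simp)
  moreover have "((\<lambda>t. grad c f (x, t)) has_vector_derivative \<i> * grad' f (x, y))
      (at y within {0..1})" if y: "0 \<le> y" "y \<le> 1" for x y
    unfolding grad_def grad'_def i[symmetric] yy[OF y, symmetric] xy[OF y, symmetric]
    by (intro has_vector_derivative_Complex Ck_has_dy[OF fx] y)
      (use DERIV_add[OF DERIV_const Ck_has_dy[OF fy y]] in simp)
  ultimately show "CR (grad c f) (grad' f)"
    unfolding CR_def using cont(1-4) Cplx[OF continuous_on_add[OF continuous_on_const cont(2)] cont(1)]
      Cplx[OF cont(4,3)]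
    by (simp add: grad_def[abs_def] grad'_def[abs_def])
  have "((\<lambda>t. grad' f (t, y)) has_vector_derivative grad'' f (x, y)) (at x)"
    if y: "0 \<le> y" "y \<le> 1" for x y
    unfolding grad'_def grad''_def
    by (intro has_vector_derivative_Complex Ck_has_dx[OF fxx] Ck_has_dx[OF fyx] y)
  moreover have "((\<lambda>t. grad' f (x, t)) has_vector_derivative \<i> * grad'' f (x, y))
      (at y within {0..1})" if y: "0 \<le> y" "y \<le> 1" for x y
    unfolding grad'_def grad''_def i[symmetric] yxy[OF y, symmetric] xxy[OF y, symmetric]
    by (intro has_vector_derivative_Complex Ck_has_dy[OF fxx] Ck_has_dy[OF fyx] y)
  ultimately show "CR (grad' f) (grad'' f)"
    unfolding CR_def using Cplx[OF cont(4,3)] Cplx[OF cont(6,5)]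
    by (simp add: grad''_def[abs_def] grad'_def[abs_def])
qed

section \<open>Maximum principles\<close>

lemma CR_dx_Im: "\<lbrakk>CR A A'; 0 \<le> y; y \<le> 1\<rbrakk> \<Longrightarrow>
    ((\<lambda>t. Im (A (t, y))) has_real_derivative Im (A' (x, y))) (at x)"
  by (rule has_real_derivative_Im[OF CR_dx])

lemma CR_dy_Im: "\<lbrakk>CR A A'; 0 \<le> y; y \<le> 1\<rbrakk> \<Longrightarrow>
    ((\<lambda>t. Im (A (x, t))) has_real_derivative Re (A' (x, y))) (at y within {0..1})"
  using has_real_derivative_Im[OF CR_dy] by force

text \<open>Continuity of the partial derivatives gives total differentiability in the open strip,
  and the differential s A' + t i A' is multiplication by A'.\<close>

lemma CR_field_derivative:
  assumes A: "CR A A'" and z: "0 < Im z" "Im z < 1"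
  shows "((\<lambda>z. A (Re z, Im z)) has_field_derivative A' (Re z, Im z)) (at z)"
proof -
  define x y where "x = Re z" and "y = Im z"
  have y: "y \<in> {0<..<1}" using z by (simp add: y_def)
  have "((\<lambda>(x, y). A (x, y)) has_derivative
      (\<lambda>(s, t). s *\<^sub>R A' (x, y) + blinfun_apply (blinfun_scaleR_left (\<i> * A' (x, y))) t))
      (at (x, y) within UNIV \<times> {0<..<1})"
  proof (rule has_derivative_partialsI)
    show "((\<lambda>x. A (x, y)) has_derivative (\<lambda>s. s *\<^sub>R A' (x, y))) (at x within UNIV)"
      using CR_dx[OF A, of y x] y by (simp add: has_vector_derivative_def)
    show "((\<lambda>y. A (x, y)) has_derivative blinfun_apply (blinfun_scaleR_left (\<i> * A' (x, y))))
        (at y within {0<..<1})" if "y \<in> {0<..<1}" for x y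
    proof -
      have "((\<lambda>t. A (x, t)) has_vector_derivative \<i> * A' (x, y)) (at y within {0<..<1})"
        by (rule has_vector_derivative_within_subset[OF CR_dy[OF A]]) (use that in auto)
      then show ?thesis by (simp add: has_vector_derivative_def)
    qed
    have "continuous_on (UNIV \<times> {0<..<1}) A'"
      by (rule continuous_on_subset[OF CR_cont'[OF A]]) auto
    then have "continuous (at (x, y) within UNIV \<times> {0<..<1}) A'"
      using y by (simp add: continuous_on_eq_continuous_within)
    then have "continuous (at (x, y) within UNIV \<times> {0<..<1})
        (\<lambda>p. blinfun_scaleR_left (\<i> * A' p))"
      by (intro bounded_linear.continuous[OF bounded_linear_blinfun_scaleR_left] continuous_mult
          continuous_const)
    then show "continuous (at (x, y) within UNIV \<times> {0<..<1})
        (\<lambda>(x, y). blinfun_scaleR_left (\<i> * A' (x, y)))"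
      by (simp add: split_beta')
  qed (use y in auto)
  moreover have "open (UNIV \<times> {0<..<1} :: plane set)" 
    by (intro open_Times open_UNIV open_greaterThanLessThan)
  ultimately have D: "(A has_derivative (\<lambda>(s, t). s *\<^sub>R A' (x, y) + t *\<^sub>R (\<i> * A' (x, y)))) (at (x, y))"
    using y by (simp add: at_within_open[of "(x, y)" "UNIV \<times> {0<..<1}"])
  have "((\<lambda>z. (Re z, Im z)) has_derivative (\<lambda>h. (Re h, Im h))) (at z)"
    by (intro has_derivative_Pair has_derivative_Re has_derivative_Im has_derivative_ident)
  from has_derivative_compose[OF this, of A "\<lambda>(s, t). s *\<^sub>R A' (x, y) + t *\<^sub>R (\<i> * A' (x, y))"] D
  have "((\<lambda>z. A (Re z, Im z)) has_derivative
      (\<lambda>h. Re h *\<^sub>R A' (x, y) + Im h *\<^sub>R (\<i> * A' (x, y)))) (at z)"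
    by (simp add: x_def y_def)
  moreover have "Re h *\<^sub>R A' (x, y) + Im h *\<^sub>R (\<i> * A' (x, y)) = A' (x, y) * h" for h
    by (simp add: complex_eq_iff)
  ultimately show ?thesis by (simp add: has_field_derivative_def x_def y_def)
qed

text \<open>Since \<open>norm (exp (- \<i> A)) = exp (Im A)\<close>, the maximum modulus principle yields maximum
  principles for \<open>Im A\<close>.\<close>
lemma norm_exp_minus_i: "norm (exp (- (\<i> * z))) = exp (Im z)"
  by simp

lemma CR_exp_holomorphic:
  assumes A: "CR A A'" and S: "\<And>z. z \<in> S \<Longrightarrow> 0 < Im z \<and> Im z < 1"
  shows "(\<lambda>z. exp (- (\<i> * A (Re z, Im z)))) holomorphic_on S"
proof -
  have "(\<lambda>z. A (Re z, Im z)) holomorphic_on S"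
    using CR_field_derivative[OF A] S
    by (auto simp: holomorphic_on_def field_differentiable_def
        intro: has_field_derivative_at_within)
  then show ?thesis by (intro holomorphic_intros)
qed

text \<open>Only continuity is required on the sides, so the rectangle may touch the bed and the
  surface.\<close>

lemma CR_Im_le_rectangle:
  assumes A: "CR A A'" and "a < b" and cd: "0 \<le> c" "c < d" "d \<le> 1"
    and hor: "\<And>x. \<lbrakk>a \<le> x; x \<le> b\<rbrakk> \<Longrightarrow> Im (A (x, c)) \<le> M \<and> Im (A (x, d)) \<le> M"
    and ver: "\<And>y. \<lbrakk>c \<le> y; y \<le> d\<rbrakk> \<Longrightarrow> Im (A (a, y)) \<le> M \<and> Im (A (b, y)) \<le> M"
    and xy: "a \<le> x" "x \<le> b" "c \<le> y" "y \<le> d"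
  shows "Im (A (x, y)) \<le> M"
proof -
  define S where "S = cbox (Complex a c) (Complex b d)"
  define f where "f z = exp (- (\<i> * A (Re z, Im z)))" for z
  have f: "norm (f z) = exp (Im (A (Re z, Im z)))" for z
    unfolding f_def by (rule norm_exp_minus_i)
  have "norm (f (Complex x y)) \<le> exp M"
  proof (rule maximum_modulus_frontier[of f S])
    show "f holomorphic_on interior S"
      unfolding f_def S_def using cd
      by (intro CR_exp_holomorphic[OF A]) (auto simp: in_box_complex_iff)
    have "continuous_on S (A \<circ> (\<lambda>z. (Re z, Im z)))"
      by (rule continuous_on_compose)
        (use cd in \<open>auto intro!: continuous_intros continuous_on_subset[OF CR_cont[OF A]]
          simp: S_def in_cbox_complex_iff\<close>)
    then show "continuous_on (closure S) f"
      by (auto simp: S_def f_def o_def intro!: continuous_intros)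
    show "norm (f z) \<le> exp M" if "z \<in> frontier S" for z
    proof -
      have "z \<in> cbox (Complex a c) (Complex b d)" "z \<notin> box (Complex a c) (Complex b d)"
        using that by (auto simp: S_def frontier_cbox)
      then have "a \<le> Re z" "Re z \<le> b" "c \<le> Im z" "Im z \<le> d"
        and "Re z = a \<or> Re z = b \<or> Im z = c \<or> Im z = d"
        by (auto simp: in_cbox_complex_iff in_box_complex_iff)
      then have "Im (A (Re z, Im z)) \<le> M" using hor ver by metis
      then show ?thesis by (simp add: f)
    qed
  qed (use xy in \<open>auto simp: S_def in_cbox_complex_iff\<close>)
  then show ?thesis by (simp add: f)
qed

lemma CR_Im_strong_maximum:
  assumes A: "CR A A'"
    and le: "\<And>x y. \<lbrakk>0 < x; 0 < y; y < 1\<rbrakk> \<Longrightarrow> Im (A (x, y)) \<le> Im (A (x0, y0))"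
    and "0 < x0" "0 < y0" "y0 < 1" "0 < x" "0 < y" "y < 1"
  shows "Im (A (x, y)) = Im (A (x0, y0))"
proof -
  define S where "S = {z. 0 < Re z} \<inter> {z. 0 < Im z} \<inter> {z. Im z < 1}"
  define f where "f z = exp (- (\<i> * A (Re z, Im z)))" for z
  have f: "norm (f z) = exp (Im (A (Re z, Im z)))" for z
    unfolding f_def by (rule norm_exp_minus_i)
  have "open S" unfolding S_def
    by (intro open_Int open_halfspace_Re_gt open_halfspace_Im_gt open_halfspace_Im_lt)
  moreover have "convex S" unfolding S_def
    by (intro convex_Int convex_halfspace_Re_gt convex_halfspace_Im_gt convex_halfspace_Im_lt)
  moreover have "f holomorphic_on S" unfolding f_def
    by (intro CR_exp_holomorphic[OF A]) (auto simp: S_def)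
  ultimately have "f constant_on S"
    by (intro maximum_modulus_principle[of f S S "Complex x0 y0"])
      (use assms in \<open>auto simp: f convex_connected S_def\<close>)
  then have "f (Complex x y) = f (Complex x0 y0)"
    using assms by (auto simp: constant_on_def S_def)
  then have "norm (f (Complex x y)) = norm (f (Complex x0 y0))" by simp
  then show ?thesis by (simp add: f)
qed

section \<open>Explicit comparison functions and signs of one-sided derivatives\<close>

lemma CR_of_holomorphic:
  assumes "\<And>z. (g has_field_derivative g' z) (at z)" "continuous_on UNIV g'"
  shows "CR (\<lambda>p. g (Complex (fst p) (snd p))) (\<lambda>p. g' (Complex (fst p) (snd p)))"
proof -
  have c: "continuous_on S (\<lambda>p. Complex (fst p) (snd p))" for S :: "plane set"
    unfolding Complex_eq by (intro continuous_intros)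
  have g: "continuous_on UNIV g"
    using assms(1) by (auto simp: continuous_on_eq_continuous_within intro: DERIV_isCont)
  have x: "((\<lambda>t. Complex t y) has_vector_derivative 1) (at x)" for x y
    using has_vector_derivative_Complex[OF DERIV_ident DERIV_const, where x = x and S = UNIV]
    by (simp add: complex_eq_iff one_complex.code)
  have y: "((\<lambda>t. Complex x t) has_vector_derivative \<i>) (at y within {0..1})" for x y
    using has_vector_derivative_Complex[OF DERIV_const DERIV_ident, where x = y and S = "{0..1}"]
    by (simp add: imaginary_unit.code)
  show ?thesis
    unfolding CR_def
  proof (intro conjI allI impI)
    show "continuous_on closed_strip (\<lambda>p. g (Complex (fst p) (snd p)))"
      by (rule continuous_on_compose2[OF g c]) auto
    show "continuous_on closed_strip (\<lambda>p. g' (Complex (fst p) (snd p)))"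
      by (rule continuous_on_compose2[OF assms(2) c]) auto
    show "((\<lambda>t. g (Complex (fst (t, y)) (snd (t, y)))) has_vector_derivative
        g' (Complex (fst (x, y)) (snd (x, y)))) (at x)" for x y
      using field_vector_diff_chain_at[OF x assms(1)] by (simp add: o_def)
    show "((\<lambda>t. g (Complex (fst (x, t)) (snd (x, t)))) has_vector_derivative
        \<i> * g' (Complex (fst (x, y)) (snd (x, y)))) (at y within {0..1})" for x y
      using field_vector_diff_chain_within[OF y has_field_derivative_at_within[OF assms(1)]]
      by (simp add: o_def)
  qed
qed

text \<open>Origin of both Hopf comparison functions: composed with an affine map with real factor
  the sine acts in x and sinh in y; with imaginary factor the roles are exchanged.\<close>

lemma Im_cos_sinh: "Im (cos z) = sin (Re z) * sinh (- Im z)"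
  by (simp add: Im_cos sinh_field_def field_simps)

lemma CR_cos_affine:
  "CR (\<lambda>p. cos (a * Complex (fst p) (snd p) + b)) (\<lambda>p. - (a * sin (a * Complex (fst p) (snd p) + b)))"
proof -
  have D: "((\<lambda>z. cos (a * z + b)) has_field_derivative - (a * sin (a * z + b))) (at z)" for z
    by (rule derivative_eq_intros refl | simp)+
  show ?thesis
    by (rule CR_of_holomorphic[OF D]) (intro continuous_intros)
qed

lemma DERIV_left_endpoint_nonneg:
  fixes f :: "real \<Rightarrow> real"
  assumes D: "(f has_real_derivative D) (at 1 within {0..1})" and "c < 1"
    and le: "\<And>y. \<lbrakk>c < y; y < 1\<rbrakk> \<Longrightarrow> f y \<le> f 1"
  shows "0 \<le> D"
proof (rule tendsto_lowerbound)
  show "((\<lambda>y. (f y - f 1) / (y - 1)) \<longlongrightarrow> D) (at 1 within {0..1})"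
    using D by (simp add: has_field_derivative_iff)
  have "at (1::real) within {0..1} = at_left 1"
    by (rule at_within_Icc_at_left) simp
  then show "\<forall>\<^sub>F y in at 1 within {0..1}. 0 \<le> (f y - f 1) / (y - 1)"
    using le \<open>c < 1\<close>
    by (auto simp: eventually_at_left[OF \<open>c < 1\<close>] divide_nonpos_nonpos intro!: exI[of _ c])
  show "at (1::real) within {0..1} \<noteq> bot"
    by (simp add: at_within_Icc_at_left)
qed

lemma DERIV_right_nonpos:
  fixes f :: "real \<Rightarrow> real"
  assumes D: "(f has_real_derivative D) (at a)" and "a < b"
    and le: "\<And>x. \<lbrakk>a < x; x < b\<rbrakk> \<Longrightarrow> f x \<le> f a"
  shows "D \<le> 0"
proof (rule tendsto_upperbound)
  have "((\<lambda>y. (f y - f a) / (y - a)) \<longlongrightarrow> D) (at a)"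
    using D by (simp add: has_field_derivative_iff)
  then show "((\<lambda>y. (f y - f a) / (y - a)) \<longlongrightarrow> D) (at_right a)"
    by (rule filterlim_mono) (auto simp: at_le)
  show "\<forall>\<^sub>F y in at_right a. (f y - f a) / (y - a) \<le> 0"
    using le \<open>a < b\<close>
    by (auto simp: eventually_at_right[OF \<open>a < b\<close>] divide_nonpos_nonneg intro!: exI[of _ b])
qed simp

text \<open>The comparison function is \<open>sin (k (x - a)) sinh (k (1 - y))\<close>, the imaginary part of a cosine;
  it vanishes on all sides of the rectangle but the lower one.\<close>
lemma Hopf_top:
  assumes A: "CR A A'" and r: "0 < r" and c: "0 \<le> c" "c < 1"
    and le: "\<And>x y. \<lbrakk>\<bar>x - x0\<bar> \<le> r; c \<le> y; y \<le> 1\<rbrakk> \<Longrightarrow> Im (A (x, y)) \<le> 0"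
    and less: "\<And>x. \<bar>x - x0\<bar> \<le> r \<Longrightarrow> Im (A (x, c)) < 0"
    and zero: "Im (A (x0, 1)) = 0"
  shows "0 < Re (A' (x0, 1))"
proof -
  \<comment> \<open>Half a period of the sine spans the width 2 r: it vanishes at x0 - r and x0 + r
    and equals 1 at x0.\<close>
  define k where "k = pi / (2 * r)"
  have k: "k > 0" using r by (simp add: k_def)
  define a where "a = x0 - r"
  define w where "w = complex_of_real k"
  define b where "b p = sin (k * (fst p - a)) * sinh (k * (1 - snd p))" for p
  define B where "B p = cos (w * Complex (fst p) (snd p) + (- w * Complex a 1))" for p
  have B: "Im (B p) = b p" for p
    unfolding B_def b_def by (simp add: Im_cos_sinh w_def algebra_simps)
  have "\<exists>x1\<in>{x0 - r..x0 + r}. \<forall>x\<in>{x0 - r..x0 + r}. Im (A (x, c)) \<le> Im (A (x1, c))"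
    using r c by (intro continuous_attains_sup)
      (auto intro!: continuous_intros continuous_on_strip_section_x[OF CR_cont[OF A]])
  then obtain x1 where x1: "\<bar>x1 - x0\<bar> \<le> r" "\<And>x. \<bar>x - x0\<bar> \<le> r \<Longrightarrow> Im (A (x, c)) \<le> Im (A (x1, c))"
    by (force simp: abs_le_iff)
  define N where "N = sinh (k * (1 - c))"
  have N: "N > 0" using k c by (simp add: N_def)
  define e where "e = - Im (A (x1, c)) / N"
  have e: "e > 0" using less[OF x1(1)] N by (simp add: e_def divide_neg_pos)
  have AB: "CR (\<lambda>p. A p - complex_of_real (- e) * B p)
      (\<lambda>p. A' p - (complex_of_real (- e) * - (w * sin (w * Complex (fst p) (snd p) + (- w * Complex a 1)))
        + 0 * B p))"
    unfolding B_def
    by (intro CR_diff[OF A] CR_mult CR_cos_affine) (auto simp: CR_def)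
  have main: "Im (A (x, y)) + e * b (x, y) \<le> 0" if "\<bar>x - x0\<bar> \<le> r" "c \<le> y" "y \<le> 1" for x y
  proof -
    have "Im ((\<lambda>p. A p - complex_of_real (- e) * B p) (x, y)) \<le> 0"
    proof (rule CR_Im_le_rectangle[OF AB, of "x0 - r" "x0 + r" c 1])
      fix x assume x: "x0 - r \<le> x" "x \<le> x0 + r"
      then have x': "\<bar>x - x0\<bar> \<le> r" by auto
      have "e * b (x, c) \<le> e * N"
        using e N by (simp add: b_def N_def mult_left_le_one_le mult_le_cancel_right1)
      also have "\<dots> = - Im (A (x1, c))" using N by (simp add: e_def)
      also have "\<dots> \<le> - Im (A (x, c))" using x1(2)[OF x'] by simp
      finally show "Im (A (x, c) - complex_of_real (- e) * B (x, c)) \<le> 0 \<and>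
          Im (A (x, 1) - complex_of_real (- e) * B (x, 1)) \<le> 0"
        using le[OF x', of 1] c by (auto simp: B b_def)
    next
      fix y assume y: "c \<le> y" "y \<le> 1"
      have "k * (x0 + r - a) = pi" using r by (simp add: k_def a_def)
      then show "Im (A (x0 - r, y) - complex_of_real (- e) * B (x0 - r, y)) \<le> 0 \<and>
          Im (A (x0 + r, y) - complex_of_real (- e) * B (x0 + r, y)) \<le> 0"
        using le[of "x0 - r" y] le[of "x0 + r" y] r y by (auto simp: B b_def a_def)
    qed (use that r c in auto)
    then show ?thesis by (simp add: B)
  qed
  have k0: "k * (x0 - a) = pi / 2" using r by (simp add: k_def a_def)
  \<comment> \<open>On x = x0 the sine is 1, so \<phi> <= 0 with equality at y = 1; the slope of
    sinh there makes the strictness.\<close>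
  define \<phi> where "\<phi> y = Im (A (x0, y)) + e * sinh (k * (1 - y))" for y
  have "(\<phi> has_real_derivative Re (A' (x0, 1)) - e * k) (at 1 within {0..1})"
  proof -
    have "((\<lambda>y. e * sinh (k * (1 - y))) has_real_derivative - e * k) (at 1 within {0..1})"
      by (auto intro!: derivative_eq_intros)
    from DERIV_add[OF CR_dy_Im[OF A] this] show ?thesis by (simp add: \<phi>_def[abs_def])
  qed
  then have "0 \<le> Re (A' (x0, 1)) - e * k"
  proof (rule DERIV_left_endpoint_nonneg[OF _ c(2)])
    show "\<phi> y \<le> \<phi> 1" if "c < y" "y < 1" for y
      using main[of x0 y] that r zero by (simp add: \<phi>_def b_def k0)
  qed
  moreover have "e * k > 0" using e k by simp
  ultimately show ?thesis by linarith
qed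

text \<open>Here the comparison function is \<open>sinh (k x) sin (k (y - c))\<close>, positive on the right side only.\<close>
lemma Hopf_corner:
  assumes A: "CR A A'" and A': "CR A' A''" and a: "0 < a" and c: "0 \<le> c" "c < 1"
    and le: "\<And>x y. \<lbrakk>0 \<le> x; x \<le> a; c \<le> y; y \<le> 1\<rbrakk> \<Longrightarrow> Im (A (x, y)) \<le> 0"
    and less: "\<And>y. \<lbrakk>c \<le> y; y \<le> 1\<rbrakk> \<Longrightarrow> Im (A (a, y)) < 0"
    and zero: "\<And>y. \<lbrakk>c \<le> y; y \<le> 1\<rbrakk> \<Longrightarrow> Im (A (0, y)) = 0" and zero': "Im (A' (0, 1)) = 0"
  shows "0 < Re (A'' (0, 1))"
proof -
  \<comment> \<open>The sine vanishes at y = c and at y = 1, so three sides of the rectangle carry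
    zero.\<close>
  define k where "k = pi / (1 - c)"
  have k: "k > 0" using c by (simp add: k_def)
  have kc: "k * (1 - c) = pi" using c by (simp add: k_def)
  define w where "w = - \<i> * complex_of_real k"
  define b where "b p = sin (k * (snd p - c)) * sinh (k * fst p)" for p
  define B where "B p = cos (w * Complex (fst p) (snd p) + (- w * Complex 0 c))" for p
  have B: "Im (B p) = b p" for p
    unfolding B_def b_def by (simp add: Im_cos_sinh w_def algebra_simps)
  have "\<exists>y1\<in>{c..1}. \<forall>y\<in>{c..1}. Im (A (a, y)) \<le> Im (A (a, y1))"
    using c by (intro continuous_attains_sup)
      (auto intro!: continuous_intros continuous_on_subset[OF continuous_on_strip_section_y[OF CR_cont[OF A]]])
  then obtain y1 where y1: "c \<le> y1" "y1 \<le> 1" "\<And>y. \<lbrakk>c \<le> y; y \<le> 1\<rbrakk> \<Longrightarrow> Im (A (a, y)) \<le> Im (A (a, y1))"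
    by force
  define N where "N = sinh (k * a)"
  have N: "N > 0" using k a by (simp add: N_def)
  define e where "e = - Im (A (a, y1)) / N"
  have e: "e > 0" using less[OF y1(1,2)] N by (simp add: e_def divide_neg_pos)
  have AB: "CR (\<lambda>p. A p - complex_of_real (- e) * B p)
      (\<lambda>p. A' p - (complex_of_real (- e) * - (w * sin (w * Complex (fst p) (snd p) + (- w * Complex 0 c)))
        + 0 * B p))"
    unfolding B_def
    by (intro CR_diff[OF A] CR_mult CR_cos_affine) (auto simp: CR_def)
  have main: "Im (A (x, y)) + e * b (x, y) \<le> 0" if "0 \<le> x" "x \<le> a" "c \<le> y" "y \<le> 1" for x y
  proof -
    have "Im ((\<lambda>p. A p - complex_of_real (- e) * B p) (x, y)) \<le> 0"
    proof (rule CR_Im_le_rectangle[OF AB, of 0 a c 1])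
      fix y assume y: "c \<le> y" "y \<le> 1"
      have "e * b (a, y) \<le> e * N"
        using e N by (simp add: b_def N_def mult_left_le_one_le mult_le_cancel_right1)
      also have "\<dots> = - Im (A (a, y1))" using N by (simp add: e_def)
      also have "\<dots> \<le> - Im (A (a, y))" using y1(3)[OF y] by simp
      finally show "Im (A (0, y) - complex_of_real (- e) * B (0, y)) \<le> 0 \<and>
          Im (A (a, y) - complex_of_real (- e) * B (a, y)) \<le> 0"
        using zero[OF y] by (auto simp: B b_def)
    next
      fix x assume x: "0 \<le> x" "x \<le> a"
      then show "Im (A (x, c) - complex_of_real (- e) * B (x, c)) \<le> 0 \<and>
          Im (A (x, 1) - complex_of_real (- e) * B (x, 1)) \<le> 0"
        using le[OF x, of c] le[OF x, of 1] c by (auto simp: B b_def kc)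
    qed (use that a c in auto)
    then show ?thesis by (simp add: B)
  qed
  \<comment> \<open>The comparison is differentiated in x at the axis, where both functions vanish,
    and afterwards in y at the corner.\<close>
  have Dx: "Im (A' (0, y)) + e * (sin (k * (y - c)) * k) \<le> 0" if y: "c \<le> y" "y \<le> 1" for y
  proof -
    have "((\<lambda>x. Im (A (x, y)) + e * b (x, y)) has_real_derivative
        Im (A' (0, y)) + e * (sin (k * (y - c)) * k)) (at 0)"
    proof -
      have "((\<lambda>x. e * b (x, y)) has_real_derivative e * (sin (k * (y - c)) * k)) (at 0)"
        unfolding b_def by (auto intro!: derivative_eq_intros)
      from DERIV_add[OF CR_dx_Im[OF A] this] show ?thesis using y c by simp
    qed
    then show ?thesis
      by (rule DERIV_right_nonpos[OF _ a]) (use main y zero in \<open>auto simp: b_def\<close>)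
  qed
  \<comment> \<open>\<phi> vanishes at y = 1 by \<open>zero'\<close> and sin pi = 0, and the sine
    has slope - k there; this is where Re A'', the mixed derivative of Im A, acquires its
    sign.\<close>
  define \<phi> where "\<phi> y = Im (A' (0, y)) + e * (sin (k * (y - c)) * k)" for y
  have "(\<phi> has_real_derivative Re (A'' (0, 1)) - e * (k * k)) (at 1 within {0..1})"
  proof -
    have "((\<lambda>y. e * (sin (k * (y - c)) * k)) has_real_derivative - (e * (k * k))) (at 1 within {0..1})"
      by (auto intro!: derivative_eq_intros simp: kc)
    from DERIV_add[OF CR_dy_Im[OF A'] this] show ?thesis by (simp add: \<phi>_def[abs_def])
  qed
  then have "0 \<le> Re (A'' (0, 1)) - e * (k * k)"
  proof (rule DERIV_left_endpoint_nonneg[OF _ c(2)])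
    show "\<phi> y \<le> \<phi> 1" if "c < y" "y < 1" for y
      using Dx[of y] that zero' by (simp add: \<phi>_def kc)
  qed
  moreover have "e * (k * k) > 0" using e k by simp
  ultimately show ?thesis by linarith
qed

section \<open>The energy estimate\<close>

abbreviation pos :: "real \<Rightarrow> real" where "pos t \<equiv> max 0 t"

text \<open>At 0 the difference quotient is (pos h)^2. The cube thus gives test functions with
  classical derivatives, and no weak formulation is needed.\<close>

lemma has_real_derivative_pos_cube: "((\<lambda>t. (pos t) ^ 3) has_real_derivative 3 * (pos t)\<^sup>2) (at t)"
proof (cases "t = 0")
  case True
  have "(\<lambda>h. (pos h)\<^sup>2) \<midarrow>0\<rightarrow> (pos 0)\<^sup>2"
    by (intro tendsto_intros)
  then have "(\<lambda>h. (pos h)\<^sup>2) \<midarrow>0\<rightarrow> 0" by simp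
  then have "(\<lambda>h. (pos h) ^ 3 / h) \<midarrow>0\<rightarrow> 0"
    by (rule Lim_transform_eventually)
      (auto simp: eventually_at_filter max_def power2_eq_square power3_eq_cube)
  with True show ?thesis by (simp add: has_field_derivative_iff)
next
  case False
  then consider "t > 0" | "t < 0" by linarith
  then show ?thesis
  proof cases
    case 1
    have "((\<lambda>t. t ^ 3) has_real_derivative 3 * (pos t)\<^sup>2) (at t)"
      using 1 by (auto intro!: derivative_eq_intros)
    then show ?thesis
      by (rule DERIV_cong_ev[THEN iffD1, OF refl _ refl, rotated])
        (use 1 in \<open>auto simp: eventually_nhds intro!: exI[of _ "{0<..}"]\<close>)
  next
    case 2
    have "((\<lambda>t. 0) has_real_derivative 3 * (pos t)\<^sup>2) (at t)"
      using 2 by (auto intro!: derivative_eq_intros)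
    then show ?thesis
      by (rule DERIV_cong_ev[THEN iffD1, OF refl _ refl, rotated])
        (use 2 in \<open>auto simp: eventually_nhds intro!: exI[of _ "{..<0}"]\<close>)
  qed
qed

text \<open>For \<open>u = Im A\<close>, \<open>m = barrier \<rho>\<close> and \<open>h = u\<^sup>+ / m\<close> the flux is the integral of
  \<open>m\<^sup>2 h\<^sup>3 h\<^sub>x\<close> over a vertical section of the strip. The function \<open>m\<close> is a concave perturbation of \<open>y\<close>
  with \<open>m(1) = 1\<close> and \<open>m'(1) = 1 - 2\<rho>\<close>; its concavity produces the zero-order term \<open>2 \<rho> m h\<^sup>4\<close> of
  the dissipation, which absorbs the derivative of a slowly varying weight.\<close>
definition barrier :: "real \<Rightarrow> real \<Rightarrow> real" where
  "barrier \<rho> y = \<rho> + y - \<rho> * y\<^sup>2"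

definition flux :: "real \<Rightarrow> (plane \<Rightarrow> complex) \<Rightarrow> (plane \<Rightarrow> complex) \<Rightarrow> real \<Rightarrow> real" where
  "flux \<rho> A A' x =
     integral {0..1} (\<lambda>y. (pos (Im (A (x, y)))) ^ 3 * Im (A' (x, y)) / (barrier \<rho> y)\<^sup>2)"

text \<open>These are the terms 3 m^2 h^2 |grad h|^2 and 2 \<rho> m h^4 written through u, using m
  h_x = u_x and m h_y = u_y - m' u / m.\<close>

definition dissipation :: "real \<Rightarrow> (plane \<Rightarrow> complex) \<Rightarrow> (plane \<Rightarrow> complex) \<Rightarrow> real \<Rightarrow> real" where
  "dissipation \<rho> A A' x = integral {0..1} (\<lambda>y.
     3 * (pos (Im (A (x, y))))\<^sup>2 * ((Im (A' (x, y)))\<^sup>2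
       + (Re (A' (x, y)) - (1 - 2 * \<rho> * y) * Im (A (x, y)) / barrier \<rho> y)\<^sup>2) / (barrier \<rho> y)\<^sup>2
     + 2 * \<rho> * (pos (Im (A (x, y)))) ^ 4 / (barrier \<rho> y) ^ 3)"

definition mass :: "real \<Rightarrow> (plane \<Rightarrow> complex) \<Rightarrow> real \<Rightarrow> real" where
  "mass \<rho> A x = integral {0..1} (\<lambda>y. (pos (Im (A (x, y)))) ^ 4 / (barrier \<rho> y) ^ 3)"

text \<open>The constant term \<rho> keeps the profile away from zero at the bed, so division by it
  is harmless there; \<open>\<rho> \<le> 1/2\<close> gives the upper bound.\<close>

lemma barrier_bounds:
  assumes "0 < \<rho>" "\<rho> \<le> 1/2" "0 \<le> y" "y \<le> 1"
  shows "\<rho> \<le> barrier \<rho> y" "0 < barrier \<rho> y" "barrier \<rho> y \<le> 1"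
proof -
  have "barrier \<rho> y = \<rho> + y * (1 - \<rho> * y)" by (simp add: barrier_def power2_eq_square algebra_simps)
  moreover have "\<rho> * y \<le> 1" using assms by (intro mult_le_one) auto
  ultimately show "\<rho> \<le> barrier \<rho> y" using assms by simp
  then show "0 < barrier \<rho> y" using assms by linarith
  have "1 - barrier \<rho> y = (1 - y) * (1 - \<rho> * (1 + y))"
    by (simp add: barrier_def power2_eq_square algebra_simps)
  moreover have "\<rho> * (1 + y) \<le> 1/2 * 2" using assms by (intro mult_mono) auto
  ultimately show "barrier \<rho> y \<le> 1" using assms
    by (metis diff_ge_0_iff_ge mult_nonneg_nonneg mult_2_right field_sum_of_halves mult.left_neutral times_divide_eq_left)
qed

text \<open>Integrate \<open>div (m\<^sup>2 h\<^sup>3 \<nabla>h) = 3 m\<^sup>2 h\<^sup>2 |\<nabla>h|\<^sup>2 + 2 \<rho> m h\<^sup>4\<close> over the vertical section.\<close>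
lemma flux_has_derivative:
  assumes A: "CR A A'" and A': "CR A' A''" and \<rho>: "0 < \<rho>" "\<rho> \<le> 1/2"
    and bed: "\<And>x. Im (A (x, 0)) = 0"
  shows "(flux \<rho> A A' has_real_derivative dissipation \<rho> A A' x
    - (pos (Im (A (x, 1)))) ^ 3 * (Re (A' (x, 1)) - (1 - 2 * \<rho>) * Im (A (x, 1)))) (at x)"
proof -
  define u where "u p = Im (A p)" for p
  define ux where "ux p = Im (A' p)" for p
  define uy where "uy p = Re (A' p)" for p
  define uxx where "uxx p = Im (A'' p)" for p
  define m where "m = barrier \<rho>"
  define m' where "m' y = 1 - 2 * \<rho> * y" for y
  have m: "m y > 0" if "0 \<le> y" "y \<le> 1" for y using barrier_bounds[OF \<rho> that] by (simp add: m_def)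
  then have mnz: "m y \<noteq> 0" if "0 \<le> y" "y \<le> 1" for y using that by (metis less_irrefl)
  have cu: "continuous_on closed_strip u" "continuous_on closed_strip ux"
    "continuous_on closed_strip uy" "continuous_on closed_strip uxx"
    unfolding u_def ux_def uy_def uxx_def
    using CR_cont[OF A] CR_cont[OF A'] CR_cont'[OF A'] by (auto intro!: continuous_intros)
  have cm: "continuous_on S m" for S unfolding m_def barrier_def by (intro continuous_intros)
  note cuy = cu[THEN continuous_on_strip_section_y]
  \<comment> \<open>\<open>I\<close> is the x-derivative of the horizontal component of m^2 h^3 grad
    h, \<open>E\<close> the y-derivative of the vertical one; \<open>uxx\<close> cancels in the sum
    because u is harmonic.\<close>
  define I where "I y = 3 * (pos (u (x, y)))\<^sup>2 * ((ux (x, y))\<^sup>2) / (m y)\<^sup>2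
    + (pos (u (x, y))) ^ 3 * uxx (x, y) / (m y)\<^sup>2" for y
  define E where "E y = 3 * (pos (u (x, y)))\<^sup>2 * (uy (x, y) - m' y * u (x, y) / m y)\<^sup>2 / (m y)\<^sup>2
    - (pos (u (x, y))) ^ 3 * uxx (x, y) / (m y)\<^sup>2 + 2 * \<rho> * (pos (u (x, y))) ^ 4 / (m y) ^ 3" for y
  have "((\<lambda>x. integral (cbox 0 1) (\<lambda>y. (pos (u (x, y))) ^ 3 * ux (x, y) / (m y)\<^sup>2)) has_real_derivative
      integral (cbox 0 1) (\<lambda>y. 3 * (pos (u (x, y)))\<^sup>2 * ((ux (x, y))\<^sup>2) / (m y)\<^sup>2
        + (pos (u (x, y))) ^ 3 * uxx (x, y) / (m y)\<^sup>2)) (at x within UNIV)"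
  proof (rule leibniz_rule_field_derivative)
    show "((\<lambda>x. (pos (u (x, y))) ^ 3 * ux (x, y) / (m y)\<^sup>2) has_real_derivative
        3 * (pos (u (x, y)))\<^sup>2 * (ux (x, y))\<^sup>2 / (m y)\<^sup>2
        + (pos (u (x, y))) ^ 3 * uxx (x, y) / (m y)\<^sup>2) (at x within UNIV)"
      if "y \<in> cbox 0 1" for x y
    proof -
      have y: "0 \<le> y" "y \<le> 1" using that by auto
      have d1: "((\<lambda>x. (pos (u (x, y))) ^ 3) has_real_derivative
          3 * (pos (u (x, y)))\<^sup>2 * ux (x, y)) (at x)"
        unfolding u_def ux_def
        by (rule DERIV_chain2[OF has_real_derivative_pos_cube CR_dx_Im[OF A y]])
      have d2: "((\<lambda>x. ux (x, y)) has_real_derivative uxx (x, y)) (at x)"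
        unfolding ux_def uxx_def by (rule CR_dx_Im[OF A' y])
      show ?thesis
        using DERIV_cdivide[OF DERIV_mult[OF d1 d2], of "(m y)\<^sup>2"] mnz[OF y]
        by (simp add: field_simps power2_eq_square)
    qed
    show "(\<lambda>y. (pos (u (x, y))) ^ 3 * ux (x, y) / (m y)\<^sup>2) integrable_on cbox 0 1" for x
      using mnz unfolding cbox_interval
      by (intro integrable_continuous_interval continuous_intros cuy cm) auto
    have cm2: "continuous_on (UNIV \<times> cbox 0 1) (\<lambda>p::plane. m (snd p))"
      by (rule continuous_on_compose2[OF cm]) (auto intro: continuous_intros)
    have cu2: "continuous_on (UNIV \<times> cbox 0 1) u" "continuous_on (UNIV \<times> cbox 0 1) ux"
      "continuous_on (UNIV \<times> cbox 0 1) uxx"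
      by (rule continuous_on_subset[OF cu(1)] continuous_on_subset[OF cu(2)]
          continuous_on_subset[OF cu(4)]; auto)+
    have "continuous_on (UNIV \<times> cbox 0 1) (\<lambda>p. 3 * (pos (u p))\<^sup>2 * ((ux p)\<^sup>2) / (m (snd p))\<^sup>2
        + (pos (u p)) ^ 3 * uxx p / (m (snd p))\<^sup>2)"
      using mnz by (intro continuous_intros cu2 cm2) auto
    then show "continuous_on (UNIV \<times> cbox 0 1)
        (\<lambda>(x, y). 3 * (pos (u (x, y)))\<^sup>2 * ((ux (x, y))\<^sup>2) / (m y)\<^sup>2
        + (pos (u (x, y))) ^ 3 * uxx (x, y) / (m y)\<^sup>2)"
      by (simp add: split_beta')
  qed auto
  then have D: "(flux \<rho> A A' has_real_derivative integral {0..1} I) (at x)"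
    by (simp add: flux_def[abs_def] I_def[abs_def] u_def ux_def m_def)
  have dE: "((\<lambda>y. (pos (u (x, y))) ^ 3 * (uy (x, y) / (m y)\<^sup>2 - m' y * u (x, y) / (m y) ^ 3))
      has_real_derivative E y) (at y within {0..1})" if y: "0 \<le> y" "y \<le> 1" for y
  proof -
    have du: "((\<lambda>y. u (x, y)) has_real_derivative uy (x, y)) (at y within {0..1})"
      unfolding u_def uy_def by (rule CR_dy_Im[OF A y])
    have dpos: "((\<lambda>y. (pos (u (x, y))) ^ 3) has_real_derivative
        3 * (pos (u (x, y)))\<^sup>2 * uy (x, y)) (at y within {0..1})"
      by (rule DERIV_chain2[OF has_real_derivative_pos_cube du])
    have duy: "((\<lambda>y. uy (x, y)) has_real_derivative - uxx (x, y)) (at y within {0..1})"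
      unfolding uxx_def uy_def using has_real_derivative_Re[OF CR_dy[OF A' y]] by force
    have dm: "(m has_real_derivative m' y) (at y within {0..1})"
      unfolding m_def m'_def barrier_def[abs_def] by (auto intro!: derivative_eq_intros)
    have dm': "(m' has_real_derivative - 2 * \<rho>) (at y within {0..1})"
      unfolding m'_def[abs_def] by (auto intro!: derivative_eq_intros)
    have "((\<lambda>y. (pos (u (x, y))) ^ 3 * (uy (x, y) / (m y)\<^sup>2 - m' y * u (x, y) / (m y) ^ 3))
      has_real_derivative
       3 * (pos (u (x, y)))\<^sup>2 * uy (x, y) * (uy (x, y) / (m y)\<^sup>2 - m' y * u (x, y) / (m y) ^ 3)
       + ((- uxx (x, y) * (m y)\<^sup>2 - uy (x, y) * (2 * m y * m' y)) / ((m y)\<^sup>2 * (m y)\<^sup>2)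
          - ((- 2 * \<rho> * u (x, y) + uy (x, y) * m' y) * (m y) ^ 3
             - m' y * u (x, y) * (3 * (m y)\<^sup>2 * m' y)) / ((m y) ^ 3 * (m y) ^ 3)) * (pos (u (x, y))) ^ 3)
      (at y within {0..1})"
      using mnz[OF y]
      by (intro DERIV_mult dpos DERIV_diff DERIV_divide duy du dm'
          DERIV_cong[OF DERIV_power[OF dm]]) (auto simp: power2_eq_square)
    moreover have "3 * (pos (u (x, y)))\<^sup>2 * uy (x, y) * (uy (x, y) / (m y)\<^sup>2 - m' y * u (x, y) / (m y) ^ 3)
       + ((- uxx (x, y) * (m y)\<^sup>2 - uy (x, y) * (2 * m y * m' y)) / ((m y)\<^sup>2 * (m y)\<^sup>2)
          - ((- 2 * \<rho> * u (x, y) + uy (x, y) * m' y) * (m y) ^ 3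
             - m' y * u (x, y) * (3 * (m y)\<^sup>2 * m' y)) / ((m y) ^ 3 * (m y) ^ 3)) * (pos (u (x, y))) ^ 3
       = E y"
    proof (cases "u (x, y) > 0")
      case True
      then have "pos (u (x, y)) = u (x, y)" by simp
      have "((- uxx (x, y) * (m y)\<^sup>2 - uy (x, y) * (2 * m y * m' y)) / ((m y)\<^sup>2 * (m y)\<^sup>2))
          = - uxx (x, y) / (m y)\<^sup>2 - 2 * uy (x, y) * m' y / (m y) ^ 3"
        using mnz[OF y] by (simp add: field_simps power2_eq_square power3_eq_cube)
      moreover have "((- 2 * \<rho> * u (x, y) + uy (x, y) * m' y) * (m y) ^ 3
             - m' y * u (x, y) * (3 * (m y)\<^sup>2 * m' y)) / ((m y) ^ 3 * (m y) ^ 3)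
          = (uy (x, y) * m' y - 2 * \<rho> * u (x, y)) / (m y) ^ 3 - 3 * (m' y)\<^sup>2 * u (x, y) / (m y) ^ 4"
        using mnz[OF y] by (simp add: field_simps power2_eq_square power3_eq_cube power4_eq_xxxx)
      \<comment> \<open>Writing i for 1 / m turns the quotient identity into a polynomial
        one.\<close>
      moreover have alg: "3 * u\<^sup>2 * a * (a * i\<^sup>2 - n * u * i ^ 3)
          + (- (b * i\<^sup>2) - 2 * a * n * i ^ 3 - ((a * n - 2 * r * u) * i ^ 3 - 3 * n\<^sup>2 * u * i ^ 4)) * u ^ 3
          = 3 * u\<^sup>2 * (a - n * u * i)\<^sup>2 * i\<^sup>2 - u ^ 3 * b * i\<^sup>2 + 2 * r * u ^ 4 * i ^ 3"
        for u a b n r i :: real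
        by (simp add: algebra_simps eval_nat_numeral)
      moreover have "pos (u (x, y)) = u (x, y)" by fact
      ultimately show ?thesis
        unfolding E_def divide_inverse power_inverse[symmetric] by simp
    next
      case False
      then have "pos (u (x, y)) = 0" by simp
      then show ?thesis by (simp add: E_def)
    qed
    ultimately show ?thesis by simp
  qed
  have m01: "m 1 = 1" "m' 1 = 1 - 2 * \<rho>" by (simp_all add: m_def m'_def barrier_def)
  have "(E has_integral (pos (u (x, 1))) ^ 3 * (uy (x, 1) / (m 1)\<^sup>2 - m' 1 * u (x, 1) / (m 1) ^ 3)
      - (pos (u (x, 0))) ^ 3 * (uy (x, 0) / (m 0)\<^sup>2 - m' 0 * u (x, 0) / (m 0) ^ 3)) {0..1}"
    by (rule fundamental_theorem_of_calculus)
      (use dE in \<open>auto simp flip: has_real_derivative_iff_has_vector_derivative\<close>)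
  then have E: "(E has_integral (pos (u (x, 1))) ^ 3 * (uy (x, 1) - (1 - 2 * \<rho>) * u (x, 1))) {0..1}"
    using bed[of x] by (simp add: m01 u_def)
  have "(\<lambda>y. I y + E y) = (\<lambda>y. 3 * (pos (u (x, y)))\<^sup>2 * ((ux (x, y))\<^sup>2
       + (uy (x, y) - m' y * u (x, y) / m y)\<^sup>2) / (m y)\<^sup>2 + 2 * \<rho> * (pos (u (x, y))) ^ 4 / (m y) ^ 3)"
    by (simp add: I_def E_def fun_eq_iff add_divide_distrib ring_distribs)
  then have "dissipation \<rho> A A' x = integral {0..1} (\<lambda>y. I y + E y)"
    by (simp add: dissipation_def u_def ux_def uy_def m'_def m_def)
  moreover have "I integrable_on {0..1}"
    unfolding I_def using mnz
    by (intro integrable_continuous_interval continuous_intros cuy cm) auto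
  ultimately have "dissipation \<rho> A A' x = integral {0..1} I + integral {0..1} E"
    using E by (simp add: integral_add has_integral_integrable)
  then show ?thesis
    using D integral_unique[OF E] by (simp add: u_def uy_def)
qed

text \<open>With p the positive part of u, X = p |u_x| and Y = p^2, the flux density is at most X Y
  / m^2. Young's inequality bounds it by the gradient term and half of the zero-order term; the
  other half is left over as the mass.\<close>

lemma flux_le_dissipation:
  assumes A: "CR A A'" and \<rho>: "0 < \<rho>" "\<rho> \<le> 1/2"
  shows "\<rho> * \<bar>flux \<rho> A A' x\<bar> + \<rho> * mass \<rho> A x \<le> dissipation \<rho> A A' x"
proof -
  define u where "u y = Im (A (x, y))" for y
  define ux where "ux y = Im (A' (x, y))" for y
  define uy where "uy y = Re (A' (x, y))" for y
  define m where "m = barrier \<rho>"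
  note mb = barrier_bounds[OF \<rho>, folded m_def]
  then have mnz: "m y \<noteq> 0" if "0 \<le> y" "y \<le> 1" for y using that by (metis less_irrefl)
  have c: "continuous_on {0..1} u" "continuous_on {0..1} ux" "continuous_on {0..1} uy"
    unfolding u_def ux_def uy_def
    by (intro continuous_intros continuous_on_strip_section_y[OF CR_cont[OF A]]
        continuous_on_strip_section_y[OF CR_cont'[OF A]])+
  have cm: "continuous_on S m" for S unfolding m_def barrier_def by (intro continuous_intros)
  define f where "f y = (pos (u y)) ^ 3 * ux y / (m y)\<^sup>2" for y
  define g where "g y = (pos (u y)) ^ 4 / (m y) ^ 3" for y
  define h where "h y = 3 * (pos (u y))\<^sup>2 * ((ux y)\<^sup>2 + (uy y - (1 - 2 * \<rho> * y) * u y / m y)\<^sup>2) / (m y)\<^sup>2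
    + 2 * \<rho> * (pos (u y)) ^ 4 / (m y) ^ 3" for y
  have cf: "continuous_on {0..1} f" and cg: "continuous_on {0..1} g" and ch: "continuous_on {0..1} h"
    unfolding f_def g_def h_def using mnz by (auto intro!: continuous_intros c cm)
  have point: "\<rho> * \<bar>f y\<bar> + \<rho> * g y \<le> h y" if y: "y \<in> {0..1}" for y
  proof -
    define p where "p = pos (u y)"
    define X where "X = p * \<bar>ux y\<bar>"
    define Y where "Y = p\<^sup>2"
    have m0: "0 < m y" "m y \<le> 1" using mb y by auto
    have XY: "X \<ge> 0" "Y \<ge> 0" "p \<ge> 0" by (simp_all add: X_def Y_def p_def)
    have "\<rho> * m y * (X * Y) \<le> 3 * m y * X\<^sup>2 + \<rho> * Y\<^sup>2"
    proof -
      have "2 * (X * Y) \<le> X\<^sup>2 + Y\<^sup>2" by (sos)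
      then have "\<rho> * m y * (2 * (X * Y)) \<le> \<rho> * m y * (X\<^sup>2 + Y\<^sup>2)"
        using m0 \<rho> by (intro mult_left_mono) auto
      moreover have "\<rho> * m y * X\<^sup>2 \<le> 3 * m y * X\<^sup>2"
        using m0 \<rho> by (intro mult_right_mono) auto
      moreover have "\<rho> * m y * Y\<^sup>2 \<le> \<rho> * 1 * Y\<^sup>2"
        using m0 \<rho> by (intro mult_right_mono mult_left_mono) auto
      moreover have "0 \<le> m y * X\<^sup>2" "0 \<le> \<rho> * Y\<^sup>2" using m0 \<rho> by auto
      ultimately show ?thesis by (simp add: algebra_simps)
    qed
    then have "(\<rho> * m y * (X * Y) + \<rho> * Y\<^sup>2) / (m y) ^ 3 \<le> (3 * m y * X\<^sup>2 + 2 * \<rho> * Y\<^sup>2) / (m y) ^ 3"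
      using m0 by (intro divide_right_mono) auto
    also have "\<dots> \<le> h y"
    proof -
      have "3 * m y * X\<^sup>2 / (m y) ^ 3 = 3 * p\<^sup>2 * (ux y)\<^sup>2 / (m y)\<^sup>2"
        using m0 by (simp add: X_def power_mult_distrib power2_eq_square power3_eq_cube)
      moreover have "3 * p\<^sup>2 * (ux y)\<^sup>2 / (m y)\<^sup>2 \<le>
          3 * p\<^sup>2 * ((ux y)\<^sup>2 + (uy y - (1 - 2 * \<rho> * y) * u y / m y)\<^sup>2) / (m y)\<^sup>2"
        by (intro divide_right_mono mult_left_mono) auto
      ultimately show ?thesis
        by (simp add: h_def p_def[symmetric] Y_def add_divide_distrib flip: power_mult)
    qed
    also have "(\<rho> * m y * (X * Y) + \<rho> * Y\<^sup>2) / (m y) ^ 3 = \<rho> * \<bar>f y\<bar> + \<rho> * g y"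
      using m0 XY
      by (simp add: f_def g_def p_def[symmetric] X_def Y_def abs_mult add_divide_distrib
          power2_eq_square power3_eq_cube power4_eq_xxxx mult.assoc)
    finally show ?thesis .
  qed
  have fI: "f integrable_on {0..1}" and gI: "g integrable_on {0..1}" and hI: "h integrable_on {0..1}"
    and afI: "(\<lambda>y. \<bar>f y\<bar>) integrable_on {0..1}"
    by (intro integrable_continuous_interval cf cg ch continuous_intros)+
  have "\<bar>integral {0..1} f\<bar> \<le> integral {0..1} (\<lambda>y. \<bar>f y\<bar>)"
    using integral_norm_bound_integral[OF fI afI] by simp
  then have "\<rho> * \<bar>integral {0..1} f\<bar> + \<rho> * integral {0..1} g
      \<le> \<rho> * integral {0..1} (\<lambda>y. \<bar>f y\<bar>) + \<rho> * integral {0..1} g"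
    using \<rho> by (intro add_right_mono mult_left_mono) auto
  also have "\<dots> = integral {0..1} (\<lambda>y. \<rho> * \<bar>f y\<bar> + \<rho> * g y)"
    using afI gI by (simp add: integral_add integrable_on_mult_right)
  also have "\<dots> \<le> integral {0..1} h"
    using afI gI hI point by (intro integral_le integrable_add integrable_on_mult_right) auto
  finally show ?thesis
    by (simp add: flux_def mass_def dissipation_def f_def[abs_def] g_def[abs_def] h_def[abs_def]
        u_def ux_def uy_def m_def)
qed

lemma flux_vanishes_at_infinity:
  assumes A: "CR A A'" and \<rho>: "0 < \<rho>" "\<rho> \<le> 1/2" and "0 < \<epsilon>"
    and decay: "\<And>e. 0 < e \<Longrightarrow> \<exists>T. \<forall>x\<ge>T. \<forall>y\<in>{0..1}. \<bar>Im (A (x, y))\<bar> \<le> e \<and> \<bar>Im (A' (x, y))\<bar> \<le> e"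
  shows "\<exists>T. \<forall>x\<ge>T. \<bar>flux \<rho> A A' x\<bar> \<le> \<epsilon>"
proof -
  \<comment> \<open>Once u <= 1 the cube is at most 1, and the denominator is at least
    \<rho>^2.\<close>
  define e where "e = min 1 (\<epsilon> * \<rho>\<^sup>2)"
  have e: "0 < e" "e \<le> 1" "e \<le> \<epsilon> * \<rho>\<^sup>2" using \<rho> \<open>0 < \<epsilon>\<close> by (auto simp: e_def)
  obtain T where T: "\<And>x y. \<lbrakk>T \<le> x; 0 \<le> y; y \<le> 1\<rbrakk> \<Longrightarrow> \<bar>Im (A (x, y))\<bar> \<le> e \<and> \<bar>Im (A' (x, y))\<bar> \<le> e"
    using decay[OF e(1)] by (meson atLeastAtMost_iff)
  have "\<bar>flux \<rho> A A' x\<bar> \<le> \<epsilon>" if x: "T \<le> x" for x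
  proof -
    have bnd: "\<bar>(pos (Im (A (x, y)))) ^ 3 * Im (A' (x, y)) / (barrier \<rho> y)\<^sup>2\<bar> \<le> \<epsilon>"
      if y: "0 \<le> y" "y \<le> 1" for y
    proof -
      note b = barrier_bounds[OF \<rho> y]
      have "(pos (Im (A (x, y)))) ^ 3 \<le> 1 ^ 3"
        using T[OF x y] e by (intro power_mono) auto
      then have "\<bar>(pos (Im (A (x, y)))) ^ 3 * Im (A' (x, y))\<bar> \<le> 1 * e"
        unfolding abs_mult using T[OF x y] by (intro mult_mono) auto
      also have "\<dots> \<le> \<epsilon> * (barrier \<rho> y)\<^sup>2"
      proof -
        have "\<rho>\<^sup>2 \<le> (barrier \<rho> y)\<^sup>2" using b \<rho> by (intro power_mono) auto
        then have "\<epsilon> * \<rho>\<^sup>2 \<le> \<epsilon> * (barrier \<rho> y)\<^sup>2" using \<open>0 < \<epsilon>\<close> by simp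
        then show ?thesis using e(3) by linarith
      qed
      finally show ?thesis using b by (simp add: abs_divide divide_le_eq)
    qed
    have nz: "barrier \<rho> y \<noteq> 0" if "y \<in> {0..1}" for y using barrier_bounds[OF \<rho>, of y] that by auto
    have "norm (flux \<rho> A A' x) \<le> \<epsilon> * (1 - 0)"
      unfolding flux_def
    proof (rule integral_bound)
      show "continuous_on {0..1} (\<lambda>y. (pos (Im (A (x, y)))) ^ 3 * Im (A' (x, y)) / (barrier \<rho> y)\<^sup>2)"
        using nz unfolding barrier_def
        by (intro continuous_intros continuous_on_strip_section_y[OF CR_cont[OF A]]
            continuous_on_strip_section_y[OF CR_cont'[OF A]]) auto
    qed (use bnd in auto)
    then show ?thesis by simp
  qed
  then show ?thesis by blast
qed

text \<open>The weighted total flux is nondecreasing in \<open>x\<close>, and zero both at \<open>x = 0\<close> and at infinity. Hence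
  the dissipation vanishes. The weight is frozen at its value at \<open>R\<close> for \<open>x < R\<close>, where the
  boundary term is zero whatever the weight.\<close>
lemma energy_estimate:
  assumes A: "CR A A'" "CR A' A''" and B: "CR B B'" "CR B' B''" and \<rho>: "0 < \<rho>" "\<rho> \<le> 1/2"
    and bed: "\<And>x. Im (A (x, 0)) = 0" "\<And>x. Im (B (x, 0)) = 0"
    and axis: "\<And>y. \<lbrakk>0 \<le> y; y \<le> 1\<rbrakk> \<Longrightarrow> Im (A (0, y)) = 0"
      "\<And>y. \<lbrakk>0 \<le> y; y \<le> 1\<rbrakk> \<Longrightarrow> Im (B (0, y)) = 0"
    and R: "0 \<le> R"
    and \<omega>: "continuous_on {R..} \<omega>" "\<And>x. R < x \<Longrightarrow> (\<omega> has_real_derivative \<omega>' x) (at x)"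
      "\<And>x. R \<le> x \<Longrightarrow> 0 < \<omega> x \<and> \<omega> x \<le> W" "\<And>x. R < x \<Longrightarrow> \<bar>\<omega>' x\<bar> \<le> \<rho> * \<omega> x"
    and near: "\<And>x. \<lbrakk>0 < x; x < R\<rbrakk> \<Longrightarrow> Im (A (x, 1)) \<le> 0 \<and> Im (B (x, 1)) \<le> 0"
    and far: "\<And>x. R < x \<Longrightarrow>
      (pos (Im (A (x, 1)))) ^ 3 * (Re (A' (x, 1)) - (1 - 2 * \<rho>) * Im (A (x, 1)))
      + \<omega> x * ((pos (Im (B (x, 1)))) ^ 3 * (Re (B' (x, 1)) - (1 - 2 * \<rho>) * Im (B (x, 1)))) \<le> 0"
    and decayA: "\<And>e. 0 < e \<Longrightarrow> \<exists>T. \<forall>x\<ge>T. \<forall>y\<in>{0..1}. \<bar>Im (A (x, y))\<bar> \<le> e \<and> \<bar>Im (A' (x, y))\<bar> \<le> e"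
    and decayB: "\<And>e. 0 < e \<Longrightarrow> \<exists>T. \<forall>x\<ge>T. \<forall>y\<in>{0..1}. \<bar>Im (B (x, y))\<bar> \<le> e \<and> \<bar>Im (B' (x, y))\<bar> \<le> e"
    and xy: "0 \<le> x" "0 \<le> y" "y \<le> 1"
  shows "Im (A (x, y)) \<le> 0"
proof -
  define \<Phi> where "\<Phi> x = flux \<rho> A A' x + \<omega> (max R x) * flux \<rho> B B' x" for x
  define q where "q A A' x = (pos (Im (A (x, 1)))) ^ 3 * (Re (A' (x, 1)) - (1 - 2 * \<rho>) * Im (A (x, 1)))"
    for A A' :: "plane \<Rightarrow> complex" and x
  note dA = flux_has_derivative[OF A \<rho> bed(1), folded q_def]
  note dB = flux_has_derivative[OF B \<rho> bed(2), folded q_def]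
  note leA = flux_le_dissipation[OF A(1) \<rho>]
  note leB = flux_le_dissipation[OF B(1) \<rho>]
  \<comment> \<open>Claimed for every \<open>C\<close>: an integral that does not exist has the
    value 0.\<close>
  have mass0: "0 \<le> mass \<rho> C x" for C x
  proof (cases "(\<lambda>y. (pos (Im (C (x, y)))) ^ 4 / (barrier \<rho> y) ^ 3) integrable_on {0..1}")
    case True
    have "0 \<le> (pos (Im (C (x, y)))) ^ 4 / (barrier \<rho> y) ^ 3" if "y \<in> {0..1}" for y
      using barrier_bounds(2)[OF \<rho>, of y] that by auto
    then show ?thesis unfolding mass_def by (rule integral_nonneg[OF True])
  qed (simp add: mass_def not_integrable_integral)
  have D: "\<exists>d. (\<Phi> has_real_derivative d) (at x) \<and> \<rho> * mass \<rho> A x \<le> d" if "0 < x" "x \<noteq> R" for x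
  proof (cases "x < R")
    case True
    have "q A A' x = 0" "q B B' x = 0" using near[of x] that True by (auto simp: q_def)
    then have "((\<lambda>x. flux \<rho> A A' x + \<omega> R * flux \<rho> B B' x) has_real_derivative
        dissipation \<rho> A A' x + \<omega> R * dissipation \<rho> B B' x) (at x)"
      using dA[of x] dB[of x] by (auto intro!: derivative_eq_intros)
    then have "(\<Phi> has_real_derivative dissipation \<rho> A A' x + \<omega> R * dissipation \<rho> B B' x) (at x)"
      by (rule DERIV_cong_ev[THEN iffD1, OF refl _ refl, rotated])
        (use True in \<open>auto simp: eventually_nhds \<Phi>_def max_def intro!: exI[of _ "{..<R}"]\<close>)
    moreover have "0 \<le> \<omega> R * dissipation \<rho> B B' x"
    proof (intro mult_nonneg_nonneg)
      have "0 \<le> \<rho> * \<bar>flux \<rho> B B' x\<bar> + \<rho> * mass \<rho> B x"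
        using \<rho> mass0 by (intro add_nonneg_nonneg mult_nonneg_nonneg) auto
      then show "0 \<le> dissipation \<rho> B B' x" using leB[of x] by linarith
    qed (use \<omega>(3)[of R] in auto)
    moreover have "0 \<le> \<rho> * \<bar>flux \<rho> A A' x\<bar>" using \<rho> by simp
    ultimately show ?thesis using leA[of x] by (intro exI conjI) (assumption, linarith)
  next
    case False
    then have x: "R < x" using that by simp
    have "((\<lambda>x. flux \<rho> A A' x + \<omega> x * flux \<rho> B B' x) has_real_derivative
        dissipation \<rho> A A' x - q A A' x + (\<omega>' x * flux \<rho> B B' x + (dissipation \<rho> B B' x - q B B' x) * \<omega> x)) (at x)"
      by (intro DERIV_add dA DERIV_mult dB \<omega>(2) x)
    then have "(\<Phi> has_real_derivative
        dissipation \<rho> A A' x - q A A' x + (\<omega>' x * flux \<rho> B B' x + (dissipation \<rho> B B' x - q B B' x) * \<omega> x)) (at x)"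
      by (rule DERIV_cong_ev[THEN iffD1, OF refl _ refl, rotated])
        (use x in \<open>auto simp: eventually_nhds \<Phi>_def max_def intro!: exI[of _ "{R<..}"]\<close>)
    moreover have "\<rho> * mass \<rho> A x \<le> dissipation \<rho> A A' x - q A A' x
        + (\<omega>' x * flux \<rho> B B' x + (dissipation \<rho> B B' x - q B B' x) * \<omega> x)"
    proof -
      \<comment> \<open>The derivative of the weight is paid for by the dissipation of B, so the
        mass of A survives.\<close>
      have "\<bar>\<omega>' x * flux \<rho> B B' x\<bar> \<le> (\<rho> * \<omega> x) * \<bar>flux \<rho> B B' x\<bar>"
        unfolding abs_mult by (intro mult_right_mono \<omega>(4) x) simp
      also have "\<dots> \<le> \<omega> x * dissipation \<rho> B B' x"
      proof -
        have "\<rho> * \<bar>flux \<rho> B B' x\<bar> \<le> dissipation \<rho> B B' x"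
          using leB[of x] mult_nonneg_nonneg[of \<rho>, OF _ mass0[of B x]] \<rho> by linarith
        from mult_left_mono[OF this, of "\<omega> x"] show ?thesis using \<omega>(3)[of x] x by (simp add: mult_ac)
      qed
      finally have "- (\<omega>' x * flux \<rho> B B' x) \<le> \<omega> x * dissipation \<rho> B B' x" by linarith
      moreover have "q A A' x + \<omega> x * q B B' x \<le> 0"
        using far[OF x] by (simp add: q_def)
      moreover have "0 \<le> \<rho> * \<bar>flux \<rho> A A' x\<bar>" using \<rho> by simp
      ultimately show ?thesis using leA[of x] by (simp add: algebra_simps)
    qed
    ultimately show ?thesis by blast
  qed
  have cont: "continuous_on {0..} \<Phi>"
  proof -
    have "continuous_on S (flux \<rho> A A')" "continuous_on S (flux \<rho> B B')" for S
      by (rule DERIV_continuous_on, rule has_field_derivative_at_within, rule dA)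
        (rule DERIV_continuous_on, rule has_field_derivative_at_within, rule dB)
    moreover have "continuous_on {0..} (\<lambda>x. \<omega> (max R x))"
      by (rule continuous_on_compose2[OF \<omega>(1)]) (auto intro!: continuous_intros)
    ultimately show ?thesis unfolding \<Phi>_def by (intro continuous_intros)
  qed
  have mono1: "\<Phi> a \<le> \<Phi> b" if "0 \<le> a" "a \<le> b" "b \<le> R \<or> R \<le> a" for a b
  proof (rule DERIV_nonneg_imp_increasing_open[of a b \<Phi>])
    show "\<exists>y. (\<Phi> has_real_derivative y) (at x) \<and> 0 \<le> y" if "a < x" "x < b" for x
      using D[of x] mult_nonneg_nonneg[OF less_imp_le[OF \<rho>(1)] mass0[of A x]] that
        \<open>0 \<le> a\<close> \<open>b \<le> R \<or> R \<le> a\<close> by fastforce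
    show "continuous_on {a..b} \<Phi>"
      by (rule continuous_on_subset[OF cont]) (use \<open>0 \<le> a\<close> in auto)
  qed fact
  have mono: "\<Phi> a \<le> \<Phi> b" if "0 \<le> a" "a \<le> b" for a b
  proof (cases "a \<le> R \<and> R \<le> b")
    case True
    then have "\<Phi> a \<le> \<Phi> R" "\<Phi> R \<le> \<Phi> b" using that R by (auto intro!: mono1)
    then show ?thesis by linarith
  qed (use that in \<open>auto intro!: mono1\<close>)
  have "flux \<rho> A A' 0 = integral {0..1} (\<lambda>_::real. 0)"
    unfolding flux_def by (rule integral_cong) (use axis in simp)
  moreover have "flux \<rho> B B' 0 = integral {0..1} (\<lambda>_::real. 0)"
    unfolding flux_def by (rule integral_cong) (use axis in simp)
  ultimately have \<Phi>0: "\<Phi> 0 = 0" by (simp add: \<Phi>_def)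
  \<comment> \<open>\<Phi> is nondecreasing, and far out it is arbitrarily small by decay and the
    bound W on the weight.\<close>
  have small: "\<Phi> x \<le> e" if "0 \<le> x" "0 < e" for x e
  proof -
    have W: "0 < W" using \<omega>(3)[of R] by auto
    obtain T1 where T1: "\<And>x. T1 \<le> x \<Longrightarrow> \<bar>flux \<rho> A A' x\<bar> \<le> e / 2"
      using flux_vanishes_at_infinity[OF A(1) \<rho> _ decayA, of "e / 2"] \<open>0 < e\<close> by auto
    obtain T2 where T2: "\<And>x. T2 \<le> x \<Longrightarrow> \<bar>flux \<rho> B B' x\<bar> \<le> e / (2 * W)"
      using flux_vanishes_at_infinity[OF B(1) \<rho> _ decayB, of "e / (2 * W)"] \<open>0 < e\<close> W by auto
    define t where "t = max (max x R) (max T1 T2)"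
    have t: "x \<le> t" "R \<le> t" "T1 \<le> t" "T2 \<le> t" by (auto simp: t_def)
    have "\<omega> t * flux \<rho> B B' t \<le> W * (e / (2 * W))"
      using \<omega>(3)[OF t(2)] T2[OF t(4)]
      by (intro order.trans[OF mult_left_mono mult_right_mono]) auto
    then have "\<Phi> t \<le> e / 2 + e / 2"
      using T1[OF t(3)] t W by (simp add: \<Phi>_def)
    then show ?thesis using mono[OF that(1) t(1)] by simp
  qed
  have zero: "\<Phi> x = 0" if "0 \<le> x" for x
    using mono[of 0 x] small[OF that] \<Phi>0 that field_le_epsilon[of "\<Phi> x" 0] by fastforce
  have main: "Im (A (x, y)) \<le> 0" if x: "0 < x" "x \<noteq> R" and y: "0 \<le> y" "y \<le> 1" for x y
  proof -
    obtain d where d: "(\<Phi> has_real_derivative d) (at x)" "\<rho> * mass \<rho> A x \<le> d" using D[OF x] by blast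
    \<comment> \<open>\<Phi> vanishes on the whole half line, hence so does its derivative, which
      dominates the mass.\<close>
    have "d = 0"
      by (rule DERIV_local_const[OF d(1) x(1)]) (auto intro!: zero[THEN trans] zero[symmetric])
    then have mass_eq: "mass \<rho> A x = 0" using d(2) mass0[of A x] \<rho> by (simp add: mult_le_0_iff)
    have nz: "barrier \<rho> y \<noteq> 0" if "y \<in> {0..1}" for y using barrier_bounds[OF \<rho>, of y] that by auto
    have "continuous_on {0..1} (\<lambda>y. (pos (Im (A (x, y)))) ^ 4 / (barrier \<rho> y) ^ 3)"
      using nz unfolding barrier_def
      by (intro continuous_intros continuous_on_strip_section_y[OF CR_cont[OF A(1)]]) auto
    moreover have "0 \<le> (pos (Im (A (x, y)))) ^ 4 / (barrier \<rho> y) ^ 3" if "y \<in> {0..1}" for y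
      using barrier_bounds(2)[OF \<rho>, of y] that by auto
    ultimately have "\<forall>y\<in>{0..1}. (pos (Im (A (x, y)))) ^ 4 / (barrier \<rho> y) ^ 3 = 0"
      using mass_eq unfolding mass_def by (subst (asm) integral_eq_0_iff) auto
    then have "(pos (Im (A (x, y)))) ^ 4 / (barrier \<rho> y) ^ 3 = 0" using y by auto
    then have "pos (Im (A (x, y))) = 0" using nz[of y] y by simp
    then show ?thesis by linarith
  qed
  show ?thesis
  proof (cases "x = R \<and> 0 < x")
    case True
    have "((\<lambda>t. Im (A (t, y))) \<longlongrightarrow> Im (A (x, y))) (at_right x)"
      using DERIV_isCont[OF CR_dx_Im[OF A(1) xy(2,3), of x]]
      by (simp add: isCont_def filterlim_at_split)
    then show ?thesis
      by (rule tendsto_upperbound)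
        (use True main xy in \<open>auto simp: eventually_at_filter\<close>)
  next
    case False
    then have "x = 0 \<or> 0 < x \<and> x \<noteq> R" using xy(1) by auto
    then show ?thesis using main[of x y] axis(1)[of y] xy by auto
  qed
qed

section \<open>Elements of \<open>\<X>\<close>\<close>

lemma X_spaceD:
  assumes "w \<in> X_space \<beta>"
  shows X_comp1_Cb: "comp1 w \<in> Cb_holder 3 \<beta>" and X_comp2_Cb: "comp2 w \<in> Cb_holder 3 \<beta>"
    and X_comp1_C0: "comp1 w \<in> C0 2" and X_comp2_C0: "comp2 w \<in> C0 2"
    and X_comp1_harmonic: "\<And>p. p \<in> strip \<Longrightarrow> dx (dx (comp1 w)) p + dy (dy (comp1 w)) p = 0"
    and X_comp2_harmonic: "\<And>p. p \<in> strip \<Longrightarrow> dx (dx (comp2 w)) p + dy (dy (comp2 w)) p = 0"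
    and X_comp1_bed: "comp1 w (x, 0) = 0" and X_comp2_bed: "comp2 w (x, 0) = 0"
    and X_comp1_even: "\<lbrakk>0 \<le> y; y \<le> 1\<rbrakk> \<Longrightarrow> comp1 w (- x, y) = comp1 w (x, y)"
    and X_comp2_even: "\<lbrakk>0 \<le> y; y \<le> 1\<rbrakk> \<Longrightarrow> comp2 w (- x, y) = comp2 w (x, y)"
  using assms by (auto simp: X_space_def bed_def)

lemma X_outside: "\<lbrakk>w \<in> X_space \<beta>; p \<notin> closed_strip\<rbrakk> \<Longrightarrow> w p = 0"
  unfolding X_space_def by blast

lemma Cb_holder_Ck: "f \<in> Cb_holder k \<beta> \<Longrightarrow> f \<in> Ck k"
  by (simp add: Cb_holder_def)

lemma X_comp1_Ck: "w \<in> X_space \<beta> \<Longrightarrow> comp1 w \<in> Ck (Suc (Suc (Suc 0)))"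
  and X_comp2_Ck: "w \<in> X_space \<beta> \<Longrightarrow> comp2 w \<in> Ck (Suc (Suc (Suc 0)))"
  using Cb_holder_Ck[OF X_comp1_Cb] Cb_holder_Ck[OF X_comp2_Cb]
  by (simp_all only: numeral_3_eq_3)

lemma partial_simps:
  "partial 0 0 f = f" "partial 1 0 f = dx f" "partial 0 1 f = dy f"
  "partial (Suc 0) 0 f = dx f" "partial 0 (Suc 0) f = dy f"
  "partial 2 0 f = dx (dx f)" "partial 1 1 f = dx (dy f)" "partial (Suc 0) (Suc 0) f = dx (dy f)"
  by (simp_all add: partial_def fun_eq_iff numeral_2_eq_2)

abbreviation strip_infinity :: "plane filter" where
  "strip_infinity \<equiv> inf at_infinity (principal closed_strip)"

lemma C0_tendsto: "\<lbrakk>f \<in> C0 k; i + j \<le> k\<rbrakk> \<Longrightarrow> (partial i j f \<longlongrightarrow> 0) strip_infinity"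
  by (simp add: C0_def)

lemma C0_2_tendsto:
  assumes "f \<in> C0 2"
  shows "(f \<longlongrightarrow> 0) strip_infinity" "(dx f \<longlongrightarrow> 0) strip_infinity" "(dy f \<longlongrightarrow> 0) strip_infinity"
    "(dx (dx f) \<longlongrightarrow> 0) strip_infinity" "(dx (dy f) \<longlongrightarrow> 0) strip_infinity"
  using C0_tendsto[OF assms, of 0 0] C0_tendsto[OF assms, of 1 0] C0_tendsto[OF assms, of 0 1]
    C0_tendsto[OF assms, of 2 0] C0_tendsto[OF assms, of 1 1]
  by (simp_all add: partial_simps)

lemma eventually_strip_infinity:
  assumes "eventually Q strip_infinity"
  shows "\<exists>T>0. \<forall>x y. T \<le> \<bar>x\<bar> \<longrightarrow> 0 \<le> y \<longrightarrow> y \<le> 1 \<longrightarrow> Q (x, y)"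
proof -
  obtain b where b: "\<And>p. b \<le> norm p \<Longrightarrow> p \<in> closed_strip \<Longrightarrow> Q p"
    using assms unfolding eventually_inf_principal eventually_at_infinity by blast
  have "Q (x, y)" if "max b 1 \<le> \<bar>x\<bar>" "0 \<le> y" "y \<le> 1" for x y
  proof (rule b)
    have "\<bar>x\<bar> \<le> norm (x, y)" using norm_fst_le[of x y] by simp
    then show "b \<le> norm (x, y)" using that by linarith
  qed (use that in simp)
  then show ?thesis by (intro exI[of _ "max b 1"]) auto
qed

lemma strip_infinity_at_top:
  assumes "0 \<le> y" "y \<le> 1"
  shows "filterlim (\<lambda>x. (x, y)) strip_infinity at_top"
  unfolding filterlim_inf filterlim_principal
proof
  show "filterlim (\<lambda>x::real. (x, y)) at_infinity at_top"
    unfolding filterlim_at_infinity[OF order_refl]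
  proof (intro allI impI)
    fix r :: real
    show "\<forall>\<^sub>F x::real in at_top. r \<le> norm (x, y)"
      using eventually_ge_at_top[of r]
    proof eventually_elim
      case (elim x)
      then show ?case using norm_fst_le[of x y] by simp
    qed
  qed
qed (use assms in simp)

lemma even_dx_odd:
  assumes f: "f \<in> Ck (Suc k)" and even: "\<And>x. f (- x, y) = f (x, y)" and y: "0 \<le> y" "y \<le> 1"
  shows "dx f (- x, y) = - dx f (x, y)"
proof (rule dx_eqI)
  have "((\<lambda>t. f (- t, y)) has_real_derivative dx f (x, y) * - 1) (at (- x))"
    by (rule DERIV_chain2[where f = "\<lambda>t. f (t, y)" and g = uminus])
      (use Ck_has_dx[OF f y, of x] in \<open>auto intro!: derivative_eq_intros\<close>)
  then show "((\<lambda>t. f (t, y)) has_real_derivative - dx f (x, y)) (at (- x))"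
    by (simp add: even)
qed

lemma bed_dx_zero: "(\<And>x. f (x, 0) = 0) \<Longrightarrow> dx f (x, 0) = 0"
  by (rule dx_eqI) simp

section \<open>The norm of \<open>\<X>\<close> controls the derivatives uniformly\<close>

text \<open>Equality is assumed on the closed strip only, because that is all an iterated derivative
  of a difference satisfies; in this form the lemma can be used inductively.\<close>

lemma Ck_diff_dx:
  assumes "f \<in> Ck (Suc k)" "g \<in> Ck (Suc k)"
    and "\<And>p. p \<in> closed_strip \<Longrightarrow> h p = f p - g p" and "p \<in> closed_strip"
  shows "dx h p = dx f p - dx g p"
proof -
  obtain x y where p: "p = (x, y)" "0 \<le> y" "y \<le> 1" using assms(4) by (cases p) auto
  have "((\<lambda>t. f (t, y) - g (t, y)) has_real_derivative dx f (x, y) - dx g (x, y)) (at x)"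
    by (intro DERIV_diff Ck_has_dx[OF assms(1)] Ck_has_dx[OF assms(2)] p)
  then show ?thesis using assms(3) p by (auto intro!: dx_eqI)
qed

lemma Ck_diff_dy:
  assumes "f \<in> Ck (Suc k)" "g \<in> Ck (Suc k)"
    and "\<And>p. p \<in> closed_strip \<Longrightarrow> h p = f p - g p" and "p \<in> closed_strip"
  shows "dy h p = dy f p - dy g p"
proof -
  obtain x y where p: "p = (x, y)" "0 \<le> y" "y \<le> 1" using assms(4) by (cases p) auto
  have "((\<lambda>t. f (x, t) - g (x, t)) has_real_derivative dy f (x, y) - dy g (x, y)) (at y within {0..1})"
    by (intro DERIV_diff Ck_has_dy[OF assms(1)] Ck_has_dy[OF assms(2)] p)
  then have "((\<lambda>t. h (x, t)) has_real_derivative dy f (x, y) - dy g (x, y)) (at y within {0..1})"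
    by (rule has_field_derivative_transform_within[OF _ zero_less_one]) (use assms(3) p in auto)
  then show ?thesis using p by (auto intro!: dy_eqI)
qed

lemma Ck_funpow_dx: "f \<in> Ck (i + k) \<Longrightarrow> (dx ^^ i) f \<in> Ck k"
  and Ck_funpow_dy: "f \<in> Ck (i + k) \<Longrightarrow> (dy ^^ i) f \<in> Ck k"
  by (induction i arbitrary: f) (auto simp: funpow_Suc_right simp del: funpow.simps)

lemma partial_diff:
  assumes f: "f \<in> Ck k" and g: "g \<in> Ck k" and "i + j \<le> k" and "p \<in> closed_strip"
  shows "partial i j (\<lambda>p. f p - g p) p = partial i j f p - partial i j g p"
proof -
  have y: "(dy ^^ j) (\<lambda>p. f p - g p) p = (dy ^^ j) f p - (dy ^^ j) g p"
    if "j \<le> k" "p \<in> closed_strip" for j p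
    using that
  proof (induction j arbitrary: p)
    case (Suc j)
    have C0: "f \<in> Ck (j + Suc (k - Suc j))" "g \<in> Ck (j + Suc (k - Suc j))" using f g Suc.prems by simp_all
    have C: "(dy ^^ j) f \<in> Ck (Suc (k - Suc j))" "(dy ^^ j) g \<in> Ck (Suc (k - Suc j))"
      by (rule Ck_funpow_dy, rule C0)+
    show ?case
      unfolding funpow.simps o_apply
      by (rule Ck_diff_dy[OF C _ Suc.prems(2)]) (rule Suc.IH, use Suc.prems in simp)
  qed simp
  have "(dx ^^ i) ((dy ^^ j) (\<lambda>p. f p - g p)) p = (dx ^^ i) ((dy ^^ j) f) p - (dx ^^ i) ((dy ^^ j) g) p"
    if "i + j \<le> k" "p \<in> closed_strip" for i p
    using that
  proof (induction i arbitrary: p)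
    case (Suc i)
    have C0: "f \<in> Ck (j + (i + Suc (k - Suc (i + j))))" "g \<in> Ck (j + (i + Suc (k - Suc (i + j))))"
      using f g Suc.prems by simp_all
    have C: "(dx ^^ i) ((dy ^^ j) f) \<in> Ck (Suc (k - Suc (i + j)))"
      "(dx ^^ i) ((dy ^^ j) g) \<in> Ck (Suc (k - Suc (i + j)))"
      by (rule Ck_funpow_dx, rule Ck_funpow_dy, rule C0)+
    show ?case
      unfolding funpow.simps o_apply
      by (rule Ck_diff_dx[OF C _ Suc.prems(2)]) (rule Suc.IH, use Suc.prems in simp)
  qed (use y in simp)
  then show ?thesis using assms by (simp add: partial_def)
qed

lemma bdd_above_holder_quotients:
  "bdd_above (holder_quotients \<beta> f) \<longleftrightarrow> (\<exists>M. \<forall>p q. p \<in> closed_strip \<longrightarrow> q \<in> closed_strip \<longrightarrow> p \<noteq> q \<longrightarrow>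
     \<bar>f p - f q\<bar> / dist p q powr \<beta> \<le> M)"
  unfolding bdd_above_def
proof (rule ex_cong1)
  show "(\<forall>x\<in>holder_quotients \<beta> f. x \<le> M) \<longleftrightarrow> (\<forall>p q. p \<in> closed_strip \<longrightarrow> q \<in> closed_strip \<longrightarrow>
      p \<noteq> q \<longrightarrow> \<bar>f p - f q\<bar> / dist p q powr \<beta> \<le> M)" for M
    unfolding holder_quotients_def by blast
qed

text \<open>One summand of the norm is the required supremum. To drop the others they must be
  nonnegative, which holds only for suprema of bounded nonempty sets; boundedness is inherited from
  f and g.\<close>

lemma partial_le_Cb_holder_norm:
  assumes f: "f \<in> Cb_holder k \<beta>" and g: "g \<in> Cb_holder k \<beta>" and ij: "i + j \<le> k"
    and p: "p \<in> closed_strip"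
  shows "\<bar>partial i j f p - partial i j g p\<bar> \<le> Cb_holder_norm k \<beta> (\<lambda>p. f p - g p)"
proof -
  define h where "h = (\<lambda>p. f p - g p)"
  note Ck = Cb_holder_Ck[OF f] Cb_holder_Ck[OF g]
  have h: "partial i j h p = partial i j f p - partial i j g p"
    if "i + j \<le> k" "p \<in> closed_strip" for i j p
    unfolding h_def by (rule partial_diff[OF Ck that])
  have bdd: "bdd_above ((\<lambda>p. \<bar>partial i j h p\<bar>) ` closed_strip)" if ij: "i + j \<le> k" for i j
  proof -
    have "bounded (partial i j f ` closed_strip)" "bounded (partial i j g ` closed_strip)"
      using f g ij by (auto simp: Cb_holder_def)
    then obtain a b where a: "\<And>p. p \<in> closed_strip \<Longrightarrow> \<bar>partial i j f p\<bar> \<le> a"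
      and b: "\<And>p. p \<in> closed_strip \<Longrightarrow> \<bar>partial i j g p\<bar> \<le> b"
      unfolding bounded_iff real_norm_def by blast
    have "\<bar>partial i j h p\<bar> \<le> a + b" if "p \<in> closed_strip" for p
      using a[OF that] b[OF that] unfolding h[OF ij that] by linarith
    then show ?thesis by (rule bdd_aboveI2)
  qed
  have Sup: "\<bar>partial i j h p\<bar> \<le> (SUP p\<in>closed_strip. \<bar>partial i j h p\<bar>)"
    if "i + j \<le> k" "p \<in> closed_strip" for i j p
    by (rule cSUP_upper[OF that(2) bdd[OF that(1)]])
  have Sup0: "0 \<le> (SUP p\<in>closed_strip. \<bar>partial i j h p\<bar>)" if "i + j \<le> k" for i j
    using Sup[OF that p] by linarith
  have hol: "0 \<le> Sup (holder_quotients \<beta> (partial i (k - i) h))" if i: "i \<le> k" for i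
  proof -
    have "i + (k - i) = k" using i by simp
    then have "bdd_above (holder_quotients \<beta> (partial i (k - i) f))"
      "bdd_above (holder_quotients \<beta> (partial i (k - i) g))"
      using f g by (auto simp: Cb_holder_def)
    then obtain a b where
      a: "\<And>p q. \<lbrakk>p \<in> closed_strip; q \<in> closed_strip; p \<noteq> q\<rbrakk> \<Longrightarrow>
        \<bar>partial i (k - i) f p - partial i (k - i) f q\<bar> / dist p q powr \<beta> \<le> a" and
      b: "\<And>p q. \<lbrakk>p \<in> closed_strip; q \<in> closed_strip; p \<noteq> q\<rbrakk> \<Longrightarrow>
        \<bar>partial i (k - i) g p - partial i (k - i) g q\<bar> / dist p q powr \<beta> \<le> b"
      unfolding bdd_above_holder_quotients by metis
    have "\<bar>partial i (k - i) h p - partial i (k - i) h q\<bar> / dist p q powr \<beta> \<le> a + b"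
      if "p \<in> closed_strip" "q \<in> closed_strip" "p \<noteq> q" for p q
    proof -
      have "\<bar>partial i (k - i) h p - partial i (k - i) h q\<bar>
          \<le> \<bar>partial i (k - i) f p - partial i (k - i) f q\<bar> + \<bar>partial i (k - i) g p - partial i (k - i) g q\<bar>"
      proof -
        have le: "i + (k - i) \<le> k" using i by simp
        show ?thesis unfolding h[OF le that(1)] h[OF le that(2)] by linarith
      qed
      then have "\<bar>partial i (k - i) h p - partial i (k - i) h q\<bar> / dist p q powr \<beta>
          \<le> (\<bar>partial i (k - i) f p - partial i (k - i) f q\<bar> + \<bar>partial i (k - i) g p - partial i (k - i) g q\<bar>)
            / dist p q powr \<beta>"
        by (intro divide_right_mono) auto
      then show ?thesis using a[OF that] b[OF that] by (simp add: add_divide_distrib)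
    qed
    then have "bdd_above (holder_quotients \<beta> (partial i (k - i) h))"
      unfolding bdd_above_holder_quotients by blast
    moreover have "\<bar>partial i (k - i) h (0, 0) - partial i (k - i) h (0, 1)\<bar> / dist (0::real, 0::real) (0, 1) powr \<beta>
        \<in> holder_quotients \<beta> (partial i (k - i) h)"
      unfolding holder_quotients_def by (rule CollectI) (intro exI[of _ "(0, 0)"] exI[of _ "(0, 1)"], auto)
    ultimately show ?thesis by (intro cSup_upper2) auto
  qed
  have "(SUP p\<in>closed_strip. \<bar>partial i j h p\<bar>) \<le> (\<Sum>j\<le>k - i. SUP p\<in>closed_strip. \<bar>partial i j h p\<bar>)"
    using ij by (intro member_le_sum[of j "{..k - i}"]) (auto intro!: Sup0)
  also have "\<dots> \<le> (\<Sum>i\<le>k. \<Sum>j\<le>k - i. SUP p\<in>closed_strip. \<bar>partial i j h p\<bar>)"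
    using ij by (intro member_le_sum[of i "{..k}" "\<lambda>i. \<Sum>j\<le>k - i. SUP p\<in>closed_strip. \<bar>partial i j h p\<bar>"])
      (auto intro!: sum_nonneg Sup0)
  also have "\<dots> \<le> Cb_holder_norm k \<beta> h"
    unfolding Cb_holder_norm_def using hol by (auto intro!: sum_nonneg)
  finally show ?thesis using Sup[OF ij p] h[OF ij p] by (simp add: h_def)
qed

lemma partial_le_X_norm:
  assumes v: "v \<in> X_space \<beta>" and w: "w \<in> X_space \<beta>" and "i + j \<le> 3" and "p \<in> closed_strip"
  shows "\<bar>partial i j (comp1 v) p - partial i j (comp1 w) p\<bar> \<le> X_norm \<beta> (\<lambda>p. v p - w p)"
    and "\<bar>partial i j (comp2 v) p - partial i j (comp2 w) p\<bar> \<le> X_norm \<beta> (\<lambda>p. v p - w p)"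
  using partial_le_Cb_holder_norm[OF X_comp1_Cb[OF v] X_comp1_Cb[OF w] assms(3,4)]
    partial_le_Cb_holder_norm[OF X_comp2_Cb[OF v] X_comp2_Cb[OF w] assms(3,4)]
  by (auto simp: X_norm_def)

section \<open>A single wave\<close>

text \<open>With \<open>\<zeta> = w\<^sub>2 + (1 - \<gamma>) y\<close> this is \<open>(\<zeta>\<^sub>y + \<i> \<zeta>\<^sub>x) / (\<eta>\<^sub>y + \<i> \<eta>\<^sub>x)\<close>. Its imaginary part is the vertical
  velocity, up to sign, of the flow in the physical plane, and \<open>vel'\<close>, \<open>vel''\<close> are its derivatives.\<close>
definition vel :: "real \<Rightarrow> (plane \<Rightarrow> real \<times> real) \<Rightarrow> plane \<Rightarrow> complex" where
  "vel \<gamma> w p = grad (1 - \<gamma>) (comp2 w) p / grad 1 (comp1 w) p"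

definition vel' :: "real \<Rightarrow> (plane \<Rightarrow> real \<times> real) \<Rightarrow> plane \<Rightarrow> complex" where
  "vel' \<gamma> w p = (grad' (comp2 w) p - vel \<gamma> w p * grad' (comp1 w) p) / grad 1 (comp1 w) p"

definition vel'' :: "real \<Rightarrow> (plane \<Rightarrow> real \<times> real) \<Rightarrow> plane \<Rightarrow> complex" where
  "vel'' \<gamma> w p = (grad'' (comp2 w) p - (vel \<gamma> w p * grad'' (comp1 w) p + vel' \<gamma> w p * grad' (comp1 w) p)
     - vel' \<gamma> w p * grad' (comp1 w) p) / grad 1 (comp1 w) p"

text \<open>\<open>jac\<close> is \<open>|\<nabla>\<eta>|\<^sup>2\<close> and \<open>psiy\<close> is the \<open>y\<close>-derivative of the stream function
  \<open>\<zeta> + \<gamma> \<eta>\<^sup>2 / 2\<close>, both on the surface; primes denote \<open>x\<close>-derivatives.\<close>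
definition jac :: "(plane \<Rightarrow> real \<times> real) \<Rightarrow> real \<Rightarrow> real" where
  "jac w x = (1 + dy (comp1 w) (x, 1))\<^sup>2 + (dx (comp1 w) (x, 1))\<^sup>2"

definition jac' :: "(plane \<Rightarrow> real \<times> real) \<Rightarrow> real \<Rightarrow> real" where
  "jac' w x = 2 * ((1 + dy (comp1 w) (x, 1)) * dx (dy (comp1 w)) (x, 1)
     + dx (comp1 w) (x, 1) * dx (dx (comp1 w)) (x, 1))"

definition psiy :: "real \<Rightarrow> (plane \<Rightarrow> real \<times> real) \<Rightarrow> real \<Rightarrow> real" where
  "psiy \<gamma> w x = \<gamma> * (comp1 w (x, 1) + dy (comp1 w) (x, 1) + comp1 w (x, 1) * dy (comp1 w) (x, 1))
     + dy (comp2 w) (x, 1) + 1"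

definition psiy' :: "real \<Rightarrow> (plane \<Rightarrow> real \<times> real) \<Rightarrow> real \<Rightarrow> real" where
  "psiy' \<gamma> w x = \<gamma> * (dx (comp1 w) (x, 1) + dx (dy (comp1 w)) (x, 1)
       + (dx (comp1 w) (x, 1) * dy (comp1 w) (x, 1) + comp1 w (x, 1) * dx (dy (comp1 w)) (x, 1)))
     + dx (dy (comp2 w)) (x, 1)"

text \<open>On the surface \<open>- Im vel = (psiy / jac) \<eta>\<^sub>x\<close>. The weight is such that
  \<open>weight (psiy / jac)\<^sup>3 = jac psiy / \<epsilon>1\<close>, the coefficient of \<open>Re vel'\<close> in the boundary
  condition \<open>surface_robin\<close> below.\<close>
definition weight :: "real \<Rightarrow> real \<Rightarrow> (plane \<Rightarrow> real \<times> real) \<Rightarrow> real \<Rightarrow> real" where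
  "weight \<gamma> \<epsilon>1 w x = (jac w x) ^ 4 / (\<epsilon>1 * (psiy \<gamma> w x)\<^sup>2)"

definition weight' :: "real \<Rightarrow> real \<Rightarrow> (plane \<Rightarrow> real \<times> real) \<Rightarrow> real \<Rightarrow> real" where
  "weight' \<gamma> \<epsilon>1 w x = (4 * (jac w x) ^ 3 * jac' w x / (psiy \<gamma> w x)\<^sup>2
     - 2 * (jac w x) ^ 4 * psiy' \<gamma> w x / (psiy \<gamma> w x) ^ 3) / \<epsilon>1"

definition robin :: "real \<Rightarrow> real \<Rightarrow> (plane \<Rightarrow> real \<times> real) \<Rightarrow> real \<Rightarrow> real \<Rightarrow> real" where
  "robin \<gamma> \<epsilon>1 w \<alpha> x = ((jac w x)\<^sup>2 / \<epsilon>1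
       * (\<alpha> + \<gamma> * psiy \<gamma> w x * (1 + dy (comp1 w) (x, 1)) / jac w x)
     - jac w x * psiy \<gamma> w x / \<epsilon>1 * Im (vel' \<gamma> w (x, 1)) - dx (dx (comp1 w)) (x, 1))
     / (1 + dy (comp1 w) (x, 1))"

locale wave =
  fixes \<beta> \<gamma> \<epsilon>1 :: real and w :: "plane \<Rightarrow> real \<times> real" and \<alpha> :: real
  assumes eps: "0 < \<epsilon>1" and U: "(w, \<alpha>) \<in> U_set \<beta> \<gamma> \<epsilon>1" and sol: "solves \<gamma> \<epsilon>1 w \<alpha>"
begin

lemma X: "w \<in> X_space \<beta>" and kappa: "\<epsilon>1 < kappa \<epsilon>1 w \<alpha>" and lambda: "0 < lambda \<epsilon>1 w \<alpha>"
  using U by (auto simp: U_set_def)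

abbreviation "f1 \<equiv> comp1 w"
abbreviation "f2 \<equiv> comp2 w"
abbreviation "A \<equiv> grad 1 f1"
abbreviation "A' \<equiv> grad' f1"
abbreviation "A'' \<equiv> grad'' f1"
abbreviation "Z \<equiv> grad (1 - \<gamma>) f2"
abbreviation "F \<equiv> vel \<gamma> w"
abbreviation "F' \<equiv> vel' \<gamma> w"
abbreviation "F'' \<equiv> vel'' \<gamma> w"
abbreviation "J \<equiv> jac w"
abbreviation "P \<equiv> psiy \<gamma> w"

lemmas Ck1 = X_comp1_Ck[OF X] and Ck2 = X_comp2_Ck[OF X]
lemmas Ck1x = Ck_dx[OF Ck1] and Ck1y = Ck_dy[OF Ck1] and Ck2y = Ck_dy[OF Ck2]

lemmas CR_A = CR_grad(1)[OF Ck1 X_comp1_harmonic[OF X]] and CR_A' = CR_grad(2)[OF Ck1 X_comp1_harmonic[OF X]]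
lemmas CR_Z = CR_grad(1)[OF Ck2 X_comp2_harmonic[OF X]] and CR_Z' = CR_grad(2)[OF Ck2 X_comp2_harmonic[OF X]]

text \<open>The infimum \<open>lambda\<close> runs over the open strip, but its positive lower bound
  passes to the boundary by continuity; a zero of the gradient would violate it.\<close>

lemma A_nonzero: "p \<in> closed_strip \<Longrightarrow> A p \<noteq> 0"
proof -
  define g where "g p = 4 * (1 + \<epsilon>1 - 2 * \<alpha> * f1 p)\<^sup>2 * ((dx f1 p)\<^sup>2 + (1 + dy f1 p)\<^sup>2)" for p
  assume "p \<in> closed_strip"
  then obtain x y where p: "p = (x, y)" and y: "0 \<le> y" "y \<le> 1" by (cases p) auto
  have "bdd_below (g ` strip)" by (rule bdd_belowI2[of _ 0]) (simp add: g_def)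
  then have le: "lambda \<epsilon>1 w \<alpha> \<le> g q" if "q \<in> strip" for q
    unfolding lambda_def g_def[symmetric] using that by (rule cINF_lower)
  have "continuous_on closed_strip g"
    unfolding g_def
    by (intro continuous_intros Ck_continuous[OF Ck1] Ck_continuous[OF Ck1x] Ck_continuous[OF Ck1y])
  then have "continuous_on (closure {0<..<1}) (\<lambda>y. g (x, y))"
    using continuous_on_strip_section_y[of g x] by simp
  then have "lambda \<epsilon>1 w \<alpha> \<le> g (x, y)"
    by (rule continuous_ge_on_closure) (use y le in \<open>auto simp: strip_def\<close>)
  then have "g (x, y) \<noteq> 0" using lambda by linarith
  then have "(dx f1 (x, y))\<^sup>2 + (1 + dy f1 (x, y))\<^sup>2 \<noteq> 0" by (auto simp: g_def)
  then show ?thesis by (auto simp: p grad_def complex_eq_iff)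
qed

lemma CR_F: "CR F F'"
  using CR_divide[OF CR_Z CR_A A_nonzero, of "1 - \<gamma>"]
  by (simp add: vel_def[abs_def] vel'_def[abs_def])

lemma CR_F': "CR F' F''"
  using CR_divide[OF CR_diff[OF CR_Z' CR_mult[OF CR_F CR_A']] CR_A A_nonzero]
  by (simp add: vel'_def[abs_def, symmetric] vel'_def[symmetric] vel''_def[abs_def])

section \<open>Identities on the surface\<close>

lemma jac_pos: "0 < J x"
proof -
  have "A (x, 1) \<noteq> 0" by (rule A_nonzero) simp
  then have "1 + dy f1 (x, 1) \<noteq> 0 \<or> dx f1 (x, 1) \<noteq> 0" by (auto simp: grad_def complex_eq_iff)
  then show ?thesis unfolding jac_def by (auto intro: add_pos_nonneg add_nonneg_pos)
qed

lemma bernoulli: "(P x)\<^sup>2 + \<epsilon>1 = (1 + \<epsilon>1 - 2 * \<alpha> * f1 (x, 1)) * J x"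
proof -
  have "F2 \<gamma> \<epsilon>1 w \<alpha> x = 0" using sol by (simp add: solves_def)
  then show ?thesis by (simp add: F2_def Let_def psiy_def jac_def algebra_simps)
qed

lemma kinematic: "f2 (x, 1) = - \<gamma> * f1 (x, 1) - 1/2 * \<gamma> * (f1 (x, 1))\<^sup>2"
proof -
  have "F1 \<gamma> w \<alpha> x = 0" using sol by (simp add: solves_def)
  then show ?thesis by (simp add: F1_def Let_def)
qed

lemma dx_surface:
  "((\<lambda>x. f1 (x, 1)) has_real_derivative dx f1 (x, 1)) (at x)"
  "((\<lambda>x. dx f1 (x, 1)) has_real_derivative dx (dx f1) (x, 1)) (at x)"
  "((\<lambda>x. dy f1 (x, 1)) has_real_derivative dx (dy f1) (x, 1)) (at x)"
  "((\<lambda>x. f2 (x, 1)) has_real_derivative dx f2 (x, 1)) (at x)"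
  "((\<lambda>x. dy f2 (x, 1)) has_real_derivative dx (dy f2) (x, 1)) (at x)"
  by (rule Ck_has_dx[OF Ck1] Ck_has_dx[OF Ck1x] Ck_has_dx[OF Ck1y] Ck_has_dx[OF Ck2] Ck_has_dx[OF Ck2y]; simp)+

lemma jac_deriv: "(J has_real_derivative jac' w x) (at x)"
  unfolding jac_def[abs_def] jac'_def
  by (auto intro!: derivative_eq_intros dx_surface)

lemma psiy_deriv: "(P has_real_derivative psiy' \<gamma> w x) (at x)"
  unfolding psiy_def[abs_def] psiy'_def
  by (auto intro!: derivative_eq_intros dx_surface)

text \<open>The Bernoulli condition and \<open>kappa > \<epsilon>1\<close> exclude zeros, and \<open>psiy \<rightarrow> 1\<close> at infinity.\<close>
lemma psiy_pos: "0 < P x"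
proof (rule ccontr)
  assume "\<not> 0 < P x"
  then have le: "P x \<le> 0" by simp
  have nz: "P x \<noteq> 0" for x
  proof -
    have eq: "(1 + \<epsilon>1 - 2 * \<alpha> * f1 (x, 1)) * ((dx f1 (x, 1))\<^sup>2 + (1 + dy f1 (x, 1))\<^sup>2)
        = (P x)\<^sup>2 + \<epsilon>1" for x
      using bernoulli[of x] by (simp add: jac_def add.commute)
    have "kappa \<epsilon>1 w \<alpha> \<le> (1 + \<epsilon>1 - 2 * \<alpha> * f1 (x, 1)) * ((dx f1 (x, 1))\<^sup>2 + (1 + dy f1 (x, 1))\<^sup>2)"
      unfolding kappa_def
    proof (rule cINF_lower)
      show "bdd_below ((\<lambda>p. (1 + \<epsilon>1 - 2 * \<alpha> * f1 p) * ((dx f1 p)\<^sup>2 + (1 + dy f1 p)\<^sup>2)) ` surface)"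
        by (rule bdd_belowI2[of _ 0]) (use eps eq in \<open>auto simp: surface_def\<close>)
    qed (simp add: surface_def)
    then show ?thesis using kappa eq[of x] by auto
  qed
  have cont: "continuous_on S P" for S
    by (rule DERIV_continuous_on[OF has_field_derivative_at_within[OF psiy_deriv]])
  note lim = C0_2_tendsto[OF X_comp1_C0[OF X]] C0_2_tendsto[OF X_comp2_C0[OF X]]
  have "((\<lambda>p. \<gamma> * (f1 p + dy f1 p + f1 p * dy f1 p) + dy f2 p + 1) \<longlongrightarrow> \<gamma> * (0 + 0 + 0 * 0) + 0 + 1) strip_infinity"
    by (intro tendsto_intros lim)
  then have "\<forall>\<^sub>F p in strip_infinity. 0 < \<gamma> * (f1 p + dy f1 p + f1 p * dy f1 p) + dy f2 p + 1"
    by (rule order_tendstoD) simp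
  from eventually_strip_infinity[OF this] obtain T where T: "\<forall>x y. T \<le> \<bar>x\<bar> \<longrightarrow> 0 \<le> y \<longrightarrow> y \<le> 1 \<longrightarrow>
      0 < \<gamma> * (f1 (x, y) + dy f1 (x, y) + f1 (x, y) * dy f1 (x, y)) + dy f2 (x, y) + 1"
    by blast
  have T: "0 < P x" if "T \<le> \<bar>x\<bar>" for x using T[rule_format, OF that, of 1] by (simp add: psiy_def)
  have "\<exists>z\<ge>x. z \<le> max x \<bar>T\<bar> \<and> P z = 0"
  proof (rule IVT')
    have "T \<le> \<bar>max x \<bar>T\<bar>\<bar>" by linarith
    then show "0 \<le> P (max x \<bar>T\<bar>)" using T less_imp_le by blast
  qed (use le cont in auto)
  then show False using nz by blast
qed

lemma dx_f2_surface: "dx f2 (x, 1) = - \<gamma> * (1 + f1 (x, 1)) * dx f1 (x, 1)"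
proof (rule dx_eqI)
  show "((\<lambda>t. f2 (t, 1)) has_real_derivative - \<gamma> * (1 + f1 (x, 1)) * dx f1 (x, 1)) (at x)"
    unfolding kinematic
    by (auto intro!: derivative_eq_intros dx_surface simp: algebra_simps)
qed

text \<open>The kinematic condition expresses \<zeta>_x through \<eta>_x; what remains combines to
  psiy = \<zeta>_y + \<gamma> \<eta> \<eta>_y, as \<eta> = 1 + f1 on the surface.\<close>

lemma vel_surface:
  "Im (F (x, 1)) = - P x * dx f1 (x, 1) / J x"
  "Re (F (x, 1)) * J x = P x * (1 + dy f1 (x, 1)) - \<gamma> * (1 + f1 (x, 1)) * J x"
proof -
  show "Im (F (x, 1)) = - P x * dx f1 (x, 1) / J x"
    using dx_f2_surface[of x] jac_pos[of x]
    by (simp add: vel_def grad_def jac_def psiy_def Im_divide divide_simps) (simp add: algebra_simps)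
  have "Re (F (x, 1)) * J x = (1 - \<gamma> + dy f2 (x, 1)) * (1 + dy f1 (x, 1)) + dx f2 (x, 1) * dx f1 (x, 1)"
    using jac_pos[of x] by (simp add: vel_def grad_def jac_def Re_divide)
  then show "Re (F (x, 1)) * J x = P x * (1 + dy f1 (x, 1)) - \<gamma> * (1 + f1 (x, 1)) * J x"
    unfolding dx_f2_surface by (simp add: jac_def psiy_def power2_eq_square algebra_simps)
qed

text \<open>This is the Bernoulli condition differentiated along the surface, with the tangential
  derivative of \<open>psiy\<close> expressed through \<open>vel'\<close>.\<close>
lemma surface_relation:
  "P x / J x * ((1 + dy f1 (x, 1)) * Re (F' (x, 1)) - dx f1 (x, 1) * Im (F' (x, 1)))
   = \<epsilon>1 / (J x)\<^sup>2 * ((1 + dy f1 (x, 1)) * dx (dy f1) (x, 1) + dx f1 (x, 1) * dx (dx f1) (x, 1))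
     - (\<alpha> + \<gamma> * P x * (1 + dy f1 (x, 1)) / J x) * dx f1 (x, 1)"
proof -
  define a v vx vy h p j rx where "a = 1 + dy f1 (x, 1)" and "v = dx f1 (x, 1)"
    and "vx = dx (dx f1) (x, 1)" and "vy = dx (dy f1) (x, 1)" and "h = 1 + f1 (x, 1)"
    and "p = P x" and "j = J x" and "rx = dx (dy f2) (x, 1)"
  have j: "j > 0" using jac_pos by (simp add: j_def)
  have "F' (x, 1) * A (x, 1) = grad' f2 (x, 1) - F (x, 1) * A' (x, 1)"
    using A_nonzero[of "(x, 1)"] by (simp add: vel'_def)
  then have "Re (F' (x, 1) * A (x, 1)) = Re (grad' f2 (x, 1) - F (x, 1) * A' (x, 1))" by simp
  then have E1: "a * Re (F' (x, 1)) - v * Im (F' (x, 1))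
      = rx - (Re (F (x, 1)) * vy - Im (F (x, 1)) * vx)"
    by (simp add: grad_def grad'_def a_def v_def rx_def vx_def vy_def mult.commute)
  have E2: "Re (F (x, 1)) * j = p * a - \<gamma> * h * j"
    using vel_surface(2)[of x] by (simp add: a_def h_def p_def j_def)
  have E3: "Im (F (x, 1)) * j = - p * v"
    using vel_surface(1)[of x] j by (simp add: v_def p_def j_def)
  have E4: "psiy' \<gamma> w x = rx + \<gamma> * v * a + \<gamma> * h * vy"
    by (simp add: psiy'_def rx_def a_def v_def h_def vy_def algebra_simps)
  have "((\<lambda>x. (P x)\<^sup>2 + \<epsilon>1) has_real_derivative 2 * P x * psiy' \<gamma> w x) (at x)"
    by (auto intro!: derivative_eq_intros psiy_deriv)
  moreover have "((\<lambda>x. (1 + \<epsilon>1 - 2 * \<alpha> * f1 (x, 1)) * J x) has_real_derivative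
      - 2 * \<alpha> * v * J x + (1 + \<epsilon>1 - 2 * \<alpha> * f1 (x, 1)) * jac' w x) (at x)"
    by (auto intro!: derivative_eq_intros dx_surface jac_deriv simp: v_def)
  ultimately have E5: "2 * p * psiy' \<gamma> w x = - 2 * \<alpha> * v * j + (1 + \<epsilon>1 - 2 * \<alpha> * f1 (x, 1)) * jac' w x"
    unfolding bernoulli p_def j_def using DERIV_unique by blast
  define s where "s = a * vy + v * vx"
  have E6: "jac' w x = 2 * s" by (simp add: jac'_def s_def a_def v_def vx_def vy_def)
  have E7: "p\<^sup>2 + \<epsilon>1 = (1 + \<epsilon>1 - 2 * \<alpha> * f1 (x, 1)) * j" using bernoulli by (simp add: p_def j_def)
  \<comment> \<open>Multiplied by j so that \<open>E7\<close> eliminates the factor containing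
    \<alpha> f1.\<close>
  have E8: "j * (p * psiy' \<gamma> w x) = - \<alpha> * v * j\<^sup>2 + (p\<^sup>2 + \<epsilon>1) * s"
  proof -
    have "p * psiy' \<gamma> w x = - \<alpha> * v * j + (1 + \<epsilon>1 - 2 * \<alpha> * f1 (x, 1)) * s" using E5 unfolding E6 by simp
    then have "j * (p * psiy' \<gamma> w x) = j * (- \<alpha> * v * j + (1 + \<epsilon>1 - 2 * \<alpha> * f1 (x, 1)) * s)" by simp
    also have "\<dots> = - \<alpha> * v * j\<^sup>2 + ((1 + \<epsilon>1 - 2 * \<alpha> * f1 (x, 1)) * j) * s"
      by (simp add: power2_eq_square algebra_simps)
    finally show ?thesis unfolding E7 .
  qed
  have "j * (a * Re (F' (x, 1)) - v * Im (F' (x, 1)))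
      = j * rx - (Re (F (x, 1)) * j) * vy + (Im (F (x, 1)) * j) * vx"
    unfolding E1 by (simp add: algebra_simps)
  also have "\<dots> = j * (rx + \<gamma> * h * vy) - p * s"
    unfolding E2 E3 by (simp add: s_def algebra_simps)
  also have "\<dots> = j * (psiy' \<gamma> w x - \<gamma> * v * a) - p * s" unfolding E4 by (simp add: algebra_simps)
  \<comment> \<open>Multiplied by p because only the product p psiy' is known, from
    \<open>E8\<close>.\<close>
  finally have "p * (j * (a * Re (F' (x, 1)) - v * Im (F' (x, 1))))
      = p * (j * (psiy' \<gamma> w x - \<gamma> * v * a) - p * s)" by simp
  also have "\<dots> = j * (p * psiy' \<gamma> w x) - \<gamma> * p * a * j * v - p\<^sup>2 * s"
    by (simp add: power2_eq_square algebra_simps)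
  also have "\<dots> = \<epsilon>1 * s - (\<alpha> * j\<^sup>2 + \<gamma> * p * a * j) * v" unfolding E8 by (simp add: algebra_simps)
  finally have E9: "p * (j * (a * Re (F' (x, 1)) - v * Im (F' (x, 1))))
      = \<epsilon>1 * s - (\<alpha> * j\<^sup>2 + \<gamma> * p * a * j) * v" .
  have "p / j * (a * Re (F' (x, 1)) - v * Im (F' (x, 1)))
      = p * (j * (a * Re (F' (x, 1)) - v * Im (F' (x, 1)))) / j\<^sup>2"
    using j by (simp add: power2_eq_square)
  also have "\<dots> = (\<epsilon>1 * s - (\<alpha> * j\<^sup>2 + \<gamma> * p * a * j) * v) / j\<^sup>2"
    unfolding E9 ..
  also have "\<dots> = \<epsilon>1 / j\<^sup>2 * s - (\<alpha> + \<gamma> * p * a / j) * v"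
    using j by (simp add: field_simps power2_eq_square)
  finally show ?thesis by (simp add: a_def v_def vx_def vy_def p_def j_def s_def)
qed

text \<open>Obtained from \<open>surface_relation\<close> on division by \<eta>_y. The quadratic
  terms \<eta>_x Im F' and \<eta>_x \<eta>_xx are read as coefficients of \<eta>_x, so the nonlinear
  condition becomes linear with coefficients that are controlled when the wave is small.\<close>

lemma surface_robin:
  assumes "1 + dy f1 (x, 1) \<noteq> 0"
  shows "Re (A' (x, 1)) - J x * P x / \<epsilon>1 * Re (F' (x, 1)) = robin \<gamma> \<epsilon>1 w \<alpha> x * dx f1 (x, 1)"
proof -
  define a v vx vy p j where "a = 1 + dy f1 (x, 1)" and "v = dx f1 (x, 1)"
    and "vx = dx (dx f1) (x, 1)" and "vy = dx (dy f1) (x, 1)" and "p = P x" and "j = J x"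
  define d where "d = \<alpha> + \<gamma> * p * a / j"
  have nz: "a \<noteq> 0" "j \<noteq> 0" "\<epsilon>1 \<noteq> 0" using assms jac_pos[of x] eps by (auto simp: a_def j_def)
  have "p / j * (a * Re (F' (x, 1)) - v * Im (F' (x, 1))) = \<epsilon>1 / j\<^sup>2 * (a * vy + v * vx) - d * v"
    using surface_relation[of x] by (simp add: a_def v_def vx_def vy_def p_def j_def d_def)
  then have "j\<^sup>2 / \<epsilon>1 * (p / j * (a * Re (F' (x, 1)) - v * Im (F' (x, 1))))
      = j\<^sup>2 / \<epsilon>1 * (\<epsilon>1 / j\<^sup>2 * (a * vy + v * vx) - d * v)" by simp
  then have "j * p / \<epsilon>1 * (a * Re (F' (x, 1)) - v * Im (F' (x, 1)))
      = (a * vy + v * vx) - j\<^sup>2 / \<epsilon>1 * d * v"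
    using nz by (simp add: right_diff_distrib power2_eq_square)
  then have "a * (vy - j * p / \<epsilon>1 * Re (F' (x, 1))) = (j\<^sup>2 / \<epsilon>1 * d - j * p / \<epsilon>1 * Im (F' (x, 1)) - vx) * v"
    by (simp add: algebra_simps)
  then have "vy - j * p / \<epsilon>1 * Re (F' (x, 1)) = (j\<^sup>2 / \<epsilon>1 * d - j * p / \<epsilon>1 * Im (F' (x, 1)) - vx) / a * v"
    using nz(1) by (simp add: eq_divide_eq mult.commute)
  then show ?thesis
    by (simp add: robin_def grad'_def a_def v_def vx_def vy_def p_def j_def d_def)
qed

section \<open>Symmetry, the bed, and limits at infinity\<close>

lemma axis_odd: "dx f1 (- x, y) = - dx f1 (x, y)" "dx f2 (- x, y) = - dx f2 (x, y)"
  if "0 \<le> y" "y \<le> 1"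
  using even_dx_odd[OF Ck1 X_comp1_even[OF X that] that] even_dx_odd[OF Ck2 X_comp2_even[OF X that] that]
  by auto

lemma Im_A: "Im (A p) = dx f1 p"
  by (simp add: grad_def)

lemma axis_zero: "dx f1 (0, y) = 0" "Im (F (0, y)) = 0" if "0 \<le> y" "y \<le> 1"
  using axis_odd[OF that, of 0] by (auto simp: vel_def grad_def Im_divide)

lemma bed_zero: "dx f1 (x, 0) = 0" "Im (F (x, 0)) = 0"
  using bed_dx_zero[of f1 x, OF X_comp1_bed[OF X]] bed_dx_zero[of f2 x, OF X_comp2_bed[OF X]]
  by (auto simp: vel_def grad_def Im_divide)

lemma grad_limits:
  "(A \<longlongrightarrow> 1) strip_infinity" "(A' \<longlongrightarrow> 0) strip_infinity"
  "(F \<longlongrightarrow> of_real (1 - \<gamma>)) strip_infinity" "(F' \<longlongrightarrow> 0) strip_infinity"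
proof -
  note lim = C0_2_tendsto[OF X_comp1_C0[OF X]] C0_2_tendsto[OF X_comp2_C0[OF X]]
  have "(A \<longlongrightarrow> Complex (1 + 0) 0) strip_infinity" unfolding grad_def[abs_def]
    by (intro tendsto_Complex tendsto_intros lim)
  then show A: "(A \<longlongrightarrow> 1) strip_infinity" by (simp add: one_complex.code)
  have "(A' \<longlongrightarrow> Complex 0 0) strip_infinity" "(grad' f2 \<longlongrightarrow> Complex 0 0) strip_infinity"
    unfolding grad'_def[abs_def] by (intro tendsto_Complex lim)+
  then have A': "(A' \<longlongrightarrow> 0) strip_infinity" and Z': "(grad' f2 \<longlongrightarrow> 0) strip_infinity"
    by (simp_all add: zero_complex.code)
  then show "(A' \<longlongrightarrow> 0) strip_infinity" by simp
  have Z: "(Z \<longlongrightarrow> Complex (1 - \<gamma> + 0) 0) strip_infinity" unfolding grad_def[abs_def]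
    by (intro tendsto_Complex tendsto_intros lim)
  then have "(F \<longlongrightarrow> Complex (1 - \<gamma> + 0) 0 / 1) strip_infinity"
    unfolding vel_def[abs_def] by (intro tendsto_divide A) auto
  then show F: "(F \<longlongrightarrow> of_real (1 - \<gamma>)) strip_infinity" by (simp add: complex_of_real_def)
  have "(F' \<longlongrightarrow> (0 - of_real (1 - \<gamma>) * 0) / 1) strip_infinity"
    unfolding vel'_def[abs_def] by (intro tendsto_intros A A' Z' F) auto
  then show "(F' \<longlongrightarrow> 0) strip_infinity" by simp
qed

lemma decay:
  assumes "0 < e"
  shows "\<exists>T>0. \<forall>x y. T \<le> \<bar>x\<bar> \<longrightarrow> 0 \<le> y \<longrightarrow> y \<le> 1 \<longrightarrow>
    \<bar>Im (A (x, y))\<bar> < e \<and> \<bar>Im (A' (x, y))\<bar> < e \<and> \<bar>Im (F (x, y))\<bar> < e \<and> \<bar>Im (F' (x, y))\<bar> < e"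
proof -
  note lim = grad_limits[THEN tendsto_Im, THEN tendsto_rabs]
  have "\<forall>\<^sub>F p in strip_infinity. \<bar>Im (A p)\<bar> < e \<and> \<bar>Im (A' p)\<bar> < e \<and> \<bar>Im (F p)\<bar> < e \<and> \<bar>Im (F' p)\<bar> < e"
    by (intro eventually_conj order_tendstoD(2)[OF lim(1)] order_tendstoD(2)[OF lim(2)]
        order_tendstoD(2)[OF lim(3)] order_tendstoD(2)[OF lim(4)]) (use assms in auto)
  from eventually_strip_infinity[OF this] show ?thesis by simp
qed

end

section \<open>From the surface to the half strip: propagation of sign and rigidity\<close>

lemma CR_cmult: "CR A A' \<Longrightarrow> CR (\<lambda>p. c * A p) (\<lambda>p. c * A' p)"
  using CR_mult[of "\<lambda>_. c" "\<lambda>_. 0" A A'] by (simp add: CR_def)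

context wave
begin

lemma weight_deriv: "(weight \<gamma> \<epsilon>1 w has_real_derivative weight' \<gamma> \<epsilon>1 w x) (at x)"
proof -
  have nz: "P x \<noteq> 0" "\<epsilon>1 \<noteq> 0" using psiy_pos[of x] eps by auto
  have "((\<lambda>x. (J x) ^ 4 / (\<epsilon>1 * (P x)\<^sup>2)) has_real_derivative
      (real 4 * (jac' w x * (J x) ^ (4 - Suc 0)) * (\<epsilon>1 * (P x)\<^sup>2)
        - (J x) ^ 4 * (\<epsilon>1 * (real 2 * (psiy' \<gamma> w x * (P x) ^ (2 - Suc 0)))))
      / ((\<epsilon>1 * (P x)\<^sup>2) * (\<epsilon>1 * (P x)\<^sup>2))) (at x)"
    using nz by (intro DERIV_divide DERIV_power DERIV_cmult jac_deriv psiy_deriv) auto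
  moreover have "(real 4 * (jac' w x * (J x) ^ (4 - Suc 0)) * (\<epsilon>1 * (P x)\<^sup>2)
        - (J x) ^ 4 * (\<epsilon>1 * (real 2 * (psiy' \<gamma> w x * (P x) ^ (2 - Suc 0)))))
      / ((\<epsilon>1 * (P x)\<^sup>2) * (\<epsilon>1 * (P x)\<^sup>2)) = weight' \<gamma> \<epsilon>1 w x"
    using nz by (simp add: weight'_def field_simps eval_nat_numeral)
  ultimately show ?thesis by (simp add: weight_def[abs_def])
qed

lemma weight_pos: "0 < weight \<gamma> \<epsilon>1 w x"
  using jac_pos[of x] psiy_pos[of x] eps by (simp add: weight_def)

lemma surface_limits:
  "(J \<longlongrightarrow> 1) at_top" "(P \<longlongrightarrow> 1) at_top" "(weight \<gamma> \<epsilon>1 w \<longlongrightarrow> 1 / \<epsilon>1) at_top"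
proof -
  note lim = C0_2_tendsto[OF X_comp1_C0[OF X], THEN filterlim_compose, OF strip_infinity_at_top[of 1]]
    C0_2_tendsto[OF X_comp2_C0[OF X], THEN filterlim_compose, OF strip_infinity_at_top[of 1]]
  have "(J \<longlongrightarrow> (1 + 0)\<^sup>2 + 0\<^sup>2) at_top" unfolding jac_def[abs_def]
    by (intro tendsto_intros lim) auto
  then show J: "(J \<longlongrightarrow> 1) at_top" by simp
  have "(P \<longlongrightarrow> \<gamma> * (0 + 0 + 0 * 0) + 0 + 1) at_top" unfolding psiy_def[abs_def]
    by (intro tendsto_intros lim) auto
  then show P: "(P \<longlongrightarrow> 1) at_top" by simp
  have "(weight \<gamma> \<epsilon>1 w \<longlongrightarrow> 1 ^ 4 / (\<epsilon>1 * 1\<^sup>2)) at_top" unfolding weight_def[abs_def]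
    using eps by (intro tendsto_intros J P) auto
  then show "(weight \<gamma> \<epsilon>1 w \<longlongrightarrow> 1 / \<epsilon>1) at_top" by simp
qed

lemma weight_bounded: "\<exists>W. \<forall>x\<ge>R. weight \<gamma> \<epsilon>1 w x \<le> W"
proof -
  have "\<forall>\<^sub>F x in at_top. weight \<gamma> \<epsilon>1 w x < 1 / \<epsilon>1 + 1"
    by (rule order_tendstoD(2)[OF surface_limits(3)]) simp
  then obtain T where T: "\<And>x. T \<le> x \<Longrightarrow> weight \<gamma> \<epsilon>1 w x < 1 / \<epsilon>1 + 1"
    by (auto simp: eventually_at_top_linorder)
  have "continuous_on {R..max R T} (weight \<gamma> \<epsilon>1 w)"
    by (rule DERIV_continuous_on[OF has_field_derivative_at_within[OF weight_deriv]])
  then obtain z where z: "\<And>x. \<lbrakk>R \<le> x; x \<le> max R T\<rbrakk> \<Longrightarrow> weight \<gamma> \<epsilon>1 w x \<le> weight \<gamma> \<epsilon>1 w z"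
    using continuous_attains_sup[of "{R..max R T}" "weight \<gamma> \<epsilon>1 w"]
    by (metis atLeastAtMost_iff atLeastatMost_empty_iff compact_Icc max.cobounded1 empty_iff order_refl)
  have "weight \<gamma> \<epsilon>1 w x \<le> max (weight \<gamma> \<epsilon>1 w z) (1 / \<epsilon>1 + 1)" if "R \<le> x" for x
  proof (cases "x \<le> max R T")
    case True
    then show ?thesis using z[OF that] by auto
  next
    case False
    then have "weight \<gamma> \<epsilon>1 w x < 1 / \<epsilon>1 + 1" by (intro T) simp
    then show ?thesis by simp
  qed
  then show ?thesis by blast
qed

text \<open>\<open>energy_estimate\<close> is applied to c A and - c F, whose imaginary parts have
  the same sign on the surface by \<open>vel_surface\<close>. The factor c allows both the upper and
  the lower bound on \<eta>_x.\<close>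

lemma sign_propagates:
  assumes \<rho>: "0 < \<rho>" "\<rho> \<le> 1/2" and R: "0 \<le> R" and c: "\<bar>c\<bar> = 1"
    and near: "\<And>x. \<lbrakk>0 < x; x < R\<rbrakk> \<Longrightarrow> c * dx f1 (x, 1) \<le> 0"
    and far: "\<And>x. R \<le> x \<Longrightarrow> \<bar>weight' \<gamma> \<epsilon>1 w x\<bar> \<le> \<rho> * weight \<gamma> \<epsilon>1 w x
      \<and> 0 < 1 + dy f1 (x, 1) \<and> robin \<gamma> \<epsilon>1 w \<alpha> x \<le> (1 - 2 * \<rho>) * (1 + (P x)\<^sup>2 / \<epsilon>1)"
    and xy: "0 \<le> x" "0 \<le> y" "y \<le> 1"
  shows "c * dx f1 (x, y) \<le> 0"
proof -
  define a b where "a = complex_of_real c" and "b = complex_of_real (- c)"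
  obtain W where W: "\<And>x. R \<le> x \<Longrightarrow> weight \<gamma> \<epsilon>1 w x \<le> W" using weight_bounded[of R] by blast
  have ImF: "Im (b * F (x, 1)) = P x / J x * Im (a * A (x, 1))" for x
    using vel_surface(1)[of x] by (simp add: a_def b_def Im_A)
  have \<sigma>: "0 < P x / J x" for x using psiy_pos jac_pos by simp
  have "Im (a * A (x, y)) \<le> 0"
  proof (rule energy_estimate[OF CR_cmult[OF CR_A] CR_cmult[OF CR_A'] CR_cmult[OF CR_F] CR_cmult[OF CR_F'] \<rho>,
        where R = R and \<omega> = "weight \<gamma> \<epsilon>1 w" and \<omega>' = "weight' \<gamma> \<epsilon>1 w" and W = W])
    show "Im (a * A (x, 0)) = 0" "Im (b * F (x, 0)) = 0" for x
      using bed_zero[of x] by (auto simp: a_def b_def Im_A)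
    show "Im (a * A (0, y)) = 0" "Im (b * F (0, y)) = 0" if "0 \<le> y" "y \<le> 1" for y
      using axis_zero[OF that] by (auto simp: a_def b_def Im_A)
    show "continuous_on {R..} (weight \<gamma> \<epsilon>1 w)"
      by (rule DERIV_continuous_on[OF has_field_derivative_at_within[OF weight_deriv]])
    show "(weight \<gamma> \<epsilon>1 w has_real_derivative weight' \<gamma> \<epsilon>1 w x) (at x)" for x
      by (rule weight_deriv)
    show "0 < weight \<gamma> \<epsilon>1 w x \<and> weight \<gamma> \<epsilon>1 w x \<le> W" if "R \<le> x" for x
      using weight_pos W[OF that] by simp
    show "\<bar>weight' \<gamma> \<epsilon>1 w x\<bar> \<le> \<rho> * weight \<gamma> \<epsilon>1 w x" if "R < x" for x
      using far[of x] that by simp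
    show "Im (a * A (x, 1)) \<le> 0 \<and> Im (b * F (x, 1)) \<le> 0" if "0 < x" "x < R" for x
    proof -
      have "Im (a * A (x, 1)) \<le> 0" using near[OF that] by (simp add: a_def Im_A)
      then show ?thesis unfolding ImF using mult_nonneg_nonpos[OF less_imp_le[OF \<sigma>]] by blast
    qed
    show "(pos (Im (a * A (x, 1)))) ^ 3 * (Re (a * A' (x, 1)) - (1 - 2 * \<rho>) * Im (a * A (x, 1)))
      + weight \<gamma> \<epsilon>1 w x * ((pos (Im (b * F (x, 1)))) ^ 3 * (Re (b * F' (x, 1)) - (1 - 2 * \<rho>) * Im (b * F (x, 1)))) \<le> 0"
      if "R < x" for x
    proof (cases "0 < Im (a * A (x, 1))")
      case False
      then have "Im (b * F (x, 1)) \<le> 0"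
        unfolding ImF using mult_nonneg_nonpos[OF less_imp_le[OF \<sigma>]] by (meson not_less)
      then show ?thesis using False by simp
    next
      case True
      define u where "u = Im (a * A (x, 1))"
      define s where "s = P x / J x"
      have u: "0 < u" and s: "0 < s" using True \<sigma> by (auto simp: u_def s_def)
      have u': "u = c * dx f1 (x, 1)" by (simp add: u_def a_def Im_A)
      \<comment> \<open>The purpose of \<open>weight\<close>: once u^3 is factored out, Re F'
        carries its coefficient from \<open>surface_robin\<close>, and both normal derivatives are
        replaced by a multiple of u.\<close>
      have w: "weight \<gamma> \<epsilon>1 w x * s ^ 3 = J x * P x / \<epsilon>1"
        using jac_pos[of x] psiy_pos[of x] eps
        by (simp add: weight_def s_def field_simps eval_nat_numeral)
      have pp: "J x * P x / \<epsilon>1 * s = (P x)\<^sup>2 / \<epsilon>1"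
        using jac_pos[of x] by (simp add: s_def power2_eq_square)
      have alg: "y - r * u + m * (z - r * (s * u)) = (y + m * z) - r * (1 + m * s) * u" for y z m r
        by (simp add: algebra_simps)
      have far': "0 < 1 + dy f1 (x, 1)" "robin \<gamma> \<epsilon>1 w \<alpha> x \<le> (1 - 2 * \<rho>) * (1 + (P x)\<^sup>2 / \<epsilon>1)"
        using far[of x] that by auto
      have "Re (a * A' (x, 1)) + J x * P x / \<epsilon>1 * Re (b * F' (x, 1))
          = c * (Re (A' (x, 1)) - J x * P x / \<epsilon>1 * Re (F' (x, 1)))"
        by (simp add: a_def b_def algebra_simps)
      also have "\<dots> = robin \<gamma> \<epsilon>1 w \<alpha> x * u"
        unfolding u' using surface_robin[of x] far'(1) by simp
      also have "\<dots> \<le> (1 - 2 * \<rho>) * (1 + (P x)\<^sup>2 / \<epsilon>1) * u"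
        using far'(2) u by (intro mult_right_mono) auto
      finally have key: "Re (a * A' (x, 1)) - (1 - 2 * \<rho>) * u
          + J x * P x / \<epsilon>1 * (Re (b * F' (x, 1)) - (1 - 2 * \<rho>) * (s * u)) \<le> 0"
        unfolding pp[symmetric] alg by simp
      have "u ^ 3 * (Re (a * A' (x, 1)) - (1 - 2 * \<rho>) * u)
          + weight \<gamma> \<epsilon>1 w x * ((s * u) ^ 3 * (Re (b * F' (x, 1)) - (1 - 2 * \<rho>) * (s * u)))
          = u ^ 3 * (Re (a * A' (x, 1)) - (1 - 2 * \<rho>) * u
          + (weight \<gamma> \<epsilon>1 w x * s ^ 3) * (Re (b * F' (x, 1)) - (1 - 2 * \<rho>) * (s * u)))"
        by (simp add: algebra_simps)
      also have "\<dots> \<le> 0" unfolding w using key u by (simp add: mult_nonneg_nonpos)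
      finally show ?thesis
        unfolding ImF u_def[symmetric] s_def[symmetric] using u s by simp
    qed
    have abs: "\<bar>Im (a * z)\<bar> = \<bar>Im z\<bar>" "\<bar>Im (b * z)\<bar> = \<bar>Im z\<bar>" for z
      using c by (simp_all add: a_def b_def abs_mult)
    have decay1: "\<exists>T. \<forall>x\<ge>T. \<forall>y\<in>{0..1}. \<bar>Im (A (x, y))\<bar> < e \<and> \<bar>Im (A' (x, y))\<bar> < e
        \<and> \<bar>Im (F (x, y))\<bar> < e \<and> \<bar>Im (F' (x, y))\<bar> < e" if e: "0 < e" for e
    proof -
      obtain T where T: "\<forall>x y. T \<le> \<bar>x\<bar> \<longrightarrow> 0 \<le> y \<longrightarrow> y \<le> 1 \<longrightarrow> \<bar>Im (A (x, y))\<bar> < e \<and> \<bar>Im (A' (x, y))\<bar> < e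
        \<and> \<bar>Im (F (x, y))\<bar> < e \<and> \<bar>Im (F' (x, y))\<bar> < e"
        using decay[OF e] by blast
      show ?thesis
      proof (intro exI allI impI ballI)
        fix x y assume "T \<le> x" "y \<in> {0..1::real}"
        moreover have "x \<le> \<bar>x\<bar>" by simp
        ultimately show "\<bar>Im (A (x, y))\<bar> < e \<and> \<bar>Im (A' (x, y))\<bar> < e
          \<and> \<bar>Im (F (x, y))\<bar> < e \<and> \<bar>Im (F' (x, y))\<bar> < e"
          using T by (meson atLeastAtMost_iff order_trans)
      qed
    qed
    show "\<exists>T. \<forall>x\<ge>T. \<forall>y\<in>{0..1}. \<bar>Im (a * A (x, y))\<bar> \<le> e \<and> \<bar>Im (a * A' (x, y))\<bar> \<le> e"
      if "0 < e" for e
      using decay1[OF that] unfolding abs by (meson less_imp_le)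
    show "\<exists>T. \<forall>x\<ge>T. \<forall>y\<in>{0..1}. \<bar>Im (b * F (x, y))\<bar> \<le> e \<and> \<bar>Im (b * F' (x, y))\<bar> \<le> e"
      if "0 < e" for e
      using decay1[OF that] unfolding abs by (meson less_imp_le)
  qed (use R xy in auto)
  then show ?thesis by (simp add: a_def Im_A)
qed

text \<open>Constancy along horizontal lines and decay give f1 = 0. The kinematic condition then
  makes \<open>dx f2\<close> vanish on the surface, and the maximum principle on long rectangles
  makes it vanish inside.\<close>

lemma trivial_if_dx_zero:
  assumes "\<And>x y. \<lbrakk>0 < x; 0 < y; y < 1\<rbrakk> \<Longrightarrow> dx f1 (x, y) = 0"
  shows "w = (\<lambda>_. 0)"
proof -
  have const_zero: "f (x, y) = 0"
    if f: "f \<in> Ck (Suc k)" "f \<in> C0 2" and z: "\<And>x. dx f (x, y) = 0" and y: "0 \<le> y" "y \<le> 1"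
    for f k x y
  proof -
    have "f (t, y) = f (x, y)" for t
      by (rule DERIV_isconst_all[of "\<lambda>t. f (t, y)"]) (use Ck_has_dx[OF f(1) y] z in simp)
    then have "(\<lambda>t. f (t, y)) = (\<lambda>_. f (x, y))" by blast
    moreover have "((\<lambda>t. f (t, y)) \<longlongrightarrow> 0) at_top"
      by (rule filterlim_compose[OF C0_2_tendsto(1)[OF f(2)] strip_infinity_at_top[OF y]])
    ultimately show ?thesis by (simp add: tendsto_const_iff)
  qed
  have v0: "dx f1 (x, y) = 0" if y: "0 < y" "y < 1" for x y
    using assms[of x y] assms[of "- x" y] axis_zero(1)[of y] axis_odd(1)[of y x] y
    by (cases x "0 :: real" rule: linorder_cases) auto
  have f1_zero: "f1 (x, y) = 0" if y: "0 \<le> y" "y \<le> 1" for x y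
  proof -
    have "continuous_on (closure {0<..<1}) (\<lambda>y. f1 (x, y))"
      using continuous_on_strip_section_y[OF Ck_continuous[OF Ck1]] by simp
    then show ?thesis
      by (rule continuous_constant_on_closure)
        (use const_zero[OF Ck1 X_comp1_C0[OF X] v0] y in auto)
  qed
  have v0': "dx f1 (x, 1) = 0" for x
    using f1_zero by (auto intro!: dx_eqI)
  have t1: "dx f2 (x, 1) = 0" for x using dx_f2_surface[of x] v0' by simp
  have t0: "dx f2 (x, 0) = 0" for x by (rule bed_dx_zero) (rule X_comp2_bed[OF X])
  have t_le: "c * dx f2 (x, y) \<le> e" if c: "\<bar>c\<bar> = 1" and e: "0 < e" and y: "0 \<le> y" "y \<le> 1" for c e x y
  proof -
    have "\<forall>\<^sub>F p in strip_infinity. \<bar>dx f2 p\<bar> < e"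
      using tendstoD[OF C0_2_tendsto(2)[OF X_comp2_C0[OF X]] e] by simp
    from eventually_strip_infinity[OF this] obtain T where
      T: "\<And>x y. \<lbrakk>T \<le> \<bar>x\<bar>; 0 \<le> y; y \<le> 1\<rbrakk> \<Longrightarrow> \<bar>dx f2 (x, y)\<bar> < e" by metis
    have ce: "c * t \<le> e" if "\<bar>t\<bar> < e" for t using that c by (auto simp: abs_if split: if_splits)
    \<comment> \<open>The vertical sides lie so far out that \<open>dx f2\<close> is below e there,
      with x in between.\<close>
    define S where "S = \<bar>T\<bar> + \<bar>x\<bar> + 1"
    have S: "T \<le> \<bar>S\<bar>" "T \<le> \<bar>- S\<bar>" "- S < S" "- S \<le> x" "x \<le> S" by (auto simp: S_def)
    have "Im (complex_of_real c * Z (x, y)) \<le> e"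
      by (rule CR_Im_le_rectangle[OF CR_cmult[OF CR_Z] S(3), of 0 1])
        (use S y e t0 t1 T ce in \<open>auto simp: grad_def\<close>)
    then show ?thesis by (simp add: grad_def)
  qed
  have "dx f2 (x, y) = 0" if y: "0 \<le> y" "y \<le> 1" for x y
    using field_le_epsilon[of "dx f2 (x, y)" 0] field_le_epsilon[of "- dx f2 (x, y)" 0]
      t_le[OF _ _ y, of 1 _ x] t_le[OF _ _ y, of "-1" _ x] by fastforce
  then have "f2 (x, y) = 0" if y: "0 \<le> y" "y \<le> 1" for x y
    using const_zero[OF Ck2 X_comp2_C0[OF X] _ y] y by blast
  then have "w (x, y) = 0" for x y
    using f1_zero X_outside[OF X, of "(x, y)"]
    by (cases "(x, y) \<in> closed_strip") (auto simp: prod_eq_iff)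
  then show ?thesis by (auto simp: fun_eq_iff)
qed

text \<open>At a zero of \<open>\<eta>\<^sub>x\<close> on the surface, Hopf's lemma gives \<open>Re A' > 0\<close>, whereas \<open>Re F' \<le> 0\<close> since
  \<open>Im F \<ge> 0\<close>; this contradicts \<open>surface_robin\<close>. At the crest the same argument applies to the
  relation divided by \<open>x\<close>.\<close>
lemma rigidity:
  assumes nontriv: "w \<noteq> (\<lambda>_. 0)"
    and le: "\<And>x y. \<lbrakk>0 \<le> x; 0 \<le> y; y \<le> 1\<rbrakk> \<Longrightarrow> dx f1 (x, y) \<le> 0"
  shows rigidity_interior: "\<And>x y. \<lbrakk>0 < x; 0 < y; y \<le> 1\<rbrakk> \<Longrightarrow> dx f1 (x, y) < 0"
    and rigidity_crest: "dx (dx f1) (0, 1) < 0"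
proof -
  have inner: "dx f1 (x, y) < 0" if xy: "0 < x" "0 < y" "y < 1" for x y
  proof (rule ccontr)
    assume "\<not> dx f1 (x, y) < 0"
    then have z: "dx f1 (x, y) = 0" using le[of x y] xy by simp
    have "dx f1 (s, t) = 0" if "0 < s" "0 < t" "t < 1" for s t
      using CR_Im_strong_maximum[OF CR_A[of 1], of x y s t] le xy that by (simp add: Im_A z)
    then show False using trivial_if_dx_zero nontriv by blast
  qed
  have ImF: "Im (F (x, 1)) = - (P x / J x) * dx f1 (x, 1)" for x using vel_surface(1)[of x] by simp
  have \<sigma>: "0 < P x / J x" for x using psiy_pos jac_pos by simp
  \<comment> \<open>On a long rectangle - Im F is zero on axis and bed, nonpositive on the surface
    by the sign of \<eta>_x, and small on the far side.\<close>
  have ImF_nonneg: "0 \<le> Im (F (x, y))" if xy: "0 \<le> x" "0 \<le> y" "y \<le> 1" for x y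
  proof (rule field_le_epsilon)
    fix e :: real assume e: "0 < e"
    obtain T where T: "\<And>x y. \<lbrakk>T \<le> \<bar>x\<bar>; 0 \<le> y; y \<le> 1\<rbrakk> \<Longrightarrow> \<bar>Im (F (x, y))\<bar> < e"
      using decay[OF e] by metis
    define S where "S = \<bar>T\<bar> + \<bar>x\<bar> + 1"
    have S: "T \<le> \<bar>S\<bar>" "0 < S" "x \<le> S" by (auto simp: S_def)
    have top: "0 \<le> Im (F (x, 1))" if "0 \<le> x" for x
      using mult_nonneg_nonpos[OF less_imp_le[OF \<sigma>[of x]] le[of x 1]] that
      by (simp only: ImF mult_minus_left) simp
    have "Im (- F (x, y)) \<le> e"
    proof (rule CR_Im_le_rectangle[OF CR_minus[OF CR_F] S(2), of 0 1])
      show "Im (- F (x, 0)) \<le> e \<and> Im (- F (x, 1)) \<le> e" if "0 \<le> x" for x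
        using bed_zero(2)[of x] top[OF that] e by simp
      show "Im (- F (0, y)) \<le> e \<and> Im (- F (S, y)) \<le> e" if "0 \<le> y" "y \<le> 1" for y
        using axis_zero(2)[OF that] T[OF S(1) that] e by simp
    qed (use S xy in auto)
    then show "0 \<le> Im (F (x, y)) + e" by simp
  qed
  have surf: "dx f1 (x, 1) < 0" if x: "0 < x" for x
  proof (rule ccontr)
    assume "\<not> dx f1 (x, 1) < 0"
    then have z: "dx f1 (x, 1) = 0" using le[of x 1] x by simp
    have "0 < Re (A' (x, 1))"
    proof (rule Hopf_top[OF CR_A[of 1], of "x / 2" "1 / 2"])
      have pos: "0 < t" if "\<bar>t - x\<bar> \<le> x / 2" for t using that x by linarith
      show "Im (A (t, y)) \<le> 0" if "\<bar>t - x\<bar> \<le> x / 2" "1 / 2 \<le> y" "y \<le> 1" for t y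
        using le[of t y] pos[OF that(1)] that by (simp add: Im_A)
      show "Im (A (t, 1 / 2)) < 0" if "\<bar>t - x\<bar> \<le> x / 2" for t
        using inner[OF pos[OF that], of "1 / 2"] by (simp add: Im_A)
    qed (use x z in \<open>auto simp: Im_A\<close>)
    \<comment> \<open>At this point J is the square of \<eta>_y alone.\<close>
    moreover have nz: "1 + dy f1 (x, 1) \<noteq> 0" using jac_pos[of x] z by (auto simp: jac_def)
    moreover have "J x * P x / \<epsilon>1 * Re (F' (x, 1)) \<le> 0"
    proof -
      have "0 \<le> Re ((\<lambda>p. - F' p) (x, 1))"
      proof (rule DERIV_left_endpoint_nonneg[of _ _ 0])
        show "((\<lambda>y. Im (- F (x, y))) has_real_derivative Re (- F' (x, 1))) (at 1 within {0..1})"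
          by (rule CR_dy_Im[OF CR_minus[OF CR_F]]) auto
        show "Im (- F (x, y)) \<le> Im (- F (x, 1))" if "0 < y" "y < 1" for y
          using ImF_nonneg[of x y] ImF[of x] z x that by simp
      qed auto
      then have "Re (F' (x, 1)) \<le> 0" by simp
      moreover have "0 \<le> J x * P x / \<epsilon>1" using jac_pos[of x] psiy_pos[of x] eps by simp
      ultimately show ?thesis by (rule mult_nonneg_nonpos[rotated])
    qed
    ultimately show False using surface_robin[OF nz] z by simp
  qed
  show "dx f1 (x, y) < 0" if "0 < x" "0 < y" "y \<le> 1" for x y
    using inner[of x y] surf[of x] that by (cases "y = 1") auto
  show "dx (dx f1) (0, 1) < 0"
  proof (rule ccontr)
    assume neg: "\<not> dx (dx f1) (0, 1) < 0"
    have v_x: "((\<lambda>x. dx f1 (x, 1)) has_real_derivative dx (dx f1) (0, 1)) (at 0)" by (rule dx_surface)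
    then have "dx (dx f1) (0, 1) \<le> 0"
      by (rule DERIV_right_nonpos[OF _ zero_less_one]) (use le axis_zero(1) in auto)
    then have vx: "dx (dx f1) (0, 1) = 0" using neg by simp
    then have ImA': "Im (A' (0, 1)) = 0" by (simp add: grad'_def)
    \<comment> \<open>The corner lemma needs \<eta>_xx = 0 at the crest, which is what the negated
      claim supplies.\<close>
    have pos: "0 < Re (A'' (0, 1))"
    proof (rule Hopf_corner[OF CR_A[of 1] CR_A', of 1 "1 / 2"])
      show "Im (A (1, y)) < 0" if "1 / 2 \<le> y" "y \<le> 1" for y
        using inner[of 1 y] surf[of 1] that by (cases "y = 1") (auto simp: Im_A)
    qed (use le axis_zero(1) ImA' in \<open>auto simp: Im_A\<close>)
    have q1: "((\<lambda>x. (dx f1 (x, 1) - 0) / (x - 0)) \<longlongrightarrow> 0) (at 0)"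
      using v_x vx axis_zero(1)[of 1] by (simp add: has_field_derivative_iff)
    have DF: "((\<lambda>x. Im (F (x, 1))) has_real_derivative Im (F' (0, 1))) (at 0)"
      by (rule CR_dx_Im[OF CR_F]) auto
    have contJ: "isCont J 0" and contP: "isCont P 0" 
      by (rule DERIV_isCont[OF jac_deriv], rule DERIV_isCont[OF psiy_deriv])
    have "((\<lambda>x. - (P x / J x) * (dx f1 (x, 1) / x)) \<longlongrightarrow> - (P 0 / J 0) * 0) (at 0)"
      using q1 contJ contP jac_pos[of 0] by (intro tendsto_intros) (auto simp: isCont_def)
    moreover have "((\<lambda>x. Im (F (x, 1)) / x) \<longlongrightarrow> Im (F' (0, 1))) (at 0)"
      using DF axis_zero(2)[of 1] by (simp add: has_field_derivative_iff)
    ultimately have ImF': "Im (F' (0, 1)) = 0"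
      unfolding ImF by (simp add: tendsto_unique[OF trivial_limit_at])
    have F'_nonneg: "0 \<le> Im (F' (0, y))" if y: "0 \<le> y" "y \<le> 1" for y
    proof -
      have "Im (- F' (0, y)) \<le> 0"
        by (rule DERIV_right_nonpos[OF CR_dx_Im[OF CR_minus[OF CR_F] y] zero_less_one])
          (use ImF_nonneg y axis_zero(2)[OF y] in auto)
      then show ?thesis by simp
    qed
    have F''_neg: "Re (F'' (0, 1)) \<le> 0"
    proof -
      have "((\<lambda>y. Im (- F' (0, y))) has_real_derivative Re (- F'' (0, 1))) (at 1 within {0..1})"
        by (rule CR_dy_Im[OF CR_minus[OF CR_F']]) auto
      then have "0 \<le> Re (- F'' (0, 1))"
        by (rule DERIV_left_endpoint_nonneg[of _ _ 0]) (use F'_nonneg ImF' in auto)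
      then show ?thesis by simp
    qed
    have a0: "1 + dy f1 (0, 1) \<noteq> 0" using jac_pos[of 0] axis_zero(1)[of 1] by (auto simp: jac_def)
    \<comment> \<open>The difference of the two sides of \<open>surface_relation\<close>. It
      vanishes identically, and dividing it by x turns the factors that vanish at the crest into
      their x-derivatives there.\<close>
    define rel where "rel x = P x / J x * ((1 + dy f1 (x, 1)) * Re (F' (x, 1)) - dx f1 (x, 1) * Im (F' (x, 1)))
      - \<epsilon>1 / (J x)\<^sup>2 * ((1 + dy f1 (x, 1)) * Re (A' (x, 1)) + dx f1 (x, 1) * dx (dx f1) (x, 1))
      + (\<alpha> + \<gamma> * P x * (1 + dy f1 (x, 1)) / J x) * dx f1 (x, 1)" for x
    have rel: "rel x = 0" for x
      using surface_relation[of x] by (simp add: rel_def grad'_def)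
    have v0: "dx f1 (0, 1) = 0" using axis_zero(1)[of 1] by simp
    \<comment> \<open>\<eta>_x is zero along the whole axis, so its y-derivative Re A' is zero as
      well.\<close>
    have yA: "Re (A' (0, 1)) = 0"
    proof -
      have "((\<lambda>y. Im (A (0, y))) has_real_derivative Re (A' (0, 1))) (at 1 within {0..1})"
        by (rule CR_dy_Im[OF CR_A]) auto
      then have "dy (dx f1) (0, 1) = Re (A' (0, 1))" unfolding Im_A by (intro dy_eqI) auto
      moreover have "dy (dx f1) (0, 1) = 0"
      proof (rule dy_eqI)
        show "((\<lambda>t. dx f1 (0, t)) has_real_derivative 0) (at 1 within {0..1})"
          by (rule has_field_derivative_transform_within[OF DERIV_const zero_less_one])
            (use axis_zero(1) in auto)
      qed auto
      ultimately show ?thesis by simp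
    qed
    have yF: "Re (F' (0, 1)) = 0" using rel[of 0] a0 jac_pos[of 0] psiy_pos[of 0] by (simp add: rel_def v0 yA)
    have A'x: "((\<lambda>x. Re (A' (x, 1)) / x) \<longlongrightarrow> Re (A'' (0, 1))) (at 0)"
      using has_real_derivative_Re[OF CR_dx[OF CR_A', of 1 0]] yA by (simp add: has_field_derivative_iff)
    have F'x: "((\<lambda>x. Re (F' (x, 1)) / x) \<longlongrightarrow> Re (F'' (0, 1))) (at 0)"
      using has_real_derivative_Re[OF CR_dx[OF CR_F', of 1 0]] yF by (simp add: has_field_derivative_iff)
    have vq: "((\<lambda>x. dx f1 (x, 1) / x) \<longlongrightarrow> 0) (at 0)" using q1 by simp
    have c: "((\<lambda>x. dy f1 (x, 1)) \<longlongrightarrow> dy f1 (0, 1)) (at 0)" "((\<lambda>x. dx (dx f1) (x, 1)) \<longlongrightarrow> dx (dx f1) (0, 1)) (at 0)"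
      "((\<lambda>x. Im (F' (x, 1))) \<longlongrightarrow> Im (F' (0, 1))) (at 0)" "(J \<longlongrightarrow> J 0) (at 0)" "(P \<longlongrightarrow> P 0) (at 0)"
      using DERIV_isCont[OF dx_surface(3), of 0] contJ contP
        DERIV_isCont[OF CR_dx_Im[OF CR_A', of 1 0]] DERIV_isCont[OF CR_dx_Im[OF CR_F', of 1 0]]
      by (simp_all add: isCont_def grad'_def)
    have "((\<lambda>x. P x / J x * ((1 + dy f1 (x, 1)) * (Re (F' (x, 1)) / x) - dx f1 (x, 1) / x * Im (F' (x, 1)))
      - \<epsilon>1 / (J x)\<^sup>2 * ((1 + dy f1 (x, 1)) * (Re (A' (x, 1)) / x) + dx f1 (x, 1) / x * dx (dx f1) (x, 1))
      + (\<alpha> + \<gamma> * P x * (1 + dy f1 (x, 1)) / J x) * (dx f1 (x, 1) / x)) \<longlongrightarrow>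
      P 0 / J 0 * ((1 + dy f1 (0, 1)) * Re (F'' (0, 1)) - 0 * Im (F' (0, 1)))
      - \<epsilon>1 / (J 0)\<^sup>2 * ((1 + dy f1 (0, 1)) * Re (A'' (0, 1)) + 0 * dx (dx f1) (0, 1))
      + (\<alpha> + \<gamma> * P 0 * (1 + dy f1 (0, 1)) / J 0) * 0) (at 0)"
      using jac_pos[of 0] by (intro tendsto_intros c A'x F'x vq) auto
    moreover have "P x / J x * ((1 + dy f1 (x, 1)) * (Re (F' (x, 1)) / x) - dx f1 (x, 1) / x * Im (F' (x, 1)))
      - \<epsilon>1 / (J x)\<^sup>2 * ((1 + dy f1 (x, 1)) * (Re (A' (x, 1)) / x) + dx f1 (x, 1) / x * dx (dx f1) (x, 1))
      + (\<alpha> + \<gamma> * P x * (1 + dy f1 (x, 1)) / J x) * (dx f1 (x, 1) / x) = rel x / x" for x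
      by (simp add: rel_def diff_divide_distrib add_divide_distrib right_diff_distrib distrib_left)
    \<comment> \<open>Pulls out \<eta>_y, which is nonzero at the crest, so that its sign does not
      matter.\<close>
    moreover have "q * (a * t - 0 * z) - k * (a * u + 0 * z') + d * 0 = a * (q * t - k * u)"
      for q a t z k u z' d :: real
      by (simp add: algebra_simps)
    ultimately have "((\<lambda>x. rel x / x) \<longlongrightarrow>
        (1 + dy f1 (0, 1)) * (P 0 / J 0 * Re (F'' (0, 1)) - \<epsilon>1 / (J 0)\<^sup>2 * Re (A'' (0, 1)))) (at 0)"
      by (simp only:)
    then have "((\<lambda>x::real. 0) \<longlongrightarrow>
        (1 + dy f1 (0, 1)) * (P 0 / J 0 * Re (F'' (0, 1)) - \<epsilon>1 / (J 0)\<^sup>2 * Re (A'' (0, 1)))) (at 0)"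
      unfolding rel div_0 .
    then have "P 0 / J 0 * Re (F'' (0, 1)) = \<epsilon>1 / (J 0)\<^sup>2 * Re (A'' (0, 1))"
      using a0 by (simp only: tendsto_const_iff[OF trivial_limit_at] mult_eq_0_iff) simp
    moreover have "0 < \<epsilon>1 / (J 0)\<^sup>2 * Re (A'' (0, 1))" using pos eps jac_pos[of 0] by simp
    moreover have "P 0 / J 0 * Re (F'' (0, 1)) \<le> 0" 
      by (rule mult_nonneg_nonpos[OF less_imp_le[OF \<sigma>] F''_neg])
    ultimately show False by linarith
  qed
qed

end

section \<open>Curves of waves\<close>

lemma nodal_iff:
  assumes X: "w \<in> X_space \<beta>"
  shows "nodal w \<longleftrightarrow> (\<forall>x>0. \<forall>y>0. y \<le> 1 \<longrightarrow> dx (comp1 w) (x, y) < 0)"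
proof -
  have eta: "dx (\<lambda>(x, y). comp1 w (x, y) + y) (x, y) = dx (comp1 w) (x, y)"
    if "0 \<le> y" "y \<le> 1" for x y
    using DERIV_add[OF Ck_has_dx[OF X_comp1_Ck[OF X] that, of x] DERIV_const, of y]
    by (intro dx_eqI) simp
  have odd: "dx (comp1 w) (- x, y) = - dx (comp1 w) (x, y)" if "0 \<le> y" "y \<le> 1" for x y
    by (rule even_dx_odd[OF X_comp1_Ck[OF X] X_comp1_even[OF X that] that])
  have dom: "(x, y) \<in> strip \<union> surface \<longleftrightarrow> 0 < y \<and> y \<le> 1" for x y
    by (auto simp: strip_def surface_def)
  show ?thesis
  proof
    assume "nodal w"
    then show "\<forall>x>0. \<forall>y>0. y \<le> 1 \<longrightarrow> dx (comp1 w) (x, y) < 0"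
      unfolding nodal_def Let_def using dom eta by (metis (lifting) IntI fst_conv less_imp_le mem_Collect_eq)
  next
    assume *: "\<forall>x>0. \<forall>y>0. y \<le> 1 \<longrightarrow> dx (comp1 w) (x, y) < 0"
    have "dx (\<lambda>(x, y). comp1 w (x, y) + y) (x, y) < 0" if "(x, y) \<in> strip \<union> surface" "0 < x" for x y
      using * eta[of y x] that unfolding dom by auto
    moreover have "dx (\<lambda>(x, y). comp1 w (x, y) + y) (x, y) > 0" if "(x, y) \<in> strip \<union> surface" "x < 0" for x y
      using *[rule_format, of "- x" y] eta[of y x] odd[of y x] that unfolding dom by auto
    ultimately show "nodal w"
      unfolding nodal_def Let_def Ball_def split_paired_All Int_iff mem_Collect_eq fst_conv by blast
  qed
qed

section \<open>Continuous families of waves and uniform control of their jets\<close>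

locale wave_family =
  fixes \<beta> \<gamma> \<epsilon>1 :: real and w :: "real \<Rightarrow> plane \<Rightarrow> real \<times> real" and \<alpha> :: "real \<Rightarrow> real"
  assumes eps: "0 < \<epsilon>1"
    and U: "0 < s \<Longrightarrow> (w s, \<alpha> s) \<in> U_set \<beta> \<gamma> \<epsilon>1"
    and sol: "0 < s \<Longrightarrow> solves \<gamma> \<epsilon>1 (w s) (\<alpha> s)"
    and cont_w: "X_continuous_on \<beta> {0<..} w" and cont_\<alpha>: "continuous_on {0<..} \<alpha>"
begin

lemma wave: "0 < s \<Longrightarrow> wave \<beta> \<gamma> \<epsilon>1 (w s) (\<alpha> s)"
  by (intro wave.intro eps U sol)

lemmas family_X = wave.X[OF wave]

lemma X_norm_tendsto:
  assumes "0 < s0"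
  shows "((\<lambda>s. X_norm \<beta> (\<lambda>p. w s p - w s0 p)) \<longlongrightarrow> 0) (at s0 within {0<..})"
  using cont_w assms by (simp add: X_continuous_on_def X_tendsto_def)

lemma eventually_close:
  assumes s0: "0 < s0" and "0 < e"
  shows "\<forall>\<^sub>F s in at s0 within {0<..}. 0 < s \<and> (\<forall>p\<in>closed_strip. \<forall>i j. i + j \<le> 3 \<longrightarrow>
    \<bar>partial i j (comp1 (w s)) p - partial i j (comp1 (w s0)) p\<bar> < e)"
proof -
  have "\<forall>\<^sub>F s in at s0 within {0<..}. X_norm \<beta> (\<lambda>p. w s p - w s0 p) < e"
    using order_tendstoD(2)[OF X_norm_tendsto[OF s0] \<open>0 < e\<close>] .
  moreover have "\<forall>\<^sub>F s in at s0 within {0<..}. 0 < s"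
    by (auto simp: eventually_at_filter)
  ultimately show ?thesis
  proof eventually_elim
    case (elim s)
    then show ?case
      using partial_le_X_norm(1)[OF family_X[OF elim(2)] family_X[OF s0]] by (meson order_le_less_trans)
  qed
qed

text \<open>Convergence in s is uniform in x, so together with the limit of the single wave
  \<open>w s0\<close> it gives a joint limit: one neighbourhood of s0 and one range of x serve
  together.\<close>

lemma jets_vanish:
  assumes s0: "0 < s0" and ij: "i + j \<le> 3"
  shows "((\<lambda>x. partial i j (comp1 (w s0)) (x, 1)) \<longlongrightarrow> 0) G \<Longrightarrow>
      ((\<lambda>p. partial i j (comp1 (w (fst p))) (snd p, 1)) \<longlongrightarrow> 0) ((at s0 within {0<..}) \<times>\<^sub>F G)"
    and "((\<lambda>x. partial i j (comp2 (w s0)) (x, 1)) \<longlongrightarrow> 0) G \<Longrightarrow>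
      ((\<lambda>p. partial i j (comp2 (w (fst p))) (snd p, 1)) \<longlongrightarrow> 0) ((at s0 within {0<..}) \<times>\<^sub>F G)"
proof -
  let ?L = "(at s0 within {0<..}) \<times>\<^sub>F G"
  have fst: "filterlim fst (at s0 within {0<..}) ?L" and snd: "filterlim snd G ?L"
    by (rule filterlim_fst, rule filterlim_snd)
  have N: "((\<lambda>p. X_norm \<beta> (\<lambda>q. w (fst p) q - w s0 q)) \<longlongrightarrow> 0) ?L"
    by (rule filterlim_compose[OF X_norm_tendsto[OF s0] fst])
  have "\<forall>\<^sub>F s in at s0 within {0<..}. 0 < s" by (auto simp: eventually_at_filter)
  then have pos: "\<forall>\<^sub>F p in ?L. 0 < fst p"
    by (rule filterlim_iff[THEN iffD1, OF fst, rule_format])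
  have main: "((\<lambda>p. f (fst p) (snd p)) \<longlongrightarrow> 0) ?L"
    if lim: "((\<lambda>x. f s0 x) \<longlongrightarrow> 0) G"
      and le: "\<And>s x. 0 < s \<Longrightarrow> \<bar>f s x - f s0 x\<bar> \<le> X_norm \<beta> (\<lambda>p. w s p - w s0 p)"
    for f :: "real \<Rightarrow> real \<Rightarrow> real"
  proof (rule Lim_null_comparison)
    have "((\<lambda>p. f s0 (snd p)) \<longlongrightarrow> 0) ?L" by (rule filterlim_compose[OF lim snd])
    from tendsto_add[OF N tendsto_rabs[OF this]]
    show "((\<lambda>p. X_norm \<beta> (\<lambda>q. w (fst p) q - w s0 q) + \<bar>f s0 (snd p)\<bar>) \<longlongrightarrow> 0) ?L" by simp
    show "\<forall>\<^sub>F p in ?L. norm (f (fst p) (snd p)) \<le> X_norm \<beta> (\<lambda>q. w (fst p) q - w s0 q) + \<bar>f s0 (snd p)\<bar>"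
      using pos
    proof eventually_elim
      case (elim p)
      then show ?case using le[of "fst p" "snd p"] by simp
    qed
  qed
  have cs: "(x, 1) \<in> closed_strip" for x by simp
  note le = partial_le_X_norm[OF family_X family_X[OF s0] ij cs]
  show "((\<lambda>p. partial i j (comp1 (w (fst p))) (snd p, 1)) \<longlongrightarrow> 0) ?L"
    if "((\<lambda>x. partial i j (comp1 (w s0)) (x, 1)) \<longlongrightarrow> 0) G"
    by (rule main[OF that le(1)])
  show "((\<lambda>p. partial i j (comp2 (w (fst p))) (snd p, 1)) \<longlongrightarrow> 0) ?L"
    if "((\<lambda>x. partial i j (comp2 (w s0)) (x, 1)) \<longlongrightarrow> 0) G"
    by (rule main[OF that le(2)])
qed

text \<open>The hypotheses of \<open>sign_propagates\<close> beyond R, at a single surface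
  point.\<close>

definition far_field :: "real \<Rightarrow> real \<Rightarrow> real \<Rightarrow> bool" where
  "far_field \<rho> s x \<longleftrightarrow> \<bar>weight' \<gamma> \<epsilon>1 (w s) x\<bar> \<le> \<rho> * weight \<gamma> \<epsilon>1 (w s) x
      \<and> 0 < 1 + dy (comp1 (w s)) (x, 1)
      \<and> robin \<gamma> \<epsilon>1 (w s) (\<alpha> s) x \<le> (1 - 2 * \<rho>) * (1 + (psiy \<gamma> (w s) x)\<^sup>2 / \<epsilon>1)"

text \<open>The filter \<open>G\<close> is \<open>at_top\<close> in general, and everything when \<open>w s0 = 0\<close>. As the jets tend to zero
  the boundary coefficient \<open>robin\<close> tends to \<open>(\<alpha> s0 + \<gamma>) / \<epsilon>1\<close>, which is less than
  \<open>1 + 1 / \<epsilon>1\<close> because \<open>\<alpha> s0 < alpha_cr\<close>.\<close>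
lemma eventually_far_field:
  assumes s0: "0 < s0" and \<rho>: "0 < \<rho>" "\<alpha> s0 + \<gamma> < (1 - 2 * \<rho>) * (1 + \<epsilon>1)"
    and lim1: "\<And>i j. i + j \<le> 2 \<Longrightarrow> ((\<lambda>x. partial i j (comp1 (w s0)) (x, 1)) \<longlongrightarrow> 0) G"
    and lim2: "\<And>i j. i + j \<le> 2 \<Longrightarrow> ((\<lambda>x. partial i j (comp2 (w s0)) (x, 1)) \<longlongrightarrow> 0) G"
  shows "\<forall>\<^sub>F p in (at s0 within {0<..}) \<times>\<^sub>F G. far_field \<rho> (fst p) (snd p)"
proof -
  let ?L = "(at s0 within {0<..}) \<times>\<^sub>F G"
  have j1: "((\<lambda>p. partial i j (comp1 (w (fst p))) (snd p, 1)) \<longlongrightarrow> 0) ?L" if "i + j \<le> 2" for i j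
    by (rule jets_vanish(1)[OF s0 _ lim1]) (use that in auto)
  have j2: "((\<lambda>p. partial i j (comp2 (w (fst p))) (snd p, 1)) \<longlongrightarrow> 0) ?L" if "i + j \<le> 2" for i j
    by (rule jets_vanish(2)[OF s0 _ lim2]) (use that in auto)
  note lim = j1[of 0 0, simplified partial_simps, simplified] j1[of 1 0, simplified partial_simps, simplified]
    j1[of 0 1, simplified partial_simps, simplified] j1[of 2 0, simplified partial_simps, simplified]
    j1[of 1 1, simplified partial_simps, simplified] j2[of 0 1, simplified partial_simps, simplified]
    j2[of 1 0, simplified partial_simps, simplified] j2[of 2 0, simplified partial_simps, simplified]
    j2[of 1 1, simplified partial_simps, simplified]
  have "((\<lambda>p. jac (w (fst p)) (snd p)) \<longlongrightarrow> (1 + 0)\<^sup>2 + 0\<^sup>2) ?L"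
    unfolding jac_def by (intro tendsto_intros lim)
  then have J: "((\<lambda>p. jac (w (fst p)) (snd p)) \<longlongrightarrow> 1) ?L" by simp
  have "((\<lambda>p. jac' (w (fst p)) (snd p)) \<longlongrightarrow> 2 * ((1 + 0) * 0 + 0 * 0)) ?L"
    unfolding jac'_def by (intro tendsto_intros lim)
  then have J': "((\<lambda>p. jac' (w (fst p)) (snd p)) \<longlongrightarrow> 0) ?L" by simp
  have "((\<lambda>p. psiy \<gamma> (w (fst p)) (snd p)) \<longlongrightarrow> \<gamma> * (0 + 0 + 0 * 0) + 0 + 1) ?L"
    unfolding psiy_def by (intro tendsto_intros lim)
  then have P: "((\<lambda>p. psiy \<gamma> (w (fst p)) (snd p)) \<longlongrightarrow> 1) ?L" by simp
  have "((\<lambda>p. psiy' \<gamma> (w (fst p)) (snd p)) \<longlongrightarrow> \<gamma> * (0 + 0 + (0 * 0 + 0 * 0)) + 0) ?L"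
    unfolding psiy'_def by (intro tendsto_intros lim)
  then have P': "((\<lambda>p. psiy' \<gamma> (w (fst p)) (snd p)) \<longlongrightarrow> 0) ?L" by simp
  have "((\<lambda>p. weight \<gamma> \<epsilon>1 (w (fst p)) (snd p)) \<longlongrightarrow> 1 ^ 4 / (\<epsilon>1 * 1\<^sup>2)) ?L"
    unfolding weight_def using eps by (intro tendsto_intros J P) auto
  then have W: "((\<lambda>p. weight \<gamma> \<epsilon>1 (w (fst p)) (snd p)) \<longlongrightarrow> 1 / \<epsilon>1) ?L" by simp
  have "((\<lambda>p. weight' \<gamma> \<epsilon>1 (w (fst p)) (snd p)) \<longlongrightarrow>
      (4 * 1 ^ 3 * 0 / 1\<^sup>2 - 2 * 1 ^ 4 * 0 / 1 ^ 3) / \<epsilon>1) ?L"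
    unfolding weight'_def using eps by (intro tendsto_intros J P J' P') auto
  then have W': "((\<lambda>p. weight' \<gamma> \<epsilon>1 (w (fst p)) (snd p)) \<longlongrightarrow> 0) ?L" by simp
  have A: "((\<lambda>p. grad 1 (comp1 (w (fst p))) (snd p, 1)) \<longlongrightarrow> Complex (1 + 0) 0) ?L"
    unfolding grad_def by (intro tendsto_Complex tendsto_intros lim)
  have Z: "((\<lambda>p. grad (1 - \<gamma>) (comp2 (w (fst p))) (snd p, 1)) \<longlongrightarrow> Complex (1 - \<gamma> + 0) 0) ?L"
    unfolding grad_def by (intro tendsto_Complex tendsto_intros lim)
  have A': "((\<lambda>p. grad' (comp1 (w (fst p))) (snd p, 1)) \<longlongrightarrow> Complex 0 0) ?L"
    and Z': "((\<lambda>p. grad' (comp2 (w (fst p))) (snd p, 1)) \<longlongrightarrow> Complex 0 0) ?L"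
    unfolding grad'_def by (intro tendsto_Complex lim)+
  have nz: "Complex (1 + 0) 0 \<noteq> 0" by (simp add: complex_eq_iff)
  have "((\<lambda>p. Im (vel' \<gamma> (w (fst p)) (snd p, 1))) \<longlongrightarrow>
      Im ((Complex 0 0 - Complex (1 - \<gamma> + 0) 0 / Complex (1 + 0) 0 * Complex 0 0) / Complex (1 + 0) 0)) ?L"
    unfolding vel'_def vel_def by (intro tendsto_intros A Z A' Z' nz)
  then have F': "((\<lambda>p. Im (vel' \<gamma> (w (fst p)) (snd p, 1))) \<longlongrightarrow> 0) ?L"
    by (simp add: zero_complex.code[symmetric])
  have "(\<alpha> \<longlongrightarrow> \<alpha> s0) (at s0 within {0<..})"
    using cont_\<alpha> s0 by (simp add: continuous_on)
  then have al: "((\<lambda>p. \<alpha> (fst p)) \<longlongrightarrow> \<alpha> s0) ?L"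
    by (rule filterlim_compose[OF _ filterlim_fst])
  have "((\<lambda>p. robin \<gamma> \<epsilon>1 (w (fst p)) (\<alpha> (fst p)) (snd p)) \<longlongrightarrow>
      (1\<^sup>2 / \<epsilon>1 * (\<alpha> s0 + \<gamma> * 1 * (1 + 0) / 1) - 1 * 1 / \<epsilon>1 * 0 - 0) / (1 + 0)) ?L"
    unfolding robin_def using eps by (intro tendsto_intros J P F' al lim) auto
  then have r: "((\<lambda>p. robin \<gamma> \<epsilon>1 (w (fst p)) (\<alpha> (fst p)) (snd p)) \<longlongrightarrow> (\<alpha> s0 + \<gamma>) / \<epsilon>1) ?L"
    by simp
  have "((\<lambda>p. \<bar>weight' \<gamma> \<epsilon>1 (w (fst p)) (snd p)\<bar> - \<rho> * weight \<gamma> \<epsilon>1 (w (fst p)) (snd p))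
      \<longlongrightarrow> \<bar>0\<bar> - \<rho> * (1 / \<epsilon>1)) ?L"
    by (intro tendsto_intros W W')
  then have e1: "\<forall>\<^sub>F p in ?L. \<bar>weight' \<gamma> \<epsilon>1 (w (fst p)) (snd p)\<bar> - \<rho> * weight \<gamma> \<epsilon>1 (w (fst p)) (snd p) < 0"
    by (rule order_tendstoD(2)) (use eps \<rho> in auto)
  have "((\<lambda>p. 1 + dy (comp1 (w (fst p))) (snd p, 1)) \<longlongrightarrow> 1 + 0) ?L"
    by (intro tendsto_intros lim)
  then have e2: "\<forall>\<^sub>F p in ?L. 0 < 1 + dy (comp1 (w (fst p))) (snd p, 1)"
    by (rule order_tendstoD(1)) auto
  have "((\<lambda>p. robin \<gamma> \<epsilon>1 (w (fst p)) (\<alpha> (fst p)) (snd p)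
        - (1 - 2 * \<rho>) * (1 + (psiy \<gamma> (w (fst p)) (snd p))\<^sup>2 / \<epsilon>1))
      \<longlongrightarrow> (\<alpha> s0 + \<gamma>) / \<epsilon>1 - (1 - 2 * \<rho>) * (1 + 1\<^sup>2 / \<epsilon>1)) ?L"
    using eps by (intro tendsto_intros r P) auto
  moreover have "(\<alpha> s0 + \<gamma>) / \<epsilon>1 - (1 - 2 * \<rho>) * (1 + 1\<^sup>2 / \<epsilon>1) < 0"
  proof -
    have "(1 - 2 * \<rho>) * (1 + 1\<^sup>2 / \<epsilon>1) = (1 - 2 * \<rho>) * (1 + \<epsilon>1) / \<epsilon>1"
      using eps by (simp add: field_simps)
    then show ?thesis using divide_strict_right_mono[OF \<rho>(2) eps] by linarith
  qed
  ultimately have e3: "\<forall>\<^sub>F p in ?L. robin \<gamma> \<epsilon>1 (w (fst p)) (\<alpha> (fst p)) (snd p)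
        - (1 - 2 * \<rho>) * (1 + (psiy \<gamma> (w (fst p)) (snd p))\<^sup>2 / \<epsilon>1) < 0"
    by (rule order_tendstoD(2))
  show ?thesis
    using e1 e2 e3 by eventually_elim (simp add: far_field_def)
qed

section \<open>Openness of the nodal set and of its complement\<close>

lemma ex_rate:
  assumes "0 < s"
  shows "\<exists>\<rho>>0. \<rho> \<le> 1/2 \<and> \<alpha> s + \<gamma> < (1 - 2 * \<rho>) * (1 + \<epsilon>1)"
proof -
  define d where "d = 1 + \<epsilon>1 - \<alpha> s - \<gamma>"
  have d: "0 < d" using U[OF assms] by (simp add: U_set_def d_def)
  \<comment> \<open>The loss 2 \<rho> (1 + \<epsilon>1) is at most half of the gap d.\<close>
  define \<rho> where "\<rho> = min (1 / 2) (d / (4 * (1 + \<epsilon>1)))"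
  have "\<rho> \<le> d / (4 * (1 + \<epsilon>1))" by (simp add: \<rho>_def)
  then have "4 * \<rho> * (1 + \<epsilon>1) \<le> d" using eps by (simp add: field_simps)
  then have "\<alpha> s + \<gamma> < (1 - 2 * \<rho>) * (1 + \<epsilon>1)" using d by (simp add: d_def algebra_simps)
  moreover have "0 < \<rho>" using d eps by (simp add: \<rho>_def)
  moreover have "\<rho> \<le> 1 / 2" unfolding \<rho>_def by (rule min.cobounded1)
  ultimately show ?thesis by blast
qed

text \<open>Uniform closeness of \<eta>_x says nothing next to x = 0, where it vanishes. There
  \<eta>_xx is negative by \<open>rigidity_crest\<close>, stays negative for nearby waves, and
  yields the sign by integration from the axis; on the remaining compact interval \<eta>_x is
  bounded away from zero.\<close>

lemma eventually_near_crest: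
  assumes s0: "0 < s0" and nod: "nodal (w s0)" and R: "0 < R"
  shows "\<forall>\<^sub>F s in at s0 within {0<..}. \<forall>x. 0 < x \<longrightarrow> x \<le> R \<longrightarrow> dx (comp1 (w s)) (x, 1) < 0"
proof -
  interpret wave \<beta> \<gamma> \<epsilon>1 "w s0" "\<alpha> s0" by (rule wave[OF s0])
  have neg: "dx (comp1 (w s0)) (x, y) < 0" if "0 < x" "0 < y" "y \<le> 1" for x y
    using nod nodal_iff[OF family_X[OF s0]] that by blast
  have "dx (comp1 (w s0)) (x, y) \<le> 0" if "0 \<le> x" "0 \<le> y" "y \<le> 1" for x y
    using neg[of x y] axis_zero(1)[of y] bed_zero(1)[of x] that
    by (cases "x = 0"; cases "y = 0") auto
  moreover have "w s0 \<noteq> (\<lambda>_. 0)"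
  proof
    assume "w s0 = (\<lambda>_. 0)"
    then have "dx (comp1 (w s0)) (1, 1) = 0" by (intro dx_eqI) simp
    then show False using neg[of 1 1] by simp
  qed
  ultimately have crest: "dx (dx (comp1 (w s0))) (0, 1) < 0" by (intro rigidity_crest)
  define c where "c = - dx (dx (comp1 (w s0))) (0, 1) / 2"
  have c: "0 < c" "dx (dx (comp1 (w s0))) (0, 1) < - c" using crest by (auto simp: c_def)
  have "isCont (\<lambda>x. dx (dx (comp1 (w s0))) (x, 1)) 0"
    by (rule DERIV_isCont[OF Ck_has_dx[OF Ck_dx[OF Ck1x]]]) auto
  then have "\<forall>\<^sub>F x in nhds 0. dx (dx (comp1 (w s0))) (x, 1) < - c"
    using tendsto_at_iff_tendsto_nhds[of "\<lambda>x. dx (dx (comp1 (w s0))) (x, 1)" 0]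
    by (auto simp: isCont_def intro: order_tendstoD(2)[OF _ c(2)])
  then obtain \<delta> where \<delta>: "0 < \<delta>" "\<And>x. \<bar>x\<bar> < \<delta> \<Longrightarrow> dx (dx (comp1 (w s0))) (x, 1) < - c"
    by (auto simp: eventually_nhds_metric dist_real_def)
  define r where "r = min (\<delta> / 2) R"
  have r: "0 < r" "r < \<delta>" "r \<le> R" using \<delta> R by (auto simp: r_def)
  have "continuous_on {r..R} (\<lambda>x. dx (comp1 (w s0)) (x, 1))"
    by (rule continuous_on_strip_section_x[OF Ck_continuous[OF Ck1x]]) auto
  then obtain z where z: "z \<in> {r..R}" "\<forall>x\<in>{r..R}. dx (comp1 (w s0)) (x, 1) \<le> dx (comp1 (w s0)) (z, 1)"
    using continuous_attains_sup[of "{r..R}"] r by (metis atLeastatMost_empty_iff compact_Icc not_le)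
  define m where "m = - dx (comp1 (w s0)) (z, 1)"
  have m: "0 < m" using neg[of z 1] z r by (auto simp: m_def)
  have "0 < min c m" using c m by simp
  from eventually_close[OF s0 this] show ?thesis
  proof eventually_elim
    case (elim s)
    then interpret s: wave \<beta> \<gamma> \<epsilon>1 "w s" "\<alpha> s" by (intro wave) simp
    have close: "\<bar>partial i j (comp1 (w s)) (x, 1) - partial i j (comp1 (w s0)) (x, 1)\<bar> < min c m"
      if "i + j \<le> 3" for i j x using elim that by simp
    have xx: "dx (dx (comp1 (w s))) (x, 1) < 0" if "\<bar>x\<bar> < \<delta>" for x
      using close[of 2 0 x, unfolded partial_simps] \<delta>(2)[OF that] by (simp, linarith)
    show ?case
    proof (intro allI impI)
      fix x assume x: "0 < x" "x \<le> R"
      show "dx (comp1 (w s)) (x, 1) < 0"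
      proof (cases "x \<le> r")
        case True
        have "dx (comp1 (w s)) (x, 1) < dx (comp1 (w s)) (0, 1)"
          by (rule DERIV_neg_imp_decreasing[OF x(1)])
            (use s.dx_surface(2) xx True r in force)
        then show ?thesis using s.axis_zero(1)[of 1] by simp
      next
        case False
        then have "dx (comp1 (w s0)) (x, 1) \<le> - m" using z(2) x by (simp add: m_def)
        then show ?thesis
          using close[of 1 0 x, unfolded partial_simps] by (simp, linarith)
      qed
    qed
  qed
qed

text \<open>The order of choices matters: the far-field condition fixes R uniformly for nearby s,
  and only then is s restricted further so that the sign holds up to R.\<close>

lemma nodal_open:
  assumes s0: "0 < s0" and nod: "nodal (w s0)"
  shows "\<forall>\<^sub>F s in at s0 within {0<..}. nodal (w s)"
proof -
  obtain \<rho> where \<rho>: "0 < \<rho>" "\<rho> \<le> 1/2" "\<alpha> s0 + \<gamma> < (1 - 2 * \<rho>) * (1 + \<epsilon>1)"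
    using ex_rate[OF s0] by blast
  have "\<forall>\<^sub>F p in (at s0 within {0<..}) \<times>\<^sub>F at_top. far_field \<rho> (fst p) (snd p)"
  proof (rule eventually_far_field[OF s0 \<rho>(1,3)])
    have st: "filterlim (\<lambda>x. (x, 1)) strip_infinity at_top" by (rule strip_infinity_at_top) auto
    show "((\<lambda>x. partial i j (comp1 (w s0)) (x, 1)) \<longlongrightarrow> 0) at_top"
      "((\<lambda>x. partial i j (comp2 (w s0)) (x, 1)) \<longlongrightarrow> 0) at_top" if "i + j \<le> 2" for i j
      using filterlim_compose[OF C0_tendsto[OF X_comp1_C0[OF family_X[OF s0]] that] st]
        filterlim_compose[OF C0_tendsto[OF X_comp2_C0[OF family_X[OF s0]] that] st] by auto
  qed
  then obtain Q1 Q2 where Q: "eventually Q1 (at s0 within {0<..})" "eventually Q2 at_top"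
    "\<And>s x. Q1 s \<Longrightarrow> Q2 x \<Longrightarrow> far_field \<rho> s x"
    by (auto simp: eventually_prod_filter)
  obtain T where T: "\<And>x. T \<le> x \<Longrightarrow> Q2 x" using Q(2) by (auto simp: eventually_at_top_linorder)
  define R where "R = max T 1"
  have R: "0 < R" "\<And>x. R \<le> x \<Longrightarrow> Q2 x" using T by (auto simp: R_def)
  have "\<forall>\<^sub>F s in at s0 within {0<..}. 0 < s" by (auto simp: eventually_at_filter)
  with Q(1) eventually_near_crest[OF s0 nod R(1)] show ?thesis
  proof eventually_elim
    case (elim s)
    then interpret wave \<beta> \<gamma> \<epsilon>1 "w s" "\<alpha> s" by (intro wave) simp
    have "1 * dx (comp1 (w s)) (x, y) \<le> 0" if "0 \<le> x" "0 \<le> y" "y \<le> 1" for x y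
    proof (rule sign_propagates[OF \<rho>(1,2) less_imp_le[OF R(1)] _ _ _ that])
      show "1 * dx (comp1 (w s)) (x, 1) \<le> 0" if "0 < x" "x < R" for x
        using elim(2) that by (simp add: less_imp_le)
    qed (use Q(3)[OF elim(1) R(2)] in \<open>auto simp: far_field_def\<close>)
    then have le: "dx (comp1 (w s)) (x, y) \<le> 0" if "0 \<le> x" "0 \<le> y" "y \<le> 1" for x y
      using that by simp
    have "w s \<noteq> (\<lambda>_. 0)"
    proof
      assume "w s = (\<lambda>_. 0)"
      then have "dx (comp1 (w s)) (R, 1) = 0" by (intro dx_eqI) simp
      then show False using elim(2) R(1) by auto
    qed
    from rigidity_interior[OF this le] show ?case
      using nodal_iff[OF family_X[OF elim(3)]] by blast
  qed
qed

text \<open>Near a trivial wave the energy estimate applies to both \<open>\<eta>\<^sub>x\<close> and \<open>- \<eta>\<^sub>x\<close>.\<close>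
lemma trivial_isolated:
  assumes s0: "0 < s0" and triv: "w s0 = (\<lambda>_. 0)"
  shows "\<forall>\<^sub>F s in at s0 within {0<..}. \<not> nodal (w s)"
proof -
  obtain \<rho> where \<rho>: "0 < \<rho>" "\<rho> \<le> 1/2" "\<alpha> s0 + \<gamma> < (1 - 2 * \<rho>) * (1 + \<epsilon>1)"
    using ex_rate[OF s0] by blast
  have zero: "partial i j (\<lambda>_. 0) p = 0" if "i + j \<le> 2" "p \<in> closed_strip" for i j p
  proof -
    have "(\<lambda>_. 0) \<in> Ck (Suc (Suc (Suc 0)))" using X_comp1_Ck[OF family_X[OF s0]] by (simp only: triv fst_zero)
    \<comment> \<open>Used for 0 - 0, which is again the zero function.\<close>
    from partial_diff[OF this this _ that(2), of i j] that(1) show ?thesis by simp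
  qed
  \<comment> \<open>With \<open>principal UNIV\<close> the conditions hold at all surface points
    simultaneously, so \<open>sign_propagates\<close> can start at R = 0.\<close>
  have "\<forall>\<^sub>F p in (at s0 within {0<..}) \<times>\<^sub>F principal UNIV. far_field \<rho> (fst p) (snd p)"
    by (rule eventually_far_field[OF s0 \<rho>(1,3)]) (simp_all add: triv zero)
  then obtain Q1 Q2 where Q: "eventually Q1 (at s0 within {0<..})" "eventually Q2 (principal UNIV)"
    "\<And>s x. Q1 s \<Longrightarrow> Q2 x \<Longrightarrow> far_field \<rho> s x"
    by (auto simp: eventually_prod_filter)
  have "\<forall>\<^sub>F s in at s0 within {0<..}. 0 < s" by (auto simp: eventually_at_filter)
  with Q(1) show ?thesis
  proof eventually_elim
    case (elim s)
    then interpret wave \<beta> \<gamma> \<epsilon>1 "w s" "\<alpha> s" by (intro wave) simp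
    have far: "far_field \<rho> s x" for x
      by (rule Q(3)[OF elim(1)]) (use Q(2) in \<open>simp add: eventually_principal\<close>)
    have "c * dx (comp1 (w s)) (1, 1) \<le> 0" if "\<bar>c\<bar> = 1" for c
    proof (rule sign_propagates[where R = 0 and \<rho> = \<rho>, OF \<rho>(1,2) order.refl that])
      show "c * dx (comp1 (w s)) (x, 1) \<le> 0" if "0 < x" "x < 0" for x using that by simp
    qed (use far[unfolded far_field_def] in simp_all)
    from this[of "-1"] have "0 \<le> dx (comp1 (w s)) (1, 1)" by simp
    moreover have "dx (comp1 (w s)) (1, 1) < 0" if "nodal (w s)"
      using that unfolding nodal_iff[OF family_X[OF elim(2)]] by (rule allE[of _ 1]) simp
    ultimately show ?case by linarith
  qed
qed

text \<open>By rigidity a nontrivial wave that is not nodal has \<eta>_x > 0 at some point with x >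
  0 and y > 0, and this survives small perturbations; trivial waves need
  \<open>trivial_isolated\<close>.\<close>

lemma not_nodal_open:
  assumes s0: "0 < s0" and nnod: "\<not> nodal (w s0)"
  shows "\<forall>\<^sub>F s in at s0 within {0<..}. \<not> nodal (w s)"
proof (cases "w s0 = (\<lambda>_. 0)")
  case True
  then show ?thesis by (rule trivial_isolated[OF s0])
next
  case False
  interpret wave \<beta> \<gamma> \<epsilon>1 "w s0" "\<alpha> s0" by (rule wave[OF s0])
  have "\<exists>x y. 0 \<le> x \<and> 0 \<le> y \<and> y \<le> 1 \<and> 0 < dx (comp1 (w s0)) (x, y)"
  proof (rule ccontr)
    assume "\<not> ?thesis"
    then have "dx (comp1 (w s0)) (x, y) \<le> 0" if "0 \<le> x" "0 \<le> y" "y \<le> 1" for x y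
      using that by (meson not_le)
    from rigidity_interior[OF False this] show False
      using nnod nodal_iff[OF family_X[OF s0]] by blast
  qed
  then obtain x y where xy: "0 \<le> x" "0 \<le> y" "y \<le> 1" "0 < dx (comp1 (w s0)) (x, y)" by blast
  have "x \<noteq> 0" "y \<noteq> 0" using axis_zero(1)[of y] bed_zero(1)[of x] xy by auto
  then have xy': "0 < x" "0 < y" using xy by auto
  from eventually_close[OF s0 xy(4)] show ?thesis
  proof eventually_elim
    case (elim s)
    then have "\<bar>partial 1 0 (comp1 (w s)) (x, y) - partial 1 0 (comp1 (w s0)) (x, y)\<bar> < dx (comp1 (w s0)) (x, y)"
      using xy by force
    then have "0 < dx (comp1 (w s)) (x, y)" by (simp add: partial_simps)
    then show ?case using nodal_iff[OF family_X, of s] elim xy xy' by force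
  qed
qed

lemma nodal_everywhere:
  assumes "0 < s1" "nodal (w s1)" "0 < s"
  shows "nodal (w s)"
proof -
  have "nodal (w s) = nodal (w s1)"
  proof (rule connected_local_const[of "{0<..}"])
    show "\<forall>a\<in>{0<..}. \<forall>\<^sub>F b in at a within {0<..}. nodal (w a) = nodal (w b)"
    proof
      fix a :: real assume "a \<in> {0<..}"
      then show "\<forall>\<^sub>F b in at a within {0<..}. nodal (w a) = nodal (w b)"
        using nodal_open[of a] not_nodal_open[of a] by (cases "nodal (w a)") auto
    qed
  qed (use assms in auto)
  then show ?thesis using assms by simp
qed

end

theorem lemma5p6:
  fixes \<beta> \<gamma> \<epsilon>1 \<epsilon>star :: real
    and wloc w :: "real \<Rightarrow> plane \<Rightarrow> real \<times> real"
    and \<alpha> :: "real \<Rightarrow> real"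
  assumes "0 < \<beta>" and "\<beta> < 1"
    and "\<epsilon>1 > 0"
    and "alpha_cr \<gamma> \<epsilon>1 > 0"
    and "local_curve \<beta> \<gamma> \<epsilon>1 \<epsilon>star wloc"
    and "global_curve \<beta> \<gamma> \<epsilon>1 (loc_set \<gamma> \<epsilon>1 \<epsilon>star wloc) w \<alpha>"
  shows "\<forall>(v, a) \<in> global_set w \<alpha>. nodal v"
proof -
  interpret wave_family \<beta> \<gamma> \<epsilon>1 w \<alpha>
    using assms by unfold_locales (auto simp: global_curve_def global_set_def)
  \<comment> \<open>A single nodal wave on the global curve suffices as a seed; the midpoint of the
    local parameter interval provides it.\<close>
  have \<epsilon>: "0 < \<epsilon>star" and loc: "nodal (wloc (\<epsilon>star / 2))"
    using assms(5) by (auto simp: local_curve_def)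
  have "(wloc (\<epsilon>star / 2), alpha_cr \<gamma> \<epsilon>1 - \<epsilon>star / 2) \<in> loc_set \<gamma> \<epsilon>1 \<epsilon>star wloc"
    unfolding loc_set_def by (rule image_eqI[where x = "\<epsilon>star / 2"]) (use \<epsilon> in auto)
  moreover have "loc_set \<gamma> \<epsilon>1 \<epsilon>star wloc \<subseteq> global_set w \<alpha>"
    using assms(6) by (simp add: global_curve_def)
  ultimately have "(wloc (\<epsilon>star / 2), alpha_cr \<gamma> \<epsilon>1 - \<epsilon>star / 2) \<in> global_set w \<alpha>" by blast
  then obtain s1 where "0 < s1" "nodal (w s1)" using loc by (auto simp: global_set_def)
  then show ?thesis using nodal_everywhere by (auto simp: global_set_def)
qed

end
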